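(* Let $f\in C([0,T];D(A^{\varepsilon}))$ for some $\varepsilon\in(0,1)$. Then for any $\Phi\in D(A)$ the backward problem $$\sum_{j=1}^{M} q_j\,\partial_t^{\rho_j}u(t)+Au(t)=f(t),\quad 0<t<T,\qquad u(T)=\Phi,$$ has a unique solution $u$. Moreover, there exists a constant $C>0$ such that $$\|u(0)\|\le C\Big(\|u(T)\|_1+\max_{t\in[0,T]}\|f(t)\|_{\varepsilon}\Big).$$
   Context: $H$ is a separable Hilbert space with inner product $(\cdot,\cdot)$ and norm $\|\cdot\|$. $A$ is a positive self-adjoint operator in $H$ with domain $D(A)$ and compact inverse $A^{-1}$. Hence $A$ has a complete orthonormal system of eigenfunctions $\{v_k\}_{k\ge1}$ with eigenvalues $0<\lambda_1\le\lambda_2\le\cdots\to+\infty$. For $g\in H$ put $g_k=(g,v_k)$. For real $\varepsilon$: $D(A^{\varepsilon})=\{g\in H:\sum_{k=1}^\infty\lambda_k^{2\varepsilon}|g_k|^2<\infty\}$, $A^{\varepsilon}g=\sum_{k=1}^\infty\lambda_k^{\varepsilon}g_kv_k$, and $\|g\|_{\varepsilon}=\|A^{\varepsilon}g\|=\big(\sum_{k=1}^\infty\lambda_k^{2\varepsilon}|g_k|^2\big)^{1/2}$; in particular $\|g\|_1=\|Ag\|$. Continuity of functions with values in $D(A^\varepsilon)$ is with respect to $\|\cdot\|_\varepsilon$. $T>0$, $M\ge1$ is an integer, $0<\rho_M<\rho_{M-1}<\cdots<\rho_1<1$, $q_j>0$ for $j=1,\dots,M$, and $q_1=1$. The Caputo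 derivative of order $\rho_j$ is $$\partial_t^{\rho_j}h(t)=\frac{1}{\Gamma(1-\rho_j)}\int_0^t\frac{h'(s)}{(t-s)^{\rho_j}}\,ds,\quad t>0,$$ provided the right-hand side exists. The data $H$, $A$, $M$, $\rho_j$, $q_j$, $T$, $\varepsilon$ are fixed; the constant $C$ does not depend on $\Phi$, $f$ or $u$. A solution is a function $u\in C([0,T];H)$ such that for $0<t<T$ one has $u(t)\in D(A)$, the derivatives $\partial_t^{\rho_j}u(t)$ exist in $H$, and the equation holds in $H$, and such that the final condition $u(T)=\Phi$ holds.
   Formalization: In the Caputo derivative, h'(s)ds is read as the Stieltjes differential dh(s), which agrees with the formula when h' exists; with a pointwise h' existence fails, e.g. for M=1 and f=w(t)v_1 with w a lacunary Weierstrass series, as then u is nowhere differentiable. *)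

theory Defs
  imports "HOL-Analysis.Analysis"
begin

text \<open>
  Conventions: the Hilbert space is a type of classes real_inner and banach, separability is
  the class second_countable_topology.  A complex Hilbert space is covered by viewing it as a real one
  with the real part of its inner product.  An unbounded operator is a pair of a domain \<open>D\<close> and a total function \<open>A\<close>
  whose values outside \<open>D\<close> are irrelevant.
\<close>

definition linear_operator_on :: "'a::real_vector set \<Rightarrow> ('a \<Rightarrow> 'a) \<Rightarrow> bool" where
  "linear_operator_on D A \<longleftrightarrow>
     subspace D \<and>
     (\<forall>x\<in>D. \<forall>y\<in>D. A (x + y) = A x + A y) \<and>
     (\<forall>c. \<forall>x\<in>D. A (c *\<^sub>R x) = c *\<^sub>R A x)"

text \<open>The last conjunct says that the graph of the adjoint is the graph of \<open>A\<close>.\<close>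

definition self_adjoint_on :: "'a::real_inner set \<Rightarrow> ('a \<Rightarrow> 'a) \<Rightarrow> bool" where
  "self_adjoint_on D A \<longleftrightarrow>
     linear_operator_on D A \<and>
     closure D = UNIV \<and>
     (\<forall>y z. (\<forall>x\<in>D. inner (A x) y = inner x z) \<longleftrightarrow> y \<in> D \<and> z = A y)"

definition positive_on :: "'a::real_inner set \<Rightarrow> ('a \<Rightarrow> 'a) \<Rightarrow> bool" where
  "positive_on D A \<longleftrightarrow> (\<forall>x\<in>D. x \<noteq> 0 \<longrightarrow> inner (A x) x > 0)"

definition has_compact_inverse_on :: "'a::real_normed_vector set \<Rightarrow> ('a \<Rightarrow> 'a) \<Rightarrow> bool" where
  "has_compact_inverse_on D A \<longleftrightarrow>
     bij_betw A D UNIV \<and>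
     (\<forall>S. bounded S \<longrightarrow> compact (closure (inv_into D A ` S)))"

text \<open>Eigenfunctions and eigenvalues are numbered from \<open>0\<close>.\<close>

definition eigensystem ::
    "'a::real_inner set \<Rightarrow> ('a \<Rightarrow> 'a) \<Rightarrow> (nat \<Rightarrow> 'a) \<Rightarrow> (nat \<Rightarrow> real) \<Rightarrow> bool" where
  "eigensystem D A v lam \<longleftrightarrow>
     (\<forall>i j. inner (v i) (v j) = (if i = j then 1 else 0)) \<and>
     closure (span (range v)) = UNIV \<and>
     (\<forall>k. v k \<in> D \<and> A (v k) = lam k *\<^sub>R v k) \<and>
     0 < lam 0 \<and> mono lam \<and> filterlim lam at_top sequentially"

definition frac_domain :: "(nat \<Rightarrow> 'a::real_inner) \<Rightarrow> (nat \<Rightarrow> real) \<Rightarrow> real \<Rightarrow> 'a set" where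
  "frac_domain v lam \<epsilon> = {g. summable (\<lambda>k. lam k powr (2 * \<epsilon>) * \<bar>inner g (v k)\<bar>\<^sup>2)}"

definition frac_power :: "(nat \<Rightarrow> 'a::real_inner) \<Rightarrow> (nat \<Rightarrow> real) \<Rightarrow> real \<Rightarrow> 'a \<Rightarrow> 'a" where
  "frac_power v lam \<epsilon> g = (\<Sum>k. (lam k powr \<epsilon> * inner g (v k)) *\<^sub>R v k)"

definition frac_norm :: "(nat \<Rightarrow> 'a::real_inner) \<Rightarrow> (nat \<Rightarrow> real) \<Rightarrow> real \<Rightarrow> 'a \<Rightarrow> real" where
  "frac_norm v lam \<epsilon> g = norm (frac_power v lam \<epsilon> g)"

definition frac_continuous_on ::
    "(nat \<Rightarrow> 'a::real_inner) \<Rightarrow> (nat \<Rightarrow> real) \<Rightarrow> real \<Rightarrow> real set \<Rightarrow> (real \<Rightarrow> 'a) \<Rightarrow> bool" where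
  "frac_continuous_on v lam \<epsilon> S f \<longleftrightarrow>
     (\<forall>t\<in>S. f t \<in> frac_domain v lam \<epsilon>) \<and>
     (\<forall>t\<in>S. ((\<lambda>s. frac_norm v lam \<epsilon> (f s - f t)) \<longlongrightarrow> 0) (at t within S))"

text \<open>
  The integral of \<open>g(s) dh(s)\<close> over \<open>[a,b]\<close>: the library's definition of has_integral (see
  has_integral_real) with the length of each interval of a tagged division, times the
  value of \<open>h'\<close>, replaced by the increment of \<open>h\<close>.
\<close>

definition has_stieltjes_integral ::
    "(real \<Rightarrow> real) \<Rightarrow> (real \<Rightarrow> 'a::real_normed_vector) \<Rightarrow> 'a \<Rightarrow> real \<Rightarrow> real \<Rightarrow> bool" where
  "has_stieltjes_integral g h I a b \<longleftrightarrow>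
     (\<forall>e>0. \<exists>\<gamma>. gauge \<gamma> \<and>
        (\<forall>p. p tagged_division_of {a..b} \<and> \<gamma> fine p \<longrightarrow>
           norm ((\<Sum>(x, K)\<in>p. g x *\<^sub>R (h (Sup K) - h (Inf K))) - I) < e))"

text \<open>
  In the Caputo derivative
  \<open>1/\<Gamma>(1 - \<rho>) * (integral over s from 0 to t of h'(s) / (t - s) powr \<rho>)\<close>
  the measure \<open>h'(s) ds\<close> is read as \<open>dh(s)\<close>.  The lemma has_caputo_derivative_classical below shows
  that this only extends the formula: whenever \<open>h'\<close> exists on \<open>(0,t)\<close> and the integral exists, it
  yields the same value.  The extension is needed for right-hand sides \<open>f\<close> that are only continuous
  in time: already in the scalar equation of order \<open>\<rho>\<close> with a lacunary (Weierstrass) \<open>f\<close>, the solution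
  \<open>h\<close> behaves like the fractional integral of order \<open>\<rho>\<close> of \<open>f\<close> and is nowhere differentiable, so that
  there is no pointwise (or locally integrable weak) derivative \<open>h'\<close>.

  At the singular endpoint \<open>s = t\<close> the integrand has the value \<open>0 powr (-\<rho>) = 0\<close>.
\<close>

definition has_caputo_derivative ::
    "real \<Rightarrow> (real \<Rightarrow> 'a::real_normed_vector) \<Rightarrow> 'a \<Rightarrow> real \<Rightarrow> bool" where
  "has_caputo_derivative \<rho> h d t \<longleftrightarrow>
     (\<exists>I. has_stieltjes_integral (\<lambda>s. (t - s) powr (-\<rho>)) h I 0 t \<and>
          d = (1 / Gamma (1 - \<rho>)) *\<^sub>R I)"

lemma has_stieltjes_integral_classical:
  fixes h h' :: "real \<Rightarrow> 'a::real_normed_vector"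
  assumes t: "0 < t" and g0: "\<And>s. 0 \<le> g s" and gt: "g t = 0"
    and cont: "continuous_on {0..t} h"
    and deriv: "\<And>s. 0 < s \<Longrightarrow> s < t \<Longrightarrow> (h has_vector_derivative h' s) (at s)"
    and int: "((\<lambda>s. g s *\<^sub>R h' s) has_integral I) {0..t}"
  shows "has_stieltjes_integral g h I 0 t"
  unfolding has_stieltjes_integral_def
proof (intro allI impI)
  fix e :: real assume e: "e > 0"
  define \<eta> where "\<eta> = e / (2 * (t + 1))"
  have \<eta>: "\<eta> > 0" using e t by (simp add: \<eta>_def)
  \<comment> \<open>\<open>P u v\<close> dominates the length of \<open>[u,v]\<close> and gives the interval at \<open>0\<close> an extra unit of mass\<close>
  define P :: "real \<Rightarrow> real" where "P s = s + (if s > 0 then 1 else 0)" for s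
  obtain \<gamma>1 where \<gamma>1: "gauge \<gamma>1"
    and \<gamma>1': "\<And>p. p tagged_division_of {0..t} \<Longrightarrow> \<gamma>1 fine p \<Longrightarrow>
        norm ((\<Sum>(x, K)\<in>p. measure lborel K *\<^sub>R (g x *\<^sub>R h' x)) - I) < e / 2"
    using int e unfolding has_integral_real
    by (meson half_gt_zero)
  have "\<exists>\<delta>>0. \<forall>u v. u \<le> x \<and> x \<le> v \<and> 0 \<le> u \<and> v \<le> t \<and> {u..v} \<subseteq> ball x \<delta> \<longrightarrow>
      norm (g x *\<^sub>R (h v - h u) - (v - u) *\<^sub>R (g x *\<^sub>R h' x)) \<le> \<eta> * (P v - P u)" for x
  proof -
    consider "x = 0" | "0 < x \<and> x < t" | "x = t" | "x < 0 \<or> x > t" by linarith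
    then show ?thesis
    proof cases
      case 1
      define a where "a = g 0 + 1"
      have a: "a > 0" using g0[of 0] by (simp add: a_def)
      obtain \<delta>1 where \<delta>1: "\<delta>1 > 0"
        and \<delta>1': "\<And>v. v \<in> {0..t} \<Longrightarrow> dist v 0 < \<delta>1 \<Longrightarrow> dist (h v) (h 0) < \<eta> / (2 * a)"
        using cont t a \<eta> unfolding continuous_on_iff
        by (metis atLeastAtMost_iff divide_pos_pos less_eq_real_def mult_pos_pos zero_less_numeral)
      define b where "b = norm (g 0 *\<^sub>R h' 0) + 1"
      have b: "b > 0" unfolding b_def by (smt (verit) norm_ge_zero)
      define \<delta> where "\<delta> = min \<delta>1 (\<eta> / (2 * b))"
      have \<delta>: "\<delta> > 0" using \<delta>1 \<eta> b by (simp add: \<delta>_def)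
      have "norm (g x *\<^sub>R (h v - h u) - (v - u) *\<^sub>R (g x *\<^sub>R h' x)) \<le> \<eta> * (P v - P u)"
        if uv: "u \<le> x" "x \<le> v" "0 \<le> u" "v \<le> t" "{u..v} \<subseteq> ball x \<delta>" for u v
      proof (cases "v = 0")
        case True
        then show ?thesis using uv 1 by simp
      next
        case False
        have u: "u = 0" and v: "v > 0" using uv 1 False by auto
        have "v \<in> ball 0 \<delta>" using subsetD[OF uv(5), of v] uv 1 by simp
        then have vd: "v < \<delta>" using v by (simp add: dist_real_def)
        have "norm (g 0 *\<^sub>R (h v - h 0)) \<le> a * (\<eta> / (2 * a))"
          using \<delta>1'[of v] vd v uv g0[of 0] unfolding norm_scaleR
          by (intro mult_mono) (auto simp: a_def \<delta>_def dist_norm)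
        then have 2: "norm (g 0 *\<^sub>R (h v - h 0)) \<le> \<eta> / 2" using a by simp
        have "norm (v *\<^sub>R (g 0 *\<^sub>R h' 0)) \<le> (\<eta> / (2 * b)) * b"
          unfolding norm_scaleR[of v] using vd v \<eta> b
          by (intro mult_mono) (auto simp: b_def \<delta>_def)
        then have 3: "norm (v *\<^sub>R (g 0 *\<^sub>R h' 0)) \<le> \<eta> / 2" using b by simp
        have "norm (g 0 *\<^sub>R (h v - h 0) - v *\<^sub>R (g 0 *\<^sub>R h' 0)) \<le> \<eta>"
          using norm_triangle_ineq4[of "g 0 *\<^sub>R (h v - h 0)" "v *\<^sub>R (g 0 *\<^sub>R h' 0)"] 2 3 by linarith
        also have "\<eta> \<le> \<eta> * (P v - P u)" using v u \<eta> by (simp add: P_def)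
        finally show ?thesis using 1 u by simp
      qed
      then show ?thesis using \<delta> by blast
    next
      case 2
      define a where "a = g x + 1"
      have a: "a > 0" using g0[of x] by (simp add: a_def)
      have "(h has_derivative (\<lambda>y. y *\<^sub>R h' x)) (at x)"
        using deriv 2 unfolding has_vector_derivative_def by blast
      moreover have "\<eta> / a > 0" using \<eta> a by simp
      ultimately obtain \<delta>1 where \<delta>1: "\<delta>1 > 0"
        and \<delta>1': "\<And>y. norm (y - x) < \<delta>1 \<Longrightarrow>
             norm (h y - h x - (y - x) *\<^sub>R h' x) \<le> \<eta> / a * norm (y - x)"
        unfolding has_derivative_at_alt by blast
      define \<delta> where "\<delta> = min \<delta>1 x"
      have \<delta>: "\<delta> > 0" using \<delta>1 2 by (simp add: \<delta>_def)
      have "norm (g x *\<^sub>R (h v - h u) - (v - u) *\<^sub>R (g x *\<^sub>R h' x)) \<le> \<eta> * (P v - P u)"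
        if uv: "u \<le> x" "x \<le> v" "0 \<le> u" "v \<le> t" "{u..v} \<subseteq> ball x \<delta>" for u v
      proof -
        have "u \<in> ball x \<delta>" "v \<in> ball x \<delta>"
          using subsetD[OF uv(5), of u] subsetD[OF uv(5), of v] uv by simp_all
        then have d: "\<bar>u - x\<bar> < \<delta>1" "\<bar>v - x\<bar> < \<delta>1" "u > 0"
          using uv 2 by (auto simp: \<delta>_def dist_real_def)
        have "h v - h u - (v - u) *\<^sub>R h' x
            = (h v - h x - (v - x) *\<^sub>R h' x) - (h u - h x - (u - x) *\<^sub>R h' x)"
          by (simp add: algebra_simps)
        then have "norm (h v - h u - (v - u) *\<^sub>R h' x)
            \<le> norm (h v - h x - (v - x) *\<^sub>R h' x) + norm (h u - h x - (u - x) *\<^sub>R h' x)"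
          by (simp only: norm_triangle_ineq4)
        also have "\<dots> \<le> \<eta> / a * \<bar>v - x\<bar> + \<eta> / a * \<bar>u - x\<bar>"
          using \<delta>1'[of v] \<delta>1'[of u] d by simp
        also have "\<dots> = \<eta> / a * (v - u)" using uv a by (simp add: field_simps)
        finally have 3: "norm (h v - h u - (v - u) *\<^sub>R h' x) \<le> \<eta> / a * (v - u)" .
        have "g x *\<^sub>R (h v - h u) - (v - u) *\<^sub>R (g x *\<^sub>R h' x)
            = g x *\<^sub>R (h v - h u - (v - u) *\<^sub>R h' x)"
          by (simp add: scaleR_diff_right scaleR_left_commute)
        then have "norm (g x *\<^sub>R (h v - h u) - (v - u) *\<^sub>R (g x *\<^sub>R h' x))
            \<le> a * (\<eta> / a * (v - u))"
          using 3 g0[of x] by (simp only: norm_scaleR) (intro mult_mono, auto simp: a_def)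
        also have "\<dots> = \<eta> * (v - u)" using a by simp
        also have "\<dots> \<le> \<eta> * (P v - P u)"
          using \<eta> uv d by (simp add: P_def)
        finally show ?thesis .
      qed
      then show ?thesis using \<delta> by blast
    next
      case 3
      have "P u \<le> P v" if "u \<le> v" for u v using that by (simp add: P_def)
      then show ?thesis using 3 gt \<eta> by (intro exI[of _ 1]) auto
    next
      case 4
      then show ?thesis by (intro exI[of _ 1]) auto
    qed
  qed
  then have "\<exists>\<delta>. \<forall>x. \<delta> x > 0 \<and> (\<forall>u v. u \<le> x \<and> x \<le> v \<and> 0 \<le> u \<and> v \<le> t \<and> {u..v} \<subseteq> ball x (\<delta> x) \<longrightarrow>
      norm (g x *\<^sub>R (h v - h u) - (v - u) *\<^sub>R (g x *\<^sub>R h' x)) \<le> \<eta> * (P v - P u))"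
    by (intro choice allI)
  then obtain \<delta> where \<delta>: "\<And>x. \<delta> x > 0"
    and \<delta>': "\<And>x u v. u \<le> x \<Longrightarrow> x \<le> v \<Longrightarrow> 0 \<le> u \<Longrightarrow> v \<le> t \<Longrightarrow> {u..v} \<subseteq> ball x (\<delta> x) \<Longrightarrow>
      norm (g x *\<^sub>R (h v - h u) - (v - u) *\<^sub>R (g x *\<^sub>R h' x)) \<le> \<eta> * (P v - P u)"
    by blast
  define \<gamma> where "\<gamma> x = \<gamma>1 x \<inter> ball x (\<delta> x)" for x
  have gauge: "gauge \<gamma>" using \<gamma>1 \<delta> by (auto simp: \<gamma>_def gauge_def)
  have main: "norm ((\<Sum>(x, K)\<in>p. g x *\<^sub>R (h (Sup K) - h (Inf K))) - I) < e"
    if p: "p tagged_division_of {0..t}" and fine: "\<gamma> fine p" for p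
  proof -
    have f1: "\<gamma>1 fine p" and f2: "(\<lambda>x. ball x (\<delta> x)) fine p"
      using fine by (auto simp: fine_def \<gamma>_def)
    have "(\<Sum>(x, K)\<in>p. g x *\<^sub>R (h (Sup K) - h (Inf K))) - (\<Sum>(x, K)\<in>p. measure lborel K *\<^sub>R (g x *\<^sub>R h' x))
        = (\<Sum>(x, K)\<in>p. g x *\<^sub>R (h (Sup K) - h (Inf K)) - measure lborel K *\<^sub>R (g x *\<^sub>R h' x))"
      by (simp add: sum_subtractf split_def)
    also have "norm \<dots> \<le> (\<Sum>(x, K)\<in>p. \<eta> * (P (Sup K) - P (Inf K)))"
    proof (rule sum_norm_le, clarify)
      fix x K assume xK: "(x, K) \<in> p"
      obtain u v where K: "K = {u..v}"
        using tagged_division_ofD(4)[OF p xK] by (auto simp: cbox_interval)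
      have x: "x \<in> K" and sub: "K \<subseteq> {0..t}"
        using tagged_division_ofD(2,3)[OF p xK] by auto
      have uv: "u \<le> x" "x \<le> v" "u \<le> v" using x K by auto
      have "K \<subseteq> ball x (\<delta> x)" using f2 xK by (auto simp: fine_def)
      then show "norm (g x *\<^sub>R (h (Sup K) - h (Inf K)) - measure lborel K *\<^sub>R (g x *\<^sub>R h' x))
          \<le> \<eta> * (P (Sup K) - P (Inf K))"
        using \<delta>'[of u x v] uv sub by (simp add: K)
    qed
    also have "\<dots> = \<eta> * (\<Sum>(x, K)\<in>p. P (Sup K) - P (Inf K))"
      by (simp add: sum_distrib_left split_def)
    also have "(\<Sum>(x, K)\<in>p. P (Sup K) - P (Inf K)) = P t - P 0"
      using additive_tagged_division_1[OF _ p, of P] t by simp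
    also have "\<eta> * (P t - P 0) = e / 2" using t by (simp add: \<eta>_def P_def field_simps)
    finally have "norm ((\<Sum>(x, K)\<in>p. g x *\<^sub>R (h (Sup K) - h (Inf K)))
        - (\<Sum>(x, K)\<in>p. measure lborel K *\<^sub>R (g x *\<^sub>R h' x))) \<le> e / 2" .
    then show ?thesis
      using \<gamma>1'[OF p f1] norm_triangle_ineq[of
        "(\<Sum>(x, K)\<in>p. g x *\<^sub>R (h (Sup K) - h (Inf K))) - (\<Sum>(x, K)\<in>p. measure lborel K *\<^sub>R (g x *\<^sub>R h' x))"
        "(\<Sum>(x, K)\<in>p. measure lborel K *\<^sub>R (g x *\<^sub>R h' x)) - I"]
      by simp
  qed
  show "\<exists>\<gamma>. gauge \<gamma> \<and> (\<forall>p. p tagged_division_of {0..t} \<and> \<gamma> fine p \<longrightarrow>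
      norm ((\<Sum>(x, K)\<in>p. g x *\<^sub>R (h (Sup K) - h (Inf K))) - I) < e)"
    using gauge main by (intro exI[of _ \<gamma>] conjI allI impI) simp_all
qed

lemma has_caputo_derivative_classical:
  fixes h h' :: "real \<Rightarrow> 'a::real_normed_vector"
  assumes "0 < t" and "continuous_on {0..t} h"
    and "\<And>s. 0 < s \<Longrightarrow> s < t \<Longrightarrow> (h has_vector_derivative h' s) (at s)"
    and "((\<lambda>s. (1 / (t - s) powr \<rho>) *\<^sub>R h' s) has_integral I) {0..t}"
  shows "has_caputo_derivative \<rho> h ((1 / Gamma (1 - \<rho>)) *\<^sub>R I) t"
  unfolding has_caputo_derivative_def
  using assms by (intro exI[of _ I] conjI has_stieltjes_integral_classical[where h' = h'])
    (auto simp: powr_minus_divide)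

text \<open>
  The derivatives \<open>d j\<close> below are uniquely determined, being limits.  Only the values of \<open>u\<close> on
  \<open>[0,T]\<close> matter.
\<close>

definition backward_solution ::
    "'a::real_inner set \<Rightarrow> ('a \<Rightarrow> 'a) \<Rightarrow> nat \<Rightarrow> (nat \<Rightarrow> real) \<Rightarrow> (nat \<Rightarrow> real) \<Rightarrow> real \<Rightarrow>
     (real \<Rightarrow> 'a) \<Rightarrow> 'a \<Rightarrow> (real \<Rightarrow> 'a) \<Rightarrow> bool" where
  "backward_solution D A M \<rho> q T f \<Phi> u \<longleftrightarrow>
     continuous_on {0..T} u \<and>
     (\<forall>t\<in>{0<..<T}. u t \<in> D \<and>
        (\<exists>d. (\<forall>j\<in>{1..M}. has_caputo_derivative (\<rho> j) u (d j) t) \<and>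
             (\<Sum>j=1..M. q j *\<^sub>R d j) + A (u t) = f t)) \<and>
     u T = \<Phi>"

end

theory Submission
  imports Defs "HOL-Probability.Helly_Selection"
begin

text \<open>
  Expanding in the eigenfunctions reduces the equation to scalar ones.  Let
  \<open>k(t) = \<Sum>j. q j * t powr (-\<rho> j) / \<Gamma>(1 - \<rho> j)\<close> and, for an eigenvalue \<open>\<mu>\<close>, let \<open>r\<close> solve
  \<open>(\<mu> + k) * r = 1\<close> (a convolution).  With the relaxation \<open>s(t) = 1 - \<mu> \<integral>\<^sub>0\<^sup>t r\<close> the coefficient of a
  solution is \<open>s u(0) + r * f\<close>, so that going backward in time means dividing by \<open>s(T)\<close>.

  Everything rests on \<open>r\<close> being nonnegative and decreasing.  This holds because \<open>\<mu> + k\<close> is log-convex: for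
  sequences it is a theorem of Kaluza (\<open>kaluza_resolvent\<close>), and the continuous case follows by
  discretisation and Helly's selection theorem (\<open>sonine_partner_exists\<close>).  Monotonicity alone yields
  bounds that are uniform in \<open>\<mu>\<close>.  Comparing values inside the convolution gives
  \<open>t (\<mu> + k(t)) r(t) \<le> 1\<close> and \<open>s(T) \<ge> k(T) / (\<mu> + k(T))\<close>.  The second bound shows that division by \<open>s(T)\<close>
  costs one power of \<open>A\<close>, which is why \<open>\<Phi>\<close> is taken in \<open>D(A)\<close>.  The first one gives
  \<open>\<mu> powr (1 - \<epsilon>) * r(t) \<le> c t powr (\<rho> 1 * \<epsilon> - 1)\<close>, an integrable bound: the
  inhomogeneity only has to lie in \<open>D(A\<^sup>\<epsilon>)\<close> for \<open>A\<close> applied to the forced part to make sense.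

  The forced part \<open>W\<close> need not be differentiable, as \<open>f\<close> is only continuous in time.  It is
  therefore rewritten as the fractional integral of order \<open>\<rho> 1\<close> of a continuous function \<open>\<phi>\<close>, the solution of
  a Volterra equation of the second kind with right-hand side \<open>f - A W\<close> (\<open>frac_representation\<close>).  The
  Caputo derivatives of a fractional integral are explicit, because its truncated Stieltjes integrals are
  an approximate identity applied to \<open>\<phi>\<close> (\<open>caputo_frac_integral\<close>).  The free part is Lipschitz
  away from time \<open>0\<close>, uniformly over all modes (\<open>caputo_diag_relaxation\<close>).

  Uniqueness is a maximum principle: the Caputo derivative of a real function is nonnegative where
  the function attains its maximum over the past (\<open>stieltjes_nonneg_at_max\<close>).  So zero initial data force
  the zero solution, the difference of two backward solutions is a free evolution that vanishes at \<open>T\<close>, and it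
  vanishes because \<open>s(T) > 0\<close> in every mode.
\<close>

section \<open>Resolvents of log-convex kernels\<close>

text \<open>
  Kaluza's theorem.  Log-convexity makes the ratios of consecutive terms increase, so that
  comparing the recursions for two consecutive coefficients of the reciprocal power series shows that all its
  coefficients after the first are nonpositive.  The partial sums of these coefficients are \<open>r\<close>, hence \<open>r\<close> decreases;
  it is nonnegative because \<open>a\<close> decreases.
\<close>

lemma kaluza_resolvent:
  fixes a :: "nat \<Rightarrow> real"
  assumes pos: "\<And>n. 0 < a n"
    and dec: "\<And>n. a (Suc n) \<le> a n"
    and lc: "\<And>n. (a (Suc n))\<^sup>2 \<le> a n * a (Suc (Suc n))"
  obtains r where "\<And>n. (\<Sum>i\<le>n. a (n - i) * r i) = 1" and "\<And>n. 0 \<le> r n" and "decseq r"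
proof -
  define C where "C = inverse (Abs_fps a)"
  define c where "c = fps_nth C"
  define r where "r n = (\<Sum>i\<le>n. c i)" for n
  have a0: "a 0 \<noteq> 0" using pos[of 0] by simp
  have AC: "C * Abs_fps a = 1"
    unfolding C_def using a0 by (simp add: inverse_mult_eq_1)
  have conv: "(\<Sum>i\<le>n. a (n - i) * c i) = (if n = 0 then 1 else 0)" for n
  proof -
    have "fps_nth (C * Abs_fps a) n = (\<Sum>i\<le>n. a (n - i) * c i)"
      by (simp add: fps_mult_nth c_def mult.commute atMost_atLeast0)
    then show ?thesis by (simp add: AC)
  qed
  have c0: "c 0 > 0" using conv[of 0] pos[of 0] by (simp add: zero_less_mult_iff) (metis less_numeral_extra(1) zero_less_mult_pos)
  have ratio: "a (Suc m) / a m \<le> a (Suc n) / a n" if "m \<le> n" for m n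
    using that
  proof (induction n rule: dec_induct)
    case (step n)
    have "a (Suc n) / a n \<le> a (Suc (Suc n)) / a (Suc n)"
      using lc[of n] pos[of n] pos[of "Suc n"] by (simp add: field_simps power2_eq_square)
    with step show ?case by linarith
  qed simp
  have cneg: "c (Suc n) \<le> 0" for n
  proof (induction n rule: less_induct)
    case (less n)
    \<comment> \<open>Among the ratios that occur, \<open>R\<close> is the largest and belongs to the only positive coefficient \<open>c 0\<close>.\<close>
    define R where "R = a (Suc n) / a n"
    have R: "R \<ge> 0" unfolding R_def using pos[of n] pos[of "Suc n"] by simp
    have tm: "a (Suc n - i) * c i \<ge> R * (a (n - i) * c i)" if i: "i \<le> n" for i
    proof (cases i)
      case 0
      then show ?thesis using pos[of n] by (simp add: R_def)
    next
      case (Suc j)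
      have "a (Suc (n - i)) / a (n - i) \<le> R"
        unfolding R_def by (rule ratio) simp
      then have "a (Suc (n - i)) \<le> R * a (n - i)"
        using pos[of "n - i"] by (simp add: divide_le_eq)
      moreover have "c i \<le> 0" using less[of j] Suc i by simp
      ultimately have "R * a (n - i) * c i \<le> a (Suc (n - i)) * c i"
        by (rule mult_right_mono_neg)
      then show ?thesis using i by (simp add: Suc_diff_le mult.assoc)
    qed
    have "0 \<le> R * (\<Sum>i\<le>n. a (n - i) * c i)" using R conv[of n] by simp
    also have "\<dots> \<le> (\<Sum>i\<le>n. a (Suc n - i) * c i)"
      unfolding sum_distrib_left by (rule sum_mono) (use tm in auto)
    finally have "a 0 * c (Suc n) \<le> 0" using conv[of "Suc n"] by simp
    then show ?case using pos[of 0] by (simp add: mult_le_0_iff)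
  qed
  have rconv: "(\<Sum>i\<le>n. a (n - i) * r i) = 1" for n
  proof -
    have r_nth: "r i = fps_nth (C * Abs_fps (\<lambda>_. 1)) i" for i
      by (simp add: fps_mult_nth r_def c_def atMost_atLeast0)
    have "(\<Sum>i\<le>n. a (n - i) * r i) = fps_nth ((C * Abs_fps (\<lambda>_. 1)) * Abs_fps a) n"
      unfolding fps_mult_nth[of "C * Abs_fps (\<lambda>_. 1)"] r_nth by (simp add: mult.commute atMost_atLeast0)
    also have "(C * Abs_fps (\<lambda>_. 1)) * Abs_fps a = (C * Abs_fps a) * Abs_fps (\<lambda>_. 1)"
      by (simp only: ac_simps)
    also have "fps_nth \<dots> n = 1" by (simp add: AC)
    finally show ?thesis .
  qed
  have rdec: "decseq r" unfolding decseq_Suc_iff r_def using cneg by simp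
  have rpos: "0 \<le> r n" for n
  proof (induction n rule: less_induct)
    case (less n)
    show ?case
    proof (cases n)
      case 0
      then show ?thesis using c0 by (simp add: r_def)
    next
      case (Suc m)
      have "a 0 * r n = 1 - (\<Sum>i\<le>m. a (Suc m - i) * r i)"
        using rconv[of "Suc m"] Suc by simp
      also have "\<dots> = (\<Sum>i\<le>m. a (m - i) * r i) - (\<Sum>i\<le>m. a (Suc m - i) * r i)"
        by (simp add: rconv)
      also have "\<dots> = (\<Sum>i\<le>m. (a (m - i) - a (Suc (m - i))) * r i)"
        by (simp add: sum_subtractf[symmetric] left_diff_distrib Suc_diff_le)
      also have "\<dots> \<ge> 0"
        by (intro sum_nonneg mult_nonneg_nonneg) (use dec less Suc in auto)
      finally show ?thesis using pos[of 0] by (simp add: zero_le_mult_iff)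
    qed
  qed
  show ?thesis using that rconv rpos rdec by blast
qed

lemma has_integral_floor_step:
  fixes G :: "nat \<Rightarrow> real"
  assumes h: "0 < h"
  shows "((\<lambda>s. G (nat \<lfloor>s / h\<rfloor>)) has_integral h * (\<Sum>i<n. G i)) {0..real n * h}"
proof (induction n)
  case (Suc n)
  have eq: "nat \<lfloor>s / h\<rfloor> = n" if "s \<in> {real n * h..real (Suc n) * h} - {real (Suc n) * h}" for s
  proof -
    have "real n \<le> s / h" "s / h < real n + 1" using that h by (auto simp: field_simps)
    then have "\<lfloor>s / h\<rfloor> = int n" by linarith
    then show ?thesis by simp
  qed
  have c: "((\<lambda>s. G n) has_integral h * G n) {real n * h..real (Suc n) * h}"
    using has_integral_const_real[of "G n" "real n * h" "real (Suc n) * h"] h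
    by (simp add: algebra_simps)
  have "((\<lambda>s. G (nat \<lfloor>s / h\<rfloor>)) has_integral h * G n) {real n * h..real (Suc n) * h}"
    by (rule has_integral_spike_finite[OF _ _ c, of "{real (Suc n) * h}"]) (use eq in auto)
  from has_integral_combine[OF _ _ Suc this]
  show ?case using h by (simp add: algebra_simps)
qed (simp add: has_integral_refl)

text \<open>
  Helly's selection theorem is about right-continuous functions.
\<close>

lemma isCont_right_floor_step:
  fixes G :: "nat \<Rightarrow> real" and h x :: real
  assumes h: "0 < h"
  shows "continuous (at_right x) (\<lambda>s. if s < 0 then 0 else G (nat \<lfloor>s / h\<rfloor>))"
proof (cases "x < 0")
  case True
  have "eventually (\<lambda>s. s < 0) (at_right x)"
    using True eventually_at_right_field[of "\<lambda>s. s < 0" x] by blast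
  then show ?thesis
    unfolding continuous_within using True
    by (intro tendsto_eventually) (auto elim!: eventually_mono)
next
  case False
  have "x < (of_int \<lfloor>x / h\<rfloor> + 1) * h"
    using h floor_correct[of "x/h"] by (simp add: field_simps)
  from eventually_at_right_real[OF this]
  have "eventually (\<lambda>s. \<lfloor>s / h\<rfloor> = \<lfloor>x / h\<rfloor> \<and> s > x) (at_right x)"
  proof eventually_elim
    case (elim s)
    have "x / h < s / h" using elim h by (simp add: divide_strict_right_mono)
    then have "of_int \<lfloor>x / h\<rfloor> \<le> s / h" using floor_correct[of "x/h"] by linarith
    moreover have "s / h < of_int \<lfloor>x / h\<rfloor> + 1" using elim h by (simp add: field_simps)
    ultimately show ?case using elim by (simp add: floor_unique)
  qed
  then show ?thesis
    unfolding continuous_within using False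
    by (intro tendsto_eventually) (auto elim!: eventually_mono)
qed

text \<open>
  The dominating function for the passage to the limit in the discretised equation: on either
  half of the interval only one of the two factors is singular.
\<close>

lemma set_integrable_product_powr:
  fixes \<kappa> :: "real \<Rightarrow> real"
  assumes t: "0 < t" and \<alpha>: "0 < \<alpha>" "\<alpha> < 1"
    and pos: "\<And>s. 0 < s \<Longrightarrow> 0 \<le> \<kappa> s"
    and dec: "\<And>s u. 0 < s \<Longrightarrow> s \<le> u \<Longrightarrow> \<kappa> u \<le> \<kappa> s"
    and meas: "set_borel_measurable borel {0<..} \<kappa>"
    and int: "set_integrable lborel {0<..<t} \<kappa>"
  shows "set_integrable lborel {0<..<t} (\<lambda>s. \<kappa> (t - s) * s powr (\<alpha> - 1))"
proof -
  have int': "set_integrable lborel {0<..<t} (\<lambda>s. \<kappa> (t - s))"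
    using int unfolding set_integrable_def
    by (subst (asm) lborel_integrable_real_affine_iff[of "-1" _ t, symmetric])
       (simp_all add: indicator_def conj_commute cong: if_cong)
  have pint: "set_integrable lborel {0<..<t} (\<lambda>s. s powr (\<alpha> - 1))"
  proof -
    have "(\<lambda>s. s powr (\<alpha> - 1)) integrable_on {0..t}"
      by (rule integrable_on_powr_from_0) (use \<alpha> t in auto)
    then have "(\<lambda>s. s powr (\<alpha> - 1)) absolutely_integrable_on {0..t}"
      by (rule nonnegative_absolutely_integrable_1) simp
    then have "(\<lambda>s. s powr (\<alpha> - 1)) absolutely_integrable_on {0<..<t}"
      by (rule set_integrable_subset) auto
    then show ?thesis
      unfolding set_integrable_def by (subst (asm) integrable_completion) auto
  qed
  have bnd: "set_integrable lborel {0<..<t} (\<lambda>s. \<kappa> (t/2) * s powr (\<alpha> - 1) + (t/2) powr (\<alpha> - 1) * \<kappa> (t - s))"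
    using int' pint by (intro set_integral_add set_integrable_mult_right) auto
  show ?thesis
  proof (rule set_integrable_bound[OF bnd])
    have "(\<lambda>s. indicator {0<..} (t - s) *\<^sub>R \<kappa> (t - s)) \<in> borel_measurable borel"
      using meas unfolding set_borel_measurable_def by (rule measurable_compose[rotated]) auto
    then have "(\<lambda>s. indicator {0<..<t} s *\<^sub>R ((indicator {0<..} (t - s) *\<^sub>R \<kappa> (t - s)) * s powr (\<alpha> - 1))) \<in> borel_measurable borel"
      by measurable
    also have "(\<lambda>s. indicator {0<..<t} s *\<^sub>R ((indicator {0<..} (t - s) *\<^sub>R \<kappa> (t - s)) * s powr (\<alpha> - 1)))
        = (\<lambda>s. indicator {0<..<t} s *\<^sub>R (\<kappa> (t - s) * s powr (\<alpha> - 1)))"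
      by (auto simp: indicator_def fun_eq_iff)
    finally show "set_borel_measurable lborel {0<..<t} (\<lambda>s. \<kappa> (t - s) * s powr (\<alpha> - 1))"
      unfolding set_borel_measurable_def by simp
    show "AE s\<in>{0<..<t} in lborel. norm (\<kappa> (t - s) * s powr (\<alpha> - 1))
        \<le> norm (\<kappa> (t/2) * s powr (\<alpha> - 1) + (t/2) powr (\<alpha> - 1) * \<kappa> (t - s))"
    proof (intro AE_I2 impI)
      fix s assume s: "s \<in> {0<..<t}"
      have p: "0 \<le> \<kappa> (t - s)" "0 \<le> \<kappa> (t/2)" using pos s t by auto
      have "\<kappa> (t - s) * s powr (\<alpha> - 1) \<le> \<kappa> (t/2) * s powr (\<alpha> - 1) + (t/2) powr (\<alpha> - 1) * \<kappa> (t - s)"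
      proof (cases "s \<le> t/2")
        case True
        then have "\<kappa> (t - s) \<le> \<kappa> (t/2)" using dec[of "t/2" "t - s"] t by simp
        then have "\<kappa> (t - s) * s powr (\<alpha> - 1) \<le> \<kappa> (t/2) * s powr (\<alpha> - 1)" by (simp add: mult_right_mono)
        then show ?thesis using p by (simp add: add_increasing2)
      next
        case False
        then have "s powr (\<alpha> - 1) \<le> (t/2) powr (\<alpha> - 1)"
          using t \<alpha> by (intro powr_mono2') auto
        then have "\<kappa> (t - s) * s powr (\<alpha> - 1) \<le> (t/2) powr (\<alpha> - 1) * \<kappa> (t - s)"
          using p by (simp add: mult_left_mono mult.commute)
        then show ?thesis using p by (simp add: add_increasing)
      qed
      then show "norm (\<kappa> (t - s) * s powr (\<alpha> - 1))
        \<le> norm (\<kappa> (t/2) * s powr (\<alpha> - 1) + (t/2) powr (\<alpha> - 1) * \<kappa> (t - s))"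
        using p by simp
    qed
  qed
qed

text \<open>
  The equation is discretised with step \<open>h\<close> and solved by Kaluza's theorem.  The discrete equation
  itself bounds its decreasing solution by \<open>s powr (\<alpha> - 1) / c\<close>, independently of \<open>h\<close>, so that Helly's theorem gives
  convergence along a subsequence outside the countably many jumps of the limit, and dominated convergence gives
  the equation for the limit.
\<close>

lemma sonine_partner_exists:
  fixes \<kappa> :: "real \<Rightarrow> real"
  assumes \<alpha>: "0 < \<alpha>" "\<alpha> < 1" and c: "0 < c"
    and low: "\<And>s. 0 < s \<Longrightarrow> c * s powr (-\<alpha>) \<le> \<kappa> s"
    and dec: "\<And>s u. 0 < s \<Longrightarrow> s \<le> u \<Longrightarrow> \<kappa> u \<le> \<kappa> s"
    and cont: "continuous_on {0<..} \<kappa>"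
    and lc: "\<And>s h. 0 < h \<Longrightarrow> h < s \<Longrightarrow> (\<kappa> s)\<^sup>2 \<le> \<kappa> (s - h) * \<kappa> (s + h)"
    and int: "\<And>b. 0 < b \<Longrightarrow> set_integrable lborel {0<..<b} \<kappa>"
    and small: "((\<lambda>s. s * \<kappa> s) \<longlongrightarrow> 0) (at_right 0)"
  obtains r where "r \<in> borel_measurable borel"
    and "\<And>s. 0 < s \<Longrightarrow> 0 \<le> r s"
    and "\<And>s u. 0 < s \<Longrightarrow> s \<le> u \<Longrightarrow> r u \<le> r s"
    and "\<And>s. 0 < s \<Longrightarrow> r s \<le> s powr (\<alpha> - 1) / c"
    and "\<And>t. 0 < t \<Longrightarrow> (LINT s:{0<..<t}|lborel. \<kappa> (t - s) * r s) = 1"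
proof -
  have kpos: "0 < \<kappa> s" if "0 < s" for s
    using low[OF that] c that by (smt (verit) mult_pos_pos powr_gt_zero)
  have kmeas: "set_borel_measurable borel {0<..} \<kappa>"
    unfolding set_borel_measurable_def
    using borel_measurable_continuous_on_indicator[OF _ cont] by simp
  define h where "h n = inverse (real (Suc n))" for n
  have h: "0 < h n" for n by (simp add: h_def)
  have h0: "h \<longlonglongrightarrow> 0" unfolding h_def by (rule LIMSEQ_inverse_real_of_nat)
  have "\<exists>r. (\<forall>m. (\<Sum>i\<le>m. h n * \<kappa> (real (Suc (m - i)) * h n) * r i) = 1) \<and> (\<forall>m. 0 \<le> r m) \<and> decseq r" for n
  proof -
    have 1: "0 < h n * \<kappa> (real (Suc m) * h n)" for m
      using h[of n] kpos[of "real (Suc m) * h n"] by simp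
    have 2: "h n * \<kappa> (real (Suc (Suc m)) * h n) \<le> h n * \<kappa> (real (Suc m) * h n)" for m
      using h[of n] by (intro mult_left_mono dec mult_pos_pos mult_right_mono) auto
    have 3: "(h n * \<kappa> (real (Suc (Suc m)) * h n))\<^sup>2 \<le> (h n * \<kappa> (real (Suc m) * h n)) * (h n * \<kappa> (real (Suc (Suc (Suc m))) * h n))" for m
    proof -
      have hm: "0 < h n + real m * h n" using h[of n] by (intro add_pos_nonneg mult_nonneg_nonneg) auto
      have "(\<kappa> (real (Suc (Suc m)) * h n))\<^sup>2 \<le> \<kappa> (real (Suc (Suc m)) * h n - h n) * \<kappa> (real (Suc (Suc m)) * h n + h n)"
        using h[of n] hm by (intro lc) (simp_all add: distrib_right)
      then have "(\<kappa> (real (Suc (Suc m)) * h n))\<^sup>2 \<le> \<kappa> (real (Suc m) * h n) * \<kappa> (real (Suc (Suc (Suc m))) * h n)"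
        by (simp add: algebra_simps)
      then show ?thesis using h[of n]
        by (simp add: power_mult_distrib power2_eq_square[of "h n"] mult_left_mono mult.assoc mult.left_commute)
    qed
    show ?thesis
      using kaluza_resolvent[of "\<lambda>m. h n * \<kappa> (real (Suc m) * h n)", OF 1 2 3] by metis
  qed
  then obtain R where Rsum: "\<And>n m. (\<Sum>i\<le>m. h n * \<kappa> (real (Suc (m - i)) * h n) * R n i) = 1"
    and Rpos: "\<And>n m. 0 \<le> R n m" and Rdec: "\<And>n. decseq (R n)" by metis
  define rn where "rn n s = R n (nat \<lfloor>s / h n\<rfloor>)" for n s
  have rnpos: "0 \<le> rn n s" for n s by (simp add: rn_def Rpos)
  have rndec: "rn n u \<le> rn n s" if "s \<le> u" for n s u
    unfolding rn_def by (rule decseqD[OF Rdec]) (use that h[of n] in \<open>simp add: floor_mono nat_mono divide_right_mono\<close>)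
  have fl: "real (nat \<lfloor>s / h n\<rfloor>) * h n \<le> s" "s < real (Suc (nat \<lfloor>s / h n\<rfloor>)) * h n" if "0 \<le> s" for n s
  proof -
    have "0 \<le> s / h n" using that h[of n] by simp
    then have "real (nat \<lfloor>s / h n\<rfloor>) \<le> s / h n" "s / h n < real (nat \<lfloor>s / h n\<rfloor>) + 1"
      using floor_correct[of "s / h n"] by simp_all
    then show "real (nat \<lfloor>s / h n\<rfloor>) * h n \<le> s" "s < real (Suc (nat \<lfloor>s / h n\<rfloor>)) * h n"
      using h[of n] by (simp_all add: field_simps)
  qed
  \<comment> \<open>By monotonicity each term of the discrete equation up to index \<open>m\<close> is at least the one with
    \<open>\<kappa> \<sigma>\<close> and \<open>R n m\<close>, so \<open>\<sigma> \<kappa>(\<sigma>) R n m \<le> 1\<close>.\<close>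
  have rnbd: "rn n s \<le> s powr (\<alpha> - 1) / c" if s: "0 < s" for n s
  proof -
    define m where "m = nat \<lfloor>s / h n\<rfloor>"
    define \<sigma> where "\<sigma> = real (Suc m) * h n"
    have \<sigma>: "s < \<sigma>" using fl[of s n] s by (simp add: \<sigma>_def m_def)
    have "\<sigma> * \<kappa> \<sigma> * R n m = (\<Sum>i\<le>m. h n * \<kappa> \<sigma> * R n m)" by (simp add: \<sigma>_def algebra_simps)
    also have "\<dots> \<le> (\<Sum>i\<le>m. h n * \<kappa> (real (Suc (m - i)) * h n) * R n i)"
    proof (rule sum_mono)
      fix i assume i: "i \<in> {..m}"
      have p: "0 < real (Suc (m - i)) * h n" using h[of n] by (intro mult_pos_pos) auto
      have le: "real (Suc (m - i)) * h n \<le> \<sigma>"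
        unfolding \<sigma>_def using h[of n] by (intro mult_right_mono) auto
      show "h n * \<kappa> \<sigma> * R n m \<le> h n * \<kappa> (real (Suc (m - i)) * h n) * R n i"
        using h[of n] dec[OF p le] kpos[OF p] Rpos decseqD[OF Rdec, of i m n] i
        by (intro mult_mono mult_left_mono) auto
    qed
    also have "\<dots> = 1" by (rule Rsum)
    finally have 1: "\<sigma> * \<kappa> \<sigma> * R n m \<le> 1" .
    have "c * \<sigma> powr (1 - \<alpha>) = \<sigma> * (c * \<sigma> powr (-\<alpha>))"
      using \<sigma> s by (simp add: powr_diff powr_minus field_simps)
    also have "\<dots> \<le> \<sigma> * \<kappa> \<sigma>" using \<sigma> s low[of \<sigma>] by (simp add: mult_left_mono)
    finally have "c * \<sigma> powr (1 - \<alpha>) * R n m \<le> 1" using 1 Rpos[of n m]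
      by (smt (verit) mult_right_mono)
    moreover have "c * s powr (1 - \<alpha>) * R n m \<le> c * \<sigma> powr (1 - \<alpha>) * R n m"
      using c \<sigma> s \<alpha> Rpos[of n m] by (intro mult_right_mono mult_left_mono powr_mono2) auto
    ultimately have "c * s powr (1 - \<alpha>) * R n m \<le> 1" by linarith
    moreover have "s powr (1 - \<alpha>) * s powr (\<alpha> - 1) = 1"
      using s by (simp add: powr_add[symmetric])
    moreover have "0 < c * s powr (1 - \<alpha>)" using c s by simp
    ultimately have "R n m \<le> 1 / (c * s powr (1 - \<alpha>))" by (simp add: field_simps)
    also have "\<dots> = s powr (\<alpha> - 1) / c"
      using \<open>s powr (1 - \<alpha>) * s powr (\<alpha> - 1) = 1\<close> s c by (simp add: field_simps)
    finally show ?thesis by (simp add: rn_def m_def)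
  qed
  \<comment> \<open>The steps \<open>rn n\<close> are unbounded near \<open>0\<close>; this transform makes them increasing and bounded by \<open>1\<close>.\<close>
  define f where "f n s = (if s < 0 then 0 else 1 / (1 + rn n s))" for n s
  have fmono: "mono (f n)" for n
  proof (rule monoI)
    fix s u :: real assume "s \<le> u"
    then have "1 / (1 + rn n s) \<le> 1 / (1 + rn n u)"
      using rndec[of s u n] rnpos[of n u] by (intro divide_left_mono) (auto simp: add_pos_nonneg)
    then show "f n s \<le> f n u" using \<open>s \<le> u\<close> rnpos[of n u] by (auto simp: f_def)
  qed
  have fbd: "0 \<le> f n s" "f n s \<le> 1" for n s
    using rnpos[of n s] by (auto simp: f_def)
  have "\<exists>s. strict_mono (s::nat \<Rightarrow> nat) \<and> (\<exists>F. (\<forall>x. continuous (at_right x) F) \<and> mono F \<and> (\<forall>x. \<bar>F x\<bar> \<le> 1) \<and>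
    (\<forall>x. continuous (at x) F \<longrightarrow> (\<lambda>n. f (s n) x) \<longlonglongrightarrow> F x))"
  proof (rule Helly_selection)
    show "continuous (at_right x) (f n)" for n x
      unfolding f_def rn_def using isCont_right_floor_step[OF h[of n], of x "\<lambda>i. 1 / (1 + R n i)"] .
    show "\<bar>f n x\<bar> \<le> 1" for n x using fbd[of n x] by simp
  qed (rule fmono)
  then obtain \<nu> :: "nat \<Rightarrow> nat" and F where \<nu>: "strict_mono \<nu>" and Fmono: "mono F" and Fbd: "\<And>x. \<bar>F x\<bar> \<le> 1"
    and Flim: "\<And>x. continuous (at x) F \<Longrightarrow> (\<lambda>n. f (\<nu> n) x) \<longlonglongrightarrow> F x" by blast
  have ctb: "countable {x. \<not> isCont F x}" using mono_ctble_discont[OF Fmono] .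
  have contpt: "\<exists>y. a < y \<and> y < b \<and> isCont F y" if "a < b" for a b
    using real_interval_avoid_countable_set[OF that ctb] by auto
  have Fcont_lb: "1 / (1 + y powr (\<alpha> - 1) / c) \<le> F y" if "0 < y" "isCont F y" for y
  proof (rule LIMSEQ_le_const[OF Flim[OF that(2)]], intro exI allI impI)
    fix n show "1 / (1 + y powr (\<alpha> - 1) / c) \<le> f (\<nu> n) y"
      using rnbd[of y "\<nu> n"] rnpos[of "\<nu> n" y] that c unfolding f_def
      by (auto intro!: divide_left_mono mult_pos_pos add_pos_nonneg)
  qed
  have Fpos: "0 < F s" if s: "0 < s" for s
  proof -
    obtain y where y: "0 < y" "y < s" "isCont F y" using contpt[OF s] by blast
    have "0 < 1 / (1 + y powr (\<alpha> - 1) / c)" using c by (simp add: add_pos_nonneg)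
    also have "\<dots> \<le> F y" by (rule Fcont_lb) (use y in auto)
    also have "\<dots> \<le> F s" using monoD[OF Fmono, of y s] y by simp
    finally show ?thesis .
  qed
  define r where "r s = 1 / F s - 1" for s
  have Fmeas: "F \<in> borel_measurable borel" by (rule borel_measurable_mono[OF Fmono])
  have rmeas [measurable]: "r \<in> borel_measurable borel" unfolding r_def using Fmeas by measurable
  have rpos: "0 \<le> r s" if "0 < s" for s
    using Fpos[OF that] Fbd[of s] by (simp add: r_def field_simps)
  have rdec: "r u \<le> r s" if "0 < s" "s \<le> u" for s u
    using Fpos[of s] that monoD[OF Fmono, of s u] unfolding r_def by (simp add: frac_le)
  have rlim: "(\<lambda>n. rn (\<nu> n) s) \<longlonglongrightarrow> r s" if "0 < s" "isCont F s" for s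
  proof -
    have "(\<lambda>n. 1 / f (\<nu> n) s - 1) \<longlonglongrightarrow> r s"
      unfolding r_def using Fpos[OF that(1)] by (intro tendsto_intros Flim that) simp
    moreover have "1 / f (\<nu> n) s - 1 = rn (\<nu> n) s" for n
      using that by (simp add: f_def)
    ultimately show ?thesis by simp
  qed
  have rbd: "r s \<le> s powr (\<alpha> - 1) / c" if s: "0 < s" for s
  proof -
    have at_cont: "r y \<le> y powr (\<alpha> - 1) / c" if "0 < y" "isCont F y" for y
      by (rule LIMSEQ_le_const2[OF rlim[OF that]]) (use rnbd that in auto)
    have "((\<lambda>y. y powr (\<alpha> - 1) / c) \<longlongrightarrow> s powr (\<alpha> - 1) / c) (at s)"
      using s c by (intro tendsto_intros) auto
    show ?thesis
    proof (rule ccontr)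
      assume "\<not> ?thesis"
      then have "eventually (\<lambda>y. y powr (\<alpha> - 1) / c < r s) (at s)"
        using order_tendstoD(2)[OF \<open>((\<lambda>y. y powr (\<alpha> - 1) / c) \<longlongrightarrow> s powr (\<alpha> - 1) / c) (at s)\<close>] by simp
      then obtain d where d: "d > 0" "\<And>y. y \<noteq> s \<Longrightarrow> dist y s < d \<Longrightarrow> y powr (\<alpha> - 1) / c < r s"
        unfolding eventually_at by auto
      obtain y where y: "max (s/2) (s - d) < y" "y < s" "isCont F y"
        using contpt[of "max (s/2) (s - d)" s] s d by auto
      then have "r s \<le> r y" using rdec[of y s] s by auto
      also have "\<dots> \<le> y powr (\<alpha> - 1) / c" using at_cont[of y] y s by auto
      also have "\<dots> < r s" using d(2)[of y] y by (auto simp: dist_real_def)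
      finally show False by simp
    qed
  qed
  have conv: "(LINT s:{0<..<t}|lborel. \<kappa> (t - s) * r s) = 1" if t: "0 < t" for t
  proof -
    define m where "m n = nat \<lfloor>t / h n\<rfloor>" for n
    have mt: "real (m n) * h n \<le> t" "t < real (Suc (m n)) * h n" for n
      using fl[of t n] t by (auto simp: m_def)
    define g where "g n s = \<kappa> (real (Suc (m n - nat \<lfloor>s / h n\<rfloor>)) * h n) * rn n s" for n s
    have fle: "nat \<lfloor>s / h n\<rfloor> \<le> m n" if "s \<le> t" for n s
      unfolding m_def using that h[of n] by (intro nat_mono floor_mono divide_right_mono) auto
    have tot: "(g n has_integral 1) {0..real (Suc (m n)) * h n}" for n
    proof -
      have "((\<lambda>s. (\<lambda>i. \<kappa> (real (Suc (m n - i)) * h n) * R n i) (nat \<lfloor>s / h n\<rfloor>)) has_integral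
         h n * (\<Sum>i<Suc (m n). \<kappa> (real (Suc (m n - i)) * h n) * R n i)) {0..real (Suc (m n)) * h n}"
        by (rule has_integral_floor_step[OF h])
      moreover have "h n * (\<Sum>i<Suc (m n). \<kappa> (real (Suc (m n - i)) * h n) * R n i) = 1"
        unfolding lessThan_Suc_atMost sum_distrib_left using Rsum[of n "m n"] by (simp add: mult.assoc)
      ultimately show ?thesis unfolding g_def rn_def by simp
    qed
    have gpos: "0 \<le> g n s" for n s
      unfolding g_def using kpos h[of n] rnpos[of n s] by (simp add: less_imp_le)
    have gtail: "(g n has_integral integral {t..real (Suc (m n)) * h n} (g n)) {t..real (Suc (m n)) * h n}" for n
      using integrable_subinterval_real[of "g n" 0 "real (Suc (m n)) * h n" t "real (Suc (m n)) * h n"] tot[of n] t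
      by (auto intro!: integrable_integral)
    \<comment> \<open>The grid point after \<open>t\<close> overshoots by at most one step, which costs at most a multiple of \<open>h \<kappa>(h)\<close>.\<close>
    have gtail_bd: "integral {t..real (Suc (m n)) * h n} (g n) \<le> h n * \<kappa> (h n) * (t powr (\<alpha> - 1) / c)" for n
    proof -
      have "integral {t..real (Suc (m n)) * h n} (g n) \<le> (\<kappa> (h n) * (t powr (\<alpha> - 1) / c)) * (real (Suc (m n)) * h n - t)"
      proof (rule has_integral_le[OF gtail])
        show "((\<lambda>s. \<kappa> (h n) * (t powr (\<alpha> - 1) / c)) has_integral (\<kappa> (h n) * (t powr (\<alpha> - 1) / c)) * (real (Suc (m n)) * h n - t)) {t..real (Suc (m n)) * h n}"
          using has_integral_const_real[of "\<kappa> (h n) * (t powr (\<alpha> - 1) / c)" t "real (Suc (m n)) * h n"] mt(2)[of n]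
          by (simp add: mult.commute)
        fix s assume s: "s \<in> {t..real (Suc (m n)) * h n}"
        have "\<kappa> (real (Suc (m n - nat \<lfloor>s / h n\<rfloor>)) * h n) \<le> \<kappa> (h n)"
          using h[of n] by (intro dec) (auto simp: algebra_simps)
        moreover have "rn n s \<le> t powr (\<alpha> - 1) / c"
          using rndec[of t s n] s rnbd[OF t, of n] by auto
        ultimately show "g n s \<le> \<kappa> (h n) * (t powr (\<alpha> - 1) / c)"
          unfolding g_def using rnpos[of n s] kpos[of "h n"] h[of n] by (intro mult_mono) auto
      qed
      also have "\<dots> \<le> (\<kappa> (h n) * (t powr (\<alpha> - 1) / c)) * h n"
        using mt(1)[of n] kpos[OF h[of n]] c by (intro mult_left_mono) (auto simp: algebra_simps)
      finally show ?thesis by (simp add: mult_ac)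
    qed
    have gtail_pos: "0 \<le> integral {t..real (Suc (m n)) * h n} (g n)" for n
      by (rule has_integral_nonneg[OF gtail]) (use gpos in auto)
    have head: "(g n has_integral 1 - integral {t..real (Suc (m n)) * h n} (g n)) {0..t}" for n
    proof -
      have i: "g n integrable_on {0..t}"
        using integrable_subinterval_real[of "g n" 0 "real (Suc (m n)) * h n" 0 t] tot[of n] mt(2)[of n] by auto
      have "(g n has_integral integral {0..t} (g n) + integral {t..real (Suc (m n)) * h n} (g n)) {0..real (Suc (m n)) * h n}"
        by (rule has_integral_combine[of 0 t]) (use t mt(2)[of n] i gtail[of n] in \<open>auto simp: integrable_integral\<close>)
      then have "integral {0..t} (g n) + integral {t..real (Suc (m n)) * h n} (g n) = 1"
        using tot[of n] has_integral_unique by blast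
      then have "integral {0..t} (g n) = 1 - integral {t..real (Suc (m n)) * h n} (g n)" by simp
      then show ?thesis using i by (metis integrable_integral)
    qed
    have gmeas [measurable]: "g n \<in> borel_measurable borel" for n
    proof -
      have "(\<lambda>s. nat \<lfloor>s / h n\<rfloor>) \<in> measurable borel (count_space UNIV)" by measurable
      moreover have "(\<lambda>i. \<kappa> (real (Suc (m n - i)) * h n) * R n i) \<in> measurable (count_space UNIV) borel" by simp
      ultimately show ?thesis unfolding g_def rn_def by (rule measurable_compose)
    qed
    have headL: "(LINT s|lborel. indicator {0<..<t} s * g n s) = 1 - integral {t..real (Suc (m n)) * h n} (g n)" for n
    proof -
      have "(g n) absolutely_integrable_on {0..t}"
        by (rule nonnegative_absolutely_integrable_1) (use head[of n] gpos in auto)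
      then have "(g n) absolutely_integrable_on {0<..<t}"
        by (rule set_integrable_subset) auto
      then have "set_integrable lborel {0<..<t} (g n)"
        unfolding set_integrable_def by (subst (asm) integrable_completion) auto
      then have "(LINT s:{0<..<t}|lborel. g n s) = integral {0<..<t} (g n)"
        by (rule set_borel_integral_eq_integral(2))
      also have "\<dots> = 1 - integral {t..real (Suc (m n)) * h n} (g n)"
        using head[of n] by (simp add: integral_open_interval_real has_integral_iff)
      finally show ?thesis by (simp add: set_lebesgue_integral_def)
    qed
    have tail0: "(\<lambda>n. integral {t..real (Suc (m n)) * h n} (g n)) \<longlonglongrightarrow> 0"
    proof (rule tendsto_sandwich[of "\<lambda>_. 0" _ _ "\<lambda>n. h n * \<kappa> (h n) * (t powr (\<alpha> - 1) / c)"])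
      have "filterlim h (at_right 0) sequentially"
        using h0 h by (auto simp: filterlim_at less_imp_neq[symmetric])
      from filterlim_compose[OF small this]
      have "(\<lambda>n. h n * \<kappa> (h n)) \<longlonglongrightarrow> 0" .
      from tendsto_mult_left_zero[OF this]
      show "(\<lambda>n. h n * \<kappa> (h n) * (t powr (\<alpha> - 1) / c)) \<longlonglongrightarrow> 0" .
    qed (use gtail_bd gtail_pos in auto)
    have L1: "(\<lambda>n. LINT s|lborel. indicator {0<..<t} s * g (\<nu> n) s) \<longlonglongrightarrow> 1 - 0"
      unfolding headL by (intro tendsto_diff tendsto_const LIMSEQ_subseq_LIMSEQ[OF tail0 \<nu>, unfolded comp_def])
    have wint: "integrable lborel (\<lambda>s. indicator {0<..<t} s * (\<kappa> (t - s) * (s powr (\<alpha> - 1) / c)))"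
      using set_integrable_mult_left[of "1/c" lborel "{0<..<t}" "\<lambda>s. \<kappa> (t - s) * s powr (\<alpha> - 1)"]
        set_integrable_product_powr[OF t \<alpha> _ dec kmeas int[OF t]] kpos
      by (simp add: set_integrable_def less_imp_le)
    have L2: "(\<lambda>n. LINT s|lborel. indicator {0<..<t} s * g (\<nu> n) s) \<longlonglongrightarrow> (LINT s|lborel. indicator {0<..<t} s * (\<kappa> (t - s) * r s))"
    proof (rule integral_dominated_convergence[OF _ _ wint])
      have "(\<lambda>s. indicator {0<..} (t - s) *\<^sub>R \<kappa> (t - s)) \<in> borel_measurable borel"
        using kmeas unfolding set_borel_measurable_def by (rule measurable_compose[rotated]) auto
      then have "(\<lambda>s. indicator {0<..<t} s * ((indicator {0<..} (t - s) *\<^sub>R \<kappa> (t - s)) * r s)) \<in> borel_measurable borel"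
        by measurable
      also have "(\<lambda>s. indicator {0<..<t} s * ((indicator {0<..} (t - s) *\<^sub>R \<kappa> (t - s)) * r s)) = (\<lambda>s. indicator {0<..<t} s * (\<kappa> (t - s) * r s))"
        by (auto simp: indicator_def fun_eq_iff)
      finally show "(\<lambda>s. indicator {0<..<t} s * (\<kappa> (t - s) * r s)) \<in> borel_measurable lborel" by simp
      show "AE s in lborel. norm (indicator {0<..<t} s * g (\<nu> n) s) \<le> indicator {0<..<t} s * (\<kappa> (t - s) * (s powr (\<alpha> - 1) / c))" for n
      proof (rule AE_I2)
        fix s
        show "norm (indicator {0<..<t} s * g (\<nu> n) s) \<le> indicator {0<..<t} s * (\<kappa> (t - s) * (s powr (\<alpha> - 1) / c))"
        proof (cases "s \<in> {0<..<t}")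
          case True
          have "t - s \<le> real (Suc (m (\<nu> n) - nat \<lfloor>s / h (\<nu> n)\<rfloor>)) * h (\<nu> n)"
            using fl(1)[of s "\<nu> n"] mt(2)[of "\<nu> n"] fle[of s "\<nu> n"] True by (simp add: of_nat_diff algebra_simps)
          then have "\<kappa> (real (Suc (m (\<nu> n) - nat \<lfloor>s / h (\<nu> n)\<rfloor>)) * h (\<nu> n)) \<le> \<kappa> (t - s)"
            using True by (intro dec) auto
          then have "g (\<nu> n) s \<le> \<kappa> (t - s) * (s powr (\<alpha> - 1) / c)"
            unfolding g_def using rnbd[of s "\<nu> n"] rnpos[of "\<nu> n" s] True kpos[of "t - s"]
            by (intro mult_mono) auto
          then show ?thesis using gpos[of "\<nu> n" s] True by simp
        qed simp
      qed
      have "AE s in lborel. s \<notin> {x. \<not> isCont F x}"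
        using countable_imp_null_set_lborel[OF ctb] by (rule AE_not_in)
      then show "AE s in lborel. (\<lambda>n. indicator {0<..<t} s * g (\<nu> n) s) \<longlonglongrightarrow> indicator {0<..<t} s * (\<kappa> (t - s) * r s)"
      proof eventually_elim
        case (elim s)
        show ?case
        proof (cases "s \<in> {0<..<t}")
          case True
          have "(\<lambda>n. real (Suc (m n - nat \<lfloor>s / h n\<rfloor>)) * h n - (t - s)) \<longlonglongrightarrow> 0"
          proof (rule Lim_null_comparison[of _ "\<lambda>n. 2 * h n"])
            show "eventually (\<lambda>n. norm (real (Suc (m n - nat \<lfloor>s / h n\<rfloor>)) * h n - (t - s)) \<le> 2 * h n) sequentially"
            proof (intro always_eventually allI)
              fix n
              show "norm (real (Suc (m n - nat \<lfloor>s / h n\<rfloor>)) * h n - (t - s)) \<le> 2 * h n"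
                using fl[of s "n"] mt[of "n"] fle[of s "n"] True h[of n]
                by (simp add: of_nat_diff algebra_simps abs_le_iff)
            qed
          qed (use tendsto_mult_right_zero[OF h0, of 2] in simp)
          then have "(\<lambda>n. real (Suc (m n - nat \<lfloor>s / h n\<rfloor>)) * h n) \<longlonglongrightarrow> t - s"
            by (simp add: LIM_zero_iff)
          then have l: "(\<lambda>n. real (Suc (m (\<nu> n) - nat \<lfloor>s / h (\<nu> n)\<rfloor>)) * h (\<nu> n)) \<longlonglongrightarrow> t - s"
            using LIMSEQ_subseq_LIMSEQ[OF _ \<nu>] by (fastforce simp: comp_def)
          have "isCont \<kappa> (t - s)" using cont True
            by (simp add: continuous_on_eq_continuous_at)
          from isCont_tendsto_compose[OF this l] have "(\<lambda>n. \<kappa> (real (Suc (m (\<nu> n) - nat \<lfloor>s / h (\<nu> n)\<rfloor>)) * h (\<nu> n))) \<longlonglongrightarrow> \<kappa> (t - s)" .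
          then show ?thesis unfolding g_def using rlim[of s] True elim
            by (intro tendsto_intros) auto
        qed simp
      qed
    qed simp
    show ?thesis using LIMSEQ_unique[OF L1 L2] by (simp add: set_lebesgue_integral_def)
  qed
  show ?thesis using that[OF rmeas rpos rdec rbd conv] .
qed

section \<open>Convolution and the Riemann-Liouville kernels\<close>

definition conv :: "(real \<Rightarrow> real) \<Rightarrow> (real \<Rightarrow> 'b::{banach, second_countable_topology}) \<Rightarrow> real \<Rightarrow> 'b" where
  "conv a x t = (LINT s|lborel. a s *\<^sub>R x (t - s))"

text \<open>
  Cutting a kernel off to \<open>(0,T]\<close> makes it integrable over the whole line without changing
  convolutions at times up to \<open>T\<close>.
\<close>

definition cutoff :: "real \<Rightarrow> (real \<Rightarrow> 'b::real_vector) \<Rightarrow> real \<Rightarrow> 'b" where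
  "cutoff T x s = (if 0 < s \<and> s \<le> T then x s else 0)"

definition causal :: "(real \<Rightarrow> 'b::real_vector) \<Rightarrow> bool" where
  "causal x \<longleftrightarrow> (\<forall>s\<le>0. x s = 0)"

lemma causal_cutoff [simp]: "causal (cutoff T x)"
  by (simp add: causal_def cutoff_def)

lemma cutoff_eq: "0 < s \<Longrightarrow> s \<le> T \<Longrightarrow> cutoff T x s = x s"
  by (simp add: cutoff_def)

lemma cutoff_measurable:
  fixes x :: "real \<Rightarrow> 'b::real_normed_vector"
  assumes "continuous_on {0<..T} x"
  shows "cutoff T x \<in> borel_measurable borel"
proof -
  have "cutoff T x = (\<lambda>s. indicator {0<..T} s *\<^sub>R x s)"
    by (auto simp: cutoff_def indicator_def fun_eq_iff)
  then show ?thesis using borel_measurable_continuous_on_indicator[OF _ assms] by simp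
qed

lemma cutoff_measurable_borel:
  fixes x :: "real \<Rightarrow> 'b::real_normed_vector"
  assumes [measurable]: "x \<in> borel_measurable borel"
  shows "cutoff T x \<in> borel_measurable borel"
  unfolding cutoff_def by measurable

lemma isCont_cutoff:
  fixes x :: "real \<Rightarrow> 'b::real_normed_vector"
  assumes "continuous_on {0<..T} x" and "s \<notin> {0, T}"
  shows "isCont (cutoff T x) s"
proof (cases "s \<in> {0<..<T}")
  case True
  have "continuous_on {0<..<T} x" using assms(1) by (rule continuous_on_subset) auto
  then have "continuous_on {0<..<T} (cutoff T x)"
    by (rule continuous_on_eq) (auto simp: cutoff_def)
  then show ?thesis using True by (simp add: continuous_on_eq_continuous_at)
next
  case False
  show ?thesis
  proof (cases "s < 0")
    case True
    have "continuous_on {..<0} (cutoff T x)"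
      by (rule continuous_on_eq[of _ "\<lambda>_. 0"]) (auto simp: cutoff_def)
    then show ?thesis using True by (simp add: continuous_on_eq_continuous_at)
  next
    case f: False
    have "continuous_on {max 0 T<..} (cutoff T x)"
      by (rule continuous_on_eq[of _ "\<lambda>_. 0"]) (auto simp: cutoff_def)
    then show ?thesis using False f assms(2) by (auto simp: continuous_on_eq_continuous_at)
  qed
qed

lemma continuous_bounded_on_Icc:
  fixes x :: "real \<Rightarrow> 'b::real_normed_vector"
  assumes "continuous_on {0..T} x"
  obtains K where "0 \<le> K" "\<And>s. s \<in> {0..T} \<Longrightarrow> norm (x s) \<le> K"
proof -
  have "bounded (x ` {0..T})" using assms by (intro compact_imp_bounded compact_continuous_image) auto
  then obtain K where "K > 0" "\<And>s. s \<in> {0..T} \<Longrightarrow> norm (x s) \<le> K" by (auto simp: bounded_pos)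
  then show ?thesis using that[of K] by auto
qed

lemma norm_cutoff_le: "0 \<le> K \<Longrightarrow> (\<And>s. s \<in> {0..T} \<Longrightarrow> norm (x s) \<le> K) \<Longrightarrow> norm (cutoff T x s) \<le> K"
  by (auto simp: cutoff_def)

lemma conv_eq_integral_Ioo:
  assumes "causal a" and "causal x"
  shows "conv a x t = (LINT s:{0<..<t}|lborel. a s *\<^sub>R x (t - s))"
  unfolding conv_def set_lebesgue_integral_def
proof (rule Bochner_Integration.integral_cong[OF refl])
  fix s show "a s *\<^sub>R x (t - s) = indicator {0<..<t} s *\<^sub>R a s *\<^sub>R x (t - s)"
    using assms by (cases "s \<le> 0"; cases "t - s \<le> 0") (simp_all add: causal_def indicator_def)
qed

lemma conv_commuted:
  fixes x :: "real \<Rightarrow> 'b::{banach, second_countable_topology}"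
  shows "conv a x t = (LINT s|lborel. a (t - s) *\<^sub>R x s)"
  unfolding conv_def
  by (subst lborel_integral_real_affine[of "-1" _ t]) simp_all

lemma conv_commute: "conv a b t = conv b a t"
  by (subst conv_commuted) (simp add: conv_def mult.commute)

lemma causal_conv: "causal a \<Longrightarrow> causal x \<Longrightarrow> causal (conv a x)"
  by (subst causal_def) (simp add: conv_eq_integral_Ioo set_lebesgue_integral_def)

lemma conv_cong:
  assumes "causal a" "causal a'" "causal x" "causal x'"
    and "\<And>s. 0 < s \<Longrightarrow> s < t \<Longrightarrow> a s = a' s" "\<And>s. 0 < s \<Longrightarrow> s < t \<Longrightarrow> x s = x' s"
  shows "conv a x t = conv a' x' t"
  unfolding conv_eq_integral_Ioo[OF assms(1,3)] conv_eq_integral_Ioo[OF assms(2,4)] set_lebesgue_integral_def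
  by (rule Bochner_Integration.integral_cong) (use assms(5,6) in \<open>auto simp: indicator_def\<close>)

lemma integrable_conv_integrand:
  fixes x :: "real \<Rightarrow> 'b::{banach, second_countable_topology}"
  assumes a: "integrable lborel a" and x [measurable]: "x \<in> borel_measurable borel" and K: "\<And>s. norm (x s) \<le> K"
  shows "integrable lborel (\<lambda>s. a s *\<^sub>R x (t - s))"
proof (rule Bochner_Integration.integrable_bound)
  show "integrable lborel (\<lambda>s. K * norm (a s))" using a by simp
  have [measurable]: "a \<in> borel_measurable borel" using a by (simp add: borel_measurable_integrable)
  show "(\<lambda>s. a s *\<^sub>R x (t - s)) \<in> borel_measurable lborel" by measurable
  show "AE s in lborel. norm (a s *\<^sub>R x (t - s)) \<le> norm (K * norm (a s))"
  proof (rule AE_I2)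
    fix s
    have "0 \<le> K" using K[of 0] norm_ge_zero order_trans by blast
    then show "norm (a s *\<^sub>R x (t - s)) \<le> norm (K * norm (a s))"
      using mult_right_mono[OF K[of "t - s"], of "\<bar>a s\<bar>"] by (simp add: mult.commute abs_mult)
  qed
qed

lemma integrable_conv_kernel:
  fixes a b :: "real \<Rightarrow> real"
  assumes a: "integrable lborel a" and b: "integrable lborel b"
  shows "integrable (lborel \<Otimes>\<^sub>M lborel) (\<lambda>(s, u). a s * b (u - s))"
proof (rule lborel_pair.Fubini_integrable)
  have [measurable]: "a \<in> borel_measurable borel" "b \<in> borel_measurable borel"
    using a b by (simp_all add: borel_measurable_integrable)
  show "(\<lambda>(s, u). a s * b (u - s)) \<in> borel_measurable (lborel \<Otimes>\<^sub>M lborel)" by measurable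
  have shift: "integrable lborel (\<lambda>u. b (u - s))" for s
    using lborel_integrable_real_affine[OF b, of 1 "-s"] by simp
  have "(\<integral>u. norm (case (s, u) of (s, u) \<Rightarrow> a s * b (u - s)) \<partial>lborel) = norm (a s) * (\<integral>u. norm (b u) \<partial>lborel)" for s
    using lborel_integral_real_affine[of 1 "\<lambda>u. norm (b u)" "-s"] by (simp add: abs_mult)
  then show "integrable lborel (\<lambda>s. \<integral>u. norm (case (s, u) of (s, u) \<Rightarrow> a s * b (u - s)) \<partial>lborel)"
    using a by simp
  show "AE s in lborel. integrable lborel (\<lambda>u. case (s, u) of (s, u) \<Rightarrow> a s * b (u - s))"
    using shift by (intro AE_I2) simp
qed

lemma integrable_conv:
  fixes a b :: "real \<Rightarrow> real"
  assumes a: "integrable lborel a" and b: "integrable lborel b"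
  shows "integrable lborel (conv a b)"
  using lborel_pair.integrable_snd[OF integrable_conv_kernel[OF a b]]
  by (simp add: conv_def[abs_def])

text \<open>
  Fubini's theorem.  As \<open>x\<close> is bounded, the identity holds at every \<open>t\<close> and not only almost everywhere.
\<close>

lemma conv_assoc:
  fixes x :: "real \<Rightarrow> 'b::{banach, second_countable_topology}"
  assumes a: "integrable lborel a" and b: "integrable lborel b"
    and x [measurable]: "x \<in> borel_measurable borel" and K: "\<And>s. norm (x s) \<le> K"
  shows "conv a (conv b x) t = conv (conv a b) x t"
proof -
  have [measurable]: "a \<in> borel_measurable borel" "b \<in> borel_measurable borel"
    using a b by (simp_all add: borel_measurable_integrable)
  have K0: "0 \<le> K" using K[of 0] norm_ge_zero order_trans by blast
  have int: "integrable (lborel \<Otimes>\<^sub>M lborel) (\<lambda>(s, u). (a s * b (u - s)) *\<^sub>R x (t - u))"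
  proof (rule Bochner_Integration.integrable_bound)
    show "integrable (lborel \<Otimes>\<^sub>M lborel) (\<lambda>p. K * (case p of (s, u) \<Rightarrow> a s * b (u - s)))"
      by (intro integrable_mult_right integrable_conv_kernel a b)
    show "(\<lambda>(s, u). (a s * b (u - s)) *\<^sub>R x (t - u)) \<in> borel_measurable (lborel \<Otimes>\<^sub>M lborel)" by measurable
    show "AE p in lborel \<Otimes>\<^sub>M lborel. norm (case p of (s, u) \<Rightarrow> (a s * b (u - s)) *\<^sub>R x (t - u))
        \<le> norm (K * (case p of (s, u) \<Rightarrow> a s * b (u - s)))"
      using K K0 by (intro AE_I2) (auto simp: split_beta abs_mult mult.commute[of K] intro!: mult_left_mono)
  qed
  have "conv a (conv b x) t = (\<integral>s. (\<integral>u. (a s * b (u - s)) *\<^sub>R x (t - u) \<partial>lborel) \<partial>lborel)"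
    unfolding conv_def
  proof (rule Bochner_Integration.integral_cong[OF refl])
    fix s
    have "(LINT \<tau>|lborel. b \<tau> *\<^sub>R x (t - s - \<tau>)) = (LINT u|lborel. b (u - s) *\<^sub>R x (t - u))"
      using lborel_integral_real_affine[of 1 "\<lambda>\<tau>. b \<tau> *\<^sub>R x (t - s - \<tau>)" "-s"] by simp
    then show "a s *\<^sub>R (LINT \<tau>|lborel. b \<tau> *\<^sub>R x (t - s - \<tau>)) = (LINT u|lborel. (a s * b (u - s)) *\<^sub>R x (t - u))"
      by (simp flip: scaleR_scaleR)
  qed
  also have "\<dots> = (\<integral>u. (\<integral>s. (a s * b (u - s)) *\<^sub>R x (t - u) \<partial>lborel) \<partial>lborel)"
    using lborel_pair.Fubini_integral[OF int] by simp
  also have "\<dots> = conv (conv a b) x t"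
    unfolding conv_def
  proof (rule integral_cong_AE)
    show "(\<lambda>u. LINT s|lborel. (a s * b (u - s)) *\<^sub>R x (t - u)) \<in> borel_measurable lborel" by measurable
    show "(\<lambda>s. (LINT sa|lborel. a sa *\<^sub>R b (s - sa)) *\<^sub>R x (t - s)) \<in> borel_measurable lborel" by measurable
    have "AE u in lborel. integrable lborel (\<lambda>s. a s * b (u - s))"
      using lborel_pair.AE_integrable_snd[OF integrable_conv_kernel[OF a b]] by simp
    then show "AE u in lborel. (LINT s|lborel. (a s * b (u - s)) *\<^sub>R x (t - u)) = (LINT s|lborel. a s *\<^sub>R b (u - s)) *\<^sub>R x (t - u)"
      by eventually_elim simp
  qed
  finally show ?thesis .
qed

text \<open>
  Convolution with an operator-valued kernel that is dominated by an integrable function.  It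
  serves for scalar kernels and for the kernel by which the smoothing operators act on the inhomogeneity.
\<close>

lemma continuous_integral_kernel:
  fixes B :: "real \<Rightarrow> 'a::real_normed_vector \<Rightarrow> 'b::{banach, second_countable_topology}"
  assumes \<beta>: "integrable lborel \<beta>" and \<beta>0: "\<And>\<sigma>. 0 \<le> \<beta> \<sigma>" and B0: "\<And>\<sigma>. B \<sigma> 0 = 0"
    and bd: "\<And>\<sigma> y z. norm (B \<sigma> y - B \<sigma> z) \<le> \<beta> \<sigma> * norm (y - z)"
    and meas: "\<And>x. x \<in> borel_measurable borel \<Longrightarrow> (\<lambda>\<sigma>. B \<sigma> (x \<sigma>)) \<in> borel_measurable borel"
    and x [measurable]: "x \<in> borel_measurable borel" and K: "\<And>s. norm (x s) \<le> K"
    and N: "countable N" and cont: "\<And>s. s \<notin> N \<Longrightarrow> isCont x s"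
  shows "integrable lborel (\<lambda>\<sigma>. B \<sigma> (x (t - \<sigma>)))"
    and "norm (LINT \<sigma>|lborel. B \<sigma> (x (t - \<sigma>))) \<le> (LINT \<sigma>|lborel. \<beta> \<sigma>) * K"
    and "continuous_on UNIV (\<lambda>t. LINT \<sigma>|lborel. B \<sigma> (x (t - \<sigma>)))"
proof -
  have K0: "0 \<le> K" using K[of 0] norm_ge_zero order_trans by blast
  have pt: "norm (B \<sigma> (x u)) \<le> \<beta> \<sigma> * K" for \<sigma> u
  proof -
    have "norm (B \<sigma> (x u)) \<le> \<beta> \<sigma> * norm (x u)" using bd[of \<sigma> "x u" 0] B0 by simp
    also have "\<dots> \<le> \<beta> \<sigma> * K" by (rule mult_left_mono[OF K \<beta>0])
    finally show ?thesis .
  qed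
  have m: "(\<lambda>\<sigma>. B \<sigma> (x (t - \<sigma>))) \<in> borel_measurable lborel" for t
    using meas[of "\<lambda>\<sigma>. x (t - \<sigma>)"] by simp
  have \<beta>K: "integrable lborel (\<lambda>\<sigma>. \<beta> \<sigma> * K)" using \<beta> by simp
  show 1: "integrable lborel (\<lambda>\<sigma>. B \<sigma> (x (t - \<sigma>)))" for t
    by (rule Bochner_Integration.integrable_bound[OF \<beta>K m])
       (use pt in \<open>auto intro!: AE_I2 order_trans[OF pt] \<close>)
  show "norm (LINT \<sigma>|lborel. B \<sigma> (x (t - \<sigma>))) \<le> (LINT \<sigma>|lborel. \<beta> \<sigma>) * K" for t
    using order_trans[OF integral_norm_bound integral_mono[OF integrable_norm[OF 1] \<beta>K pt], of t] by simp
  show "continuous_on UNIV (\<lambda>t. LINT \<sigma>|lborel. B \<sigma> (x (t - \<sigma>)))"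
  proof (rule continuous_on_sequentiallyI)
    fix tn :: "nat \<Rightarrow> real" and t assume tn: "tn \<longlonglongrightarrow> t"
    show "(\<lambda>n. LINT \<sigma>|lborel. B \<sigma> (x (tn n - \<sigma>))) \<longlonglongrightarrow> (LINT \<sigma>|lborel. B \<sigma> (x (t - \<sigma>)))"
    proof (rule integral_dominated_convergence[OF m m \<beta>K])
      have "countable ((\<lambda>n. t - n) ` N)" using N by simp
      then have "AE \<sigma> in lborel. \<sigma> \<notin> (\<lambda>n. t - n) ` N"
        by (intro AE_not_in countable_imp_null_set_lborel)
      then show "AE \<sigma> in lborel. (\<lambda>n. B \<sigma> (x (tn n - \<sigma>))) \<longlonglongrightarrow> B \<sigma> (x (t - \<sigma>))"
      proof eventually_elim
        case (elim \<sigma>)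
        then have "t - \<sigma> \<notin> N" by (auto simp: image_iff) 
        then have "(\<lambda>n. x (tn n - \<sigma>)) \<longlonglongrightarrow> x (t - \<sigma>)"
          by (intro isCont_tendsto_compose[OF cont] tendsto_intros tn)
        then have "(\<lambda>n. \<beta> \<sigma> * norm (x (tn n - \<sigma>) - x (t - \<sigma>))) \<longlonglongrightarrow> 0"
          by (intro tendsto_mult_right_zero tendsto_norm_zero) (simp add: LIM_zero)
        then have "(\<lambda>n. B \<sigma> (x (tn n - \<sigma>)) - B \<sigma> (x (t - \<sigma>))) \<longlonglongrightarrow> 0"
          by (rule Lim_null_comparison[rotated]) (use bd in auto)
        then show ?case by (simp add: LIM_zero_iff)
      qed
      show "AE \<sigma> in lborel. norm (B \<sigma> (x (tn n - \<sigma>))) \<le> \<beta> \<sigma> * K" for n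
        using pt by auto
    qed
  qed
qed

text \<open>
  Convolution with this kernel is the Riemann-Liouville integral of order \<open>\<alpha>\<close>.
\<close>

definition frac_kernel :: "real \<Rightarrow> real \<Rightarrow> real" where
  "frac_kernel \<alpha> s = (if 0 < s then s powr (\<alpha> - 1) / Gamma \<alpha> else 0)"

lemma frac_kernel_pos: "0 < \<alpha> \<Longrightarrow> 0 < s \<Longrightarrow> 0 < frac_kernel \<alpha> s"
  by (simp add: frac_kernel_def)

lemma frac_kernel_nonneg: "0 < \<alpha> \<Longrightarrow> 0 \<le> frac_kernel \<alpha> s"
  by (simp add: frac_kernel_def less_imp_le)

lemma frac_kernel_measurable [measurable]: "frac_kernel \<alpha> \<in> borel_measurable borel"
  unfolding frac_kernel_def by measurable

lemma continuous_on_frac_kernel: "continuous_on {0<..} (frac_kernel \<alpha>)"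
proof (cases "Gamma \<alpha> = 0")
  case True
  then show ?thesis by (simp add: frac_kernel_def[abs_def] cong: if_cong)
next
  case False
  then have "continuous_on {0<..} (\<lambda>s. s powr (\<alpha> - 1) / Gamma \<alpha>)"
    by (intro continuous_intros) auto
  then show ?thesis by (rule continuous_on_eq) (simp add: frac_kernel_def)
qed

lemma set_integrable_powr_Ioo:
  fixes \<alpha> :: real
  assumes "0 < \<alpha>"
  shows "set_integrable lborel {0<..<t} (\<lambda>s. s powr (\<alpha> - 1))"
proof (cases "0 < t")
  case True
  have "(\<lambda>s. s powr (\<alpha> - 1)) integrable_on {0..t}"
    by (rule integrable_on_powr_from_0) (use assms True in auto)
  then have "(\<lambda>s. s powr (\<alpha> - 1)) absolutely_integrable_on {0..t}"
    by (rule nonnegative_absolutely_integrable_1) simp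
  then have "(\<lambda>s. s powr (\<alpha> - 1)) absolutely_integrable_on {0<..<t}"
    by (rule set_integrable_subset) auto
  then show ?thesis
    unfolding set_integrable_def by (subst (asm) integrable_completion) auto
next
  case False
  then have "{0<..<t} = {}" by auto
  then show ?thesis by (simp add: set_integrable_def)
qed

lemma integrable_cutoff_iff_Ioo:
  fixes x :: "real \<Rightarrow> 'b::{banach, second_countable_topology}"
  assumes "x \<in> borel_measurable borel"
  shows "integrable lborel (cutoff T x) \<longleftrightarrow> set_integrable lborel {0<..<T} x"
proof -
  have 1: "AE s in lborel. cutoff T x s = indicator {0<..<T} s *\<^sub>R x s"
    using AE_lborel_singleton[of T] by eventually_elim (auto simp: cutoff_def)
  show ?thesis
    unfolding set_integrable_def
    by (rule integrable_cong_AE[OF _ _ 1]) (use assms cutoff_measurable_borel[OF assms] in measurable)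
qed

lemma integrable_cutoff_frac_kernel:
  assumes "0 < \<alpha>"
  shows "integrable lborel (cutoff T (frac_kernel \<alpha>))"
proof -
  have "set_integrable lborel {0<..<T} (\<lambda>s. s powr (\<alpha> - 1) / Gamma \<alpha>)"
    using integrable_divide[OF set_integrable_powr_Ioo[OF assms, of T, unfolded set_integrable_def], of "Gamma \<alpha>"]
    by (simp add: set_integrable_def)
  moreover have "(\<lambda>s. indicat_real {0<..<T} s *\<^sub>R (s powr (\<alpha> - 1) / Gamma \<alpha>)) = (\<lambda>s. indicat_real {0<..<T} s *\<^sub>R frac_kernel \<alpha> s)"
    by (auto simp: frac_kernel_def indicator_def fun_eq_iff)
  ultimately show ?thesis
    by (subst integrable_cutoff_iff_Ioo) (simp_all add: set_integrable_def)
qed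

text \<open>
  The semigroup law of fractional integration, which is Euler's Beta integral.
\<close>

lemma conv_frac_kernel:
  assumes \<alpha>: "0 < \<alpha>" and \<beta>: "0 < \<beta>" and t: "0 < t" "t \<le> T"
  shows "conv (cutoff T (frac_kernel \<alpha>)) (cutoff T (frac_kernel \<beta>)) t = frac_kernel (\<alpha> + \<beta>) t"
proof -
  have *: "(LINT z:{0<..<1}|lborel. z powr (\<alpha> - 1) * (1 - z) powr (\<beta> - 1)) = Beta \<alpha> \<beta>"
  proof -
    have "set_integrable lborel {0<..<1} (\<lambda>z. z powr (\<alpha> - 1) * (1 - z) powr (\<beta> - 1))"
      by (rule set_integrable_subset[OF integrable_Beta[OF \<alpha> \<beta>]]) auto
    then have "(LINT z:{0<..<1}|lborel. z powr (\<alpha> - 1) * (1 - z) powr (\<beta> - 1))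
        = integral {0<..<1} (\<lambda>z. z powr (\<alpha> - 1) * (1 - z) powr (\<beta> - 1))"
      by (rule set_borel_integral_eq_integral(2))
    also have "\<dots> = Beta \<alpha> \<beta>"
      using has_integral_Beta_real[OF \<alpha> \<beta>] by (simp add: integral_open_interval_real has_integral_iff)
    finally show ?thesis .
  qed
  have "conv (cutoff T (frac_kernel \<alpha>)) (cutoff T (frac_kernel \<beta>)) t
      = (LINT s|lborel. indicator {0<..<t} s * (s powr (\<alpha> - 1) * (t - s) powr (\<beta> - 1) / (Gamma \<alpha> * Gamma \<beta>)))"
    unfolding conv_eq_integral_Ioo[OF causal_cutoff causal_cutoff] set_lebesgue_integral_def
    by (rule Bochner_Integration.integral_cong[OF refl])
       (use t in \<open>auto simp: cutoff_def frac_kernel_def indicator_def field_simps\<close>)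
  also have "\<dots> = t * (LINT z|lborel. indicator {0<..<t} (t * z) * ((t * z) powr (\<alpha> - 1) * (t - t * z) powr (\<beta> - 1) / (Gamma \<alpha> * Gamma \<beta>)))"
    using t by (subst lborel_integral_real_affine[of t _ 0]) simp_all
  also have "\<dots> = t * (LINT z|lborel. (t powr (\<alpha> - 1) * t powr (\<beta> - 1) / (Gamma \<alpha> * Gamma \<beta>)) * (indicator {0<..<1} z * (z powr (\<alpha> - 1) * (1 - z) powr (\<beta> - 1))))"
  proof (intro arg_cong[of _ _ "\<lambda>x. t * x"] Bochner_Integration.integral_cong refl)
    fix z
    show "indicator {0<..<t} (t * z) * ((t * z) powr (\<alpha> - 1) * (t - t * z) powr (\<beta> - 1) / (Gamma \<alpha> * Gamma \<beta>))
        = (t powr (\<alpha> - 1) * t powr (\<beta> - 1) / (Gamma \<alpha> * Gamma \<beta>)) * (indicator {0<..<1} z * (z powr (\<alpha> - 1) * (1 - z) powr (\<beta> - 1)))"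
    proof (cases "0 < z \<and> z < 1")
      case True
      have "t - t * z = t * (1 - z)" by (simp add: algebra_simps)
      then show ?thesis using True t by (simp add: powr_mult indicator_def)
    next
      case False
      then have "indicator {0<..<t} (t * z) = (0::real)" "indicator {0<..<1} z = (0::real)" using t by (auto simp: indicator_def zero_less_mult_iff)
      then show ?thesis by simp
    qed
  qed
  also have "\<dots> = t * (t powr (\<alpha> - 1) * t powr (\<beta> - 1) / (Gamma \<alpha> * Gamma \<beta>)) * Beta \<alpha> \<beta>"
    using * by (simp add: set_lebesgue_integral_def)
  also have "\<dots> = t powr (\<alpha> + \<beta> - 1) / Gamma (\<alpha> + \<beta>)"
  proof -
    have "t * (t powr (\<alpha> - 1) * t powr (\<beta> - 1)) = t powr (\<alpha> + \<beta> - 1)"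
      using t by (simp add: powr_add[symmetric] powr_mult_base)
    moreover have "Gamma \<alpha> \<noteq> 0" "Gamma \<beta> \<noteq> 0" using Gamma_real_pos[OF \<alpha>] Gamma_real_pos[OF \<beta>] by auto
    ultimately show ?thesis by (simp add: Beta_def)
  qed
  finally show ?thesis using t by (simp add: frac_kernel_def)
qed

lemma conv_one:
  assumes "causal x" and t: "t \<le> T"
  shows "conv (cutoff T (frac_kernel 1)) x t = (LINT s:{0<..<t}|lborel. x s)"
proof -
  have "conv (cutoff T (frac_kernel 1)) x t = (LINT s|lborel. cutoff T (frac_kernel 1) (t - s) *\<^sub>R x s)"
    by (rule conv_commuted)
  also have "\<dots> = (LINT s:{0<..<t}|lborel. x s)"
    unfolding set_lebesgue_integral_def
  proof (rule Bochner_Integration.integral_cong[OF refl])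
    fix s show "cutoff T (frac_kernel 1) (t - s) *\<^sub>R x s = indicat_real {0<..<t} s *\<^sub>R x s"
      using assms by (cases "s \<le> 0") (auto simp: causal_def cutoff_def frac_kernel_def indicator_def)
  qed
  finally show ?thesis .
qed

lemma zero_if_primitive_zero:
  fixes x :: "real \<Rightarrow> real"
  assumes cont: "continuous_on {0..T} x" and zero: "\<And>t. 0 < t \<Longrightarrow> t < T \<Longrightarrow> (LINT s:{0<..<t}|lborel. x s) = 0"
    and t: "0 < t" "t < T"
  shows "x t = 0"
proof -
  have "((\<lambda>u. integral {0..u} x) has_real_derivative x t) (at t within {0..T})"
    by (rule integral_has_real_derivative[OF cont]) (use t in auto)
  then have 1: "((\<lambda>u. integral {0..u} x) has_real_derivative x t) (at t)"
    using t by (simp add: at_within_interior[of t "{0..T}"])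
  have z: "integral {0..u} x = 0" if u: "0 < u" "u < T" for u
  proof -
    have "set_integrable lborel {0..u} x"
      by (rule borel_integrable_atLeastAtMost') (use cont u in \<open>auto intro: continuous_on_subset\<close>)
    then have "set_integrable lborel {0<..<u} x" by (rule set_integrable_subset) auto
    from set_borel_integral_eq_integral(2)[OF this] zero[OF u]
    show ?thesis by (simp add: integral_open_interval_real)
  qed
  have "((\<lambda>u. integral {0..u} x) has_real_derivative 0) (at t)"
    by (rule has_field_derivative_transform_within_open[of "\<lambda>_. 0" _ _ "{0<..<T}"]) (use t z in auto)
  then show ?thesis using 1 DERIV_unique by blast
qed

lemma continuous_conv:
  fixes x :: "real \<Rightarrow> 'b::{banach, second_countable_topology}"
  assumes a: "integrable lborel a" and x: "continuous_on {0..T} x"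
  shows "continuous_on UNIV (conv a (cutoff T x))"
proof -
  obtain K where K: "0 \<le> K" "\<And>s. s \<in> {0..T} \<Longrightarrow> norm (x s) \<le> K" using continuous_bounded_on_Icc[OF x] by blast
  have x': "continuous_on {0<..T} x" using x by (rule continuous_on_subset) auto
  have [measurable]: "a \<in> borel_measurable borel" using a by (simp add: borel_measurable_integrable)
  show ?thesis unfolding conv_def[abs_def]
    by (rule continuous_integral_kernel(3)[of "\<lambda>s. \<bar>a s\<bar>" "\<lambda>s y. a s *\<^sub>R y" _ K "{0, T}"])
       (use a x' K in \<open>auto simp: scaleR_diff_right[symmetric] intro!: cutoff_measurable isCont_cutoff norm_cutoff_le\<close>)
qed

lemma norm_conv_le:
  fixes x :: "real \<Rightarrow> 'b::{banach, second_countable_topology}"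
  assumes a: "integrable lborel a" and x [measurable]: "x \<in> borel_measurable borel" and K: "\<And>s. norm (x s) \<le> K"
  shows "norm (conv a x t) \<le> (LINT s|lborel. \<bar>a s\<bar>) * K"
proof -
  have "norm (conv a x t) \<le> (LINT s|lborel. norm (a s *\<^sub>R x (t - s)))" unfolding conv_def by (rule integral_norm_bound)
  also have "\<dots> \<le> (LINT s|lborel. \<bar>a s\<bar> * K)"
    by (rule integral_mono[OF integrable_norm[OF integrable_conv_integrand[OF a x K]]])
       (use a K in \<open>auto intro!: mult_left_mono\<close>)
  finally show ?thesis by simp
qed

lemma conv_add:
  fixes x y :: "real \<Rightarrow> 'b::{banach, second_countable_topology}"
  assumes a: "integrable lborel a" and x: "x \<in> borel_measurable borel" "\<And>s. norm (x s) \<le> K"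
    and y: "y \<in> borel_measurable borel" "\<And>s. norm (y s) \<le> L"
  shows "conv a (\<lambda>s. x s + y s) t = conv a x t + conv a y t"
  unfolding conv_def scaleR_add_right
  by (rule Bochner_Integration.integral_add[OF integrable_conv_integrand[OF a x] integrable_conv_integrand[OF a y]])

lemma conv_scaleR_const:
  fixes y :: "'b::{banach, second_countable_topology}"
  assumes a: "integrable lborel a" and x: "x \<in> borel_measurable borel" "\<And>s. norm (x s) \<le> K"
  shows "conv a (\<lambda>s. x s *\<^sub>R y) t = conv a x t *\<^sub>R y"
  using integrable_conv_integrand[OF a x] by (simp add: conv_def)

lemma conv_kernel_sum:
  fixes x :: "real \<Rightarrow> 'b::{banach, second_countable_topology}"
  assumes a: "\<And>i. i \<in> I \<Longrightarrow> integrable lborel (a i)" and x: "x \<in> borel_measurable borel" "\<And>s. norm (x s) \<le> K"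
  shows "conv (\<lambda>s. \<Sum>i\<in>I. c i * a i s) x t = (\<Sum>i\<in>I. c i *\<^sub>R conv (a i) x t)"
proof -
  have i: "integrable lborel (\<lambda>s. c i *\<^sub>R (a i s *\<^sub>R x (t - s)))" if "i \<in> I" for i
    by (intro integrable_scaleR_right integrable_conv_integrand[OF a[OF that] x])
  have "conv (\<lambda>s. \<Sum>i\<in>I. c i * a i s) x t = (LINT s|lborel. (\<Sum>i\<in>I. c i *\<^sub>R (a i s *\<^sub>R x (t - s))))"
    by (simp add: conv_def scaleR_sum_left)
  also have "\<dots> = (\<Sum>i\<in>I. LINT s|lborel. c i *\<^sub>R (a i s *\<^sub>R x (t - s)))"
    by (rule Bochner_Integration.integral_sum[OF i])
  also have "\<dots> = (\<Sum>i\<in>I. c i *\<^sub>R conv (a i) x t)"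
    by (simp add: conv_def del: scaleR_scaleR)
  finally show ?thesis .
qed

lemma conv_inner:
  fixes x :: "real \<Rightarrow> 'b::{real_inner, banach, second_countable_topology}"
  assumes a: "integrable lborel a" and x: "x \<in> borel_measurable borel" "\<And>s. norm (x s) \<le> K"
  shows "inner (conv a x t) z = conv a (\<lambda>s. inner (x s) z) t"
proof -
  have "(LINT s|lborel. inner (a s *\<^sub>R x (t - s)) z) = inner (LINT s|lborel. a s *\<^sub>R x (t - s)) z"
    by (rule integral_inner_left[OF integrable_conv_integrand[OF a x]])
  then show ?thesis by (simp add: conv_def)
qed

lemma frac_kernel_antimono: "0 < \<alpha> \<Longrightarrow> \<alpha> < 1 \<Longrightarrow> 0 < s \<Longrightarrow> s \<le> u \<Longrightarrow> frac_kernel \<alpha> u \<le> frac_kernel \<alpha> s"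
  using Gamma_real_pos[of \<alpha>] by (auto simp: frac_kernel_def intro!: divide_right_mono powr_mono2')

lemma frac_kernel_log_convex:
  assumes \<alpha>: "0 < \<alpha>" "\<alpha> < 1" and h: "0 < h" "h < s"
  shows "(frac_kernel \<alpha> s)\<^sup>2 \<le> frac_kernel \<alpha> (s - h) * frac_kernel \<alpha> (s + h)"
proof -
  have "(s * s) powr (\<alpha> - 1) \<le> ((s - h) * (s + h)) powr (\<alpha> - 1)"
    using \<alpha> h mult_strict_mono[of h s h s] by (intro powr_mono2') (auto simp: algebra_simps)
  then have "s powr (\<alpha> - 1) * s powr (\<alpha> - 1) \<le> (s - h) powr (\<alpha> - 1) * (s + h) powr (\<alpha> - 1)"
    using h by (simp add: powr_mult)
  then have "s powr (\<alpha> - 1) * s powr (\<alpha> - 1) / (Gamma \<alpha> * Gamma \<alpha>) \<le> (s - h) powr (\<alpha> - 1) * (s + h) powr (\<alpha> - 1) / (Gamma \<alpha> * Gamma \<alpha>)"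
    by (rule divide_right_mono) simp
  then show ?thesis using h by (simp add: frac_kernel_def power2_eq_square)
qed

lemma tendsto_mult_frac_kernel:
  assumes \<alpha>: "0 < \<alpha>"
  shows "((\<lambda>s. s * frac_kernel \<alpha> s) \<longlongrightarrow> 0) (at_right 0)"
proof -
  have ev: "eventually (\<lambda>s::real. 0 < s) (at_right 0)" by (simp add: eventually_at_right_less)
  have "((\<lambda>s. s powr \<alpha> / Gamma \<alpha>) \<longlongrightarrow> 0 powr \<alpha> / Gamma \<alpha>) (at_right 0)"
    using \<alpha> less_imp_neq[OF Gamma_real_pos[OF \<alpha>], symmetric] ev
    by (intro tendsto_divide tendsto_powr' tendsto_const tendsto_ident_at) (auto elim: eventually_mono)
  then have "((\<lambda>s. s powr \<alpha> / Gamma \<alpha>) \<longlongrightarrow> 0) (at_right 0)" by simp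
  then show ?thesis
  proof (rule Lim_transform_eventually)
    show "\<forall>\<^sub>F s in at_right 0. s powr \<alpha> / Gamma \<alpha> = s * frac_kernel \<alpha> s"
      using ev by eventually_elim (simp add: frac_kernel_def powr_diff)
  qed
qed

lemma set_integrable_frac_kernel: "0 < \<alpha> \<Longrightarrow> set_integrable lborel {0<..<b} (frac_kernel \<alpha>)"
  using integrable_cutoff_frac_kernel[of \<alpha> b] by (simp add: integrable_cutoff_iff_Ioo)

lemma set_integrable_const_Ioo: "set_integrable lborel {a<..<b::real} (\<lambda>_. c :: real)"
  by (rule set_integrable_subset[OF borel_integrable_atLeastAtMost'[of a b]]) auto

lemma set_integral_const_Ioo: "a \<le> b \<Longrightarrow> (LINT s:{a<..<b::real}|lborel. c :: real) = c * (b - a)"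
  unfolding set_lebesgue_integral_def by simp

section \<open>A Volterra equation of the second kind\<close>

text \<open>
  Multiplying by a decaying exponential makes the kernel small in the mean, and the equation becomes a
  fixed point equation for a contraction of bounded continuous functions.
\<close>

lemma volterra_second_kind:
  fixes F :: "real \<Rightarrow> 'b::{banach, second_countable_topology}"
  assumes a: "integrable lborel a" and causal: "causal a" and T: "0 \<le> T" and F: "continuous_on {0..T} F"
  obtains \<phi> where "continuous_on {0..T} \<phi>" "\<And>t. t \<in> {0..T} \<Longrightarrow> \<phi> t + conv a (cutoff T \<phi>) t = F t"
proof -
  have [measurable]: "a \<in> borel_measurable borel" using a by (simp add: borel_measurable_integrable)
  have le: "\<bar>a s * exp (- real n * s)\<bar> \<le> \<bar>a s\<bar>" for n s
  proof (cases "s \<le> 0")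
    case False
    then show ?thesis by (simp add: abs_mult mult_left_le)
  qed (use causal in \<open>simp add: causal_def\<close>)
  have "(\<lambda>n. LINT s|lborel. \<bar>a s * exp (- real n * s)\<bar>) \<longlonglongrightarrow> integral\<^sup>L lborel (\<lambda>s::real. 0::real)"
  proof (rule integral_dominated_convergence)
    show "integrable lborel (\<lambda>s. \<bar>a s\<bar>)" using a by simp
    show "AE s in lborel. (\<lambda>n. \<bar>a s * exp (- real n * s)\<bar>) \<longlonglongrightarrow> 0"
    proof (rule AE_I2)
      fix s
      show "(\<lambda>n. \<bar>a s * exp (- real n * s)\<bar>) \<longlonglongrightarrow> 0"
      proof (cases "s \<le> 0")
        case False
        have "(\<lambda>n. exp (- s) ^ n) \<longlonglongrightarrow> 0" using False by (intro LIMSEQ_realpow_zero) auto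
        then have "(\<lambda>n. exp (- real n * s)) \<longlonglongrightarrow> 0" by (simp add: exp_of_nat_mult[symmetric])
        from tendsto_rabs_zero[OF tendsto_mult_right_zero[OF this]] show ?thesis .
      qed (use causal in \<open>simp add: causal_def\<close>)
    qed
  qed (use le in auto)
  then have "eventually (\<lambda>n. (LINT s|lborel. \<bar>a s * exp (- real n * s)\<bar>) < 1/2) sequentially"
    by (intro order_tendstoD(2)) auto
  then obtain n where n: "(LINT s|lborel. \<bar>a s * exp (- real n * s)\<bar>) < 1/2"
    by (auto simp: eventually_sequentially)
  \<comment> \<open>Passing from \<open>\<phi>\<close> to \<open>exp (- n t) \<phi> t\<close> replaces the kernel \<open>a\<close> by \<open>w\<close>, whose mass is below \<open>1/2\<close>.\<close>
  define w where "w s = a s * exp (- real n * s)" for s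
  have wi: "integrable lborel w"
    by (rule Bochner_Integration.integrable_bound[OF a]) (use le in \<open>auto simp: w_def[abs_def]\<close>)
  \<comment> \<open>Clamping extends functions on \<open>[0,T]\<close> continuously to the line, where Banach's theorem is applied.\<close>
  define cl where "cl t = max 0 (min T t)" for t :: real
  have cl: "cl t \<in> {0..T}" "continuous_on UNIV cl" for t
    using T unfolding cl_def by (auto intro!: continuous_intros)
  have cl_id: "cl t = t" if "t \<in> {0..T}" for t using that by (simp add: cl_def)
  define G where "G \<xi> t = exp (- real n * t) *\<^sub>R F t - conv w (cutoff T (apply_bcontfun \<xi>)) t" for \<xi> t
  have cont_ap: "continuous_on A (apply_bcontfun \<xi>)" for A and \<xi> :: "(real, 'b) bcontfun" by simp
  have Gc: "continuous_on {0..T} (G \<xi>)" for \<xi>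
    unfolding G_def by (intro continuous_intros F continuous_on_subset[OF continuous_conv[OF wi cont_ap]]) simp
  have Gb: "(\<lambda>t. G \<xi> (cl t)) \<in> bcontfun" for \<xi>
  proof -
    obtain K where K: "\<And>s. s \<in> {0..T} \<Longrightarrow> norm (G \<xi> s) \<le> K" using continuous_bounded_on_Icc[OF Gc] by blast
    show ?thesis
    proof (rule bcontfun_normI)
      show "continuous_on UNIV (\<lambda>t. G \<xi> (cl t))"
        by (rule continuous_on_compose2[OF Gc cl(2)]) (use cl(1) in blast)
      show "norm (G \<xi> (cl x)) \<le> K" for x using K cl by blast
    qed
  qed
  define \<Psi> where "\<Psi> \<xi> = Bcontfun (\<lambda>t. G \<xi> (cl t))" for \<xi>
  have ap: "apply_bcontfun (\<Psi> \<xi>) t = G \<xi> (cl t)" for \<xi> t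
    unfolding \<Psi>_def using Gb by (simp add: Bcontfun_inverse)
  have "\<exists>!\<xi>. \<Psi> \<xi> = \<xi>"
  proof (rule banach_fix_type[of "1/2"])
    show "\<forall>\<xi> \<xi>'. dist (\<Psi> \<xi>) (\<Psi> \<xi>') \<le> 1 / 2 * dist \<xi> \<xi>'"
    proof (intro allI dist_bound)
      fix \<xi> \<xi>' :: "(real, 'b) bcontfun" and t
      define D where "D s = apply_bcontfun \<xi> s - apply_bcontfun \<xi>' s" for s
      have Db: "norm (D s) \<le> dist \<xi> \<xi>'" for s using dist_bounded[of \<xi> s \<xi>'] by (simp add: D_def dist_norm)
      have Dm: "cutoff T D \<in> borel_measurable borel" unfolding D_def by (intro cutoff_measurable continuous_intros cont_ap)
      have "conv w (cutoff T (apply_bcontfun \<xi>)) (cl t) = conv w (\<lambda>s. cutoff T (apply_bcontfun \<xi>') s + cutoff T D s) (cl t)"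
        by (rule arg_cong[of _ _ "\<lambda>x. conv w x (cl t)"]) (auto simp: cutoff_def D_def)
      also have "\<dots> = conv w (cutoff T (apply_bcontfun \<xi>')) (cl t) + conv w (cutoff T D) (cl t)"
      proof (rule conv_add[OF wi _ _ Dm])
        show "cutoff T (apply_bcontfun \<xi>') \<in> borel_measurable borel" by (intro cutoff_measurable cont_ap)
        show "norm (cutoff T D s) \<le> dist \<xi> \<xi>'" for s using Db by (intro norm_cutoff_le) auto
        show "norm (cutoff T (apply_bcontfun \<xi>') s) \<le> norm \<xi>'" for s
          by (intro norm_cutoff_le) (auto simp: norm_bounded)
      qed
      finally have eq: "apply_bcontfun (\<Psi> \<xi>) t - apply_bcontfun (\<Psi> \<xi>') t = - conv w (cutoff T D) (cl t)"
        by (simp add: ap G_def)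
      have "dist (apply_bcontfun (\<Psi> \<xi>) t) (apply_bcontfun (\<Psi> \<xi>') t) = norm (conv w (cutoff T D) (cl t))"
        by (simp add: dist_norm eq)
      also have "\<dots> \<le> (LINT s|lborel. \<bar>w s\<bar>) * dist \<xi> \<xi>'"
        by (rule norm_conv_le[OF wi Dm]) (use Db in \<open>auto intro: norm_cutoff_le\<close>)
      also have "\<dots> \<le> 1 / 2 * dist \<xi> \<xi>'" using n by (intro mult_right_mono) (auto simp: w_def)
      finally show "dist (apply_bcontfun (\<Psi> \<xi>) t) (apply_bcontfun (\<Psi> \<xi>') t) \<le> 1 / 2 * dist \<xi> \<xi>'" .
    qed
  qed auto
  then obtain \<xi> where \<xi>: "\<Psi> \<xi> = \<xi>" by blast
  define \<phi> where "\<phi> t = exp (real n * t) *\<^sub>R apply_bcontfun \<xi> t" for t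
  have 1: "continuous_on {0..T} \<phi>" unfolding \<phi>_def by (intro continuous_intros cont_ap)
  have 2: "\<phi> t + conv a (cutoff T \<phi>) t = F t" if t: "t \<in> {0..T}" for t
  proof -
    have "apply_bcontfun \<xi> t = G \<xi> t" using ap[of \<xi> t] \<xi> cl_id[OF t] by simp
    then have "\<phi> t = exp (real n * t) *\<^sub>R (exp (- real n * t) *\<^sub>R F t) - exp (real n * t) *\<^sub>R conv w (cutoff T (apply_bcontfun \<xi>)) t"
      by (simp add: \<phi>_def G_def scaleR_diff_right)
    also have "exp (real n * t) *\<^sub>R (exp (- real n * t) *\<^sub>R F t) = F t"
      by (simp flip: exp_add)
    also have "exp (real n * t) *\<^sub>R conv w (cutoff T (apply_bcontfun \<xi>)) t = conv a (cutoff T \<phi>) t"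
      unfolding conv_def integral_scaleR_right[symmetric]
    proof (rule Bochner_Integration.integral_cong[OF refl])
      fix s
      have "exp (real n * t) * (a s * exp (- real n * s)) = a s * exp (real n * (t - s))"
        by (simp add: right_diff_distrib exp_diff exp_minus field_simps)
      then show "exp (real n * t) *\<^sub>R w s *\<^sub>R cutoff T (apply_bcontfun \<xi>) (t - s) = a s *\<^sub>R cutoff T \<phi> (t - s)"
        by (simp add: w_def cutoff_def \<phi>_def)
    qed
    finally show ?thesis by simp
  qed
  show ?thesis using that 1 2 by blast
qed

section \<open>Stieltjes integrals\<close>

text \<open>
  A criterion in terms of an indefinite integral \<open>Fn\<close>: in the interior the increments of \<open>Fn\<close> must
  agree with those of \<open>g dh\<close> up to a small multiple of the length, and at the two end points continuity is
  enough.  In particular \<open>g\<close> may be singular at \<open>t\<close>.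
\<close>

lemma has_stieltjes_integral_of_indefinite:
  fixes h Fn :: "real \<Rightarrow> 'a::real_normed_vector"
  assumes t: "0 < t" and h: "continuous_on {0..t} h"
    and F0: "(Fn \<longlongrightarrow> Fn 0) (at 0 within {0..t})" and Ft: "(Fn \<longlongrightarrow> Fn t) (at t within {0..t})"
    and loc: "\<And>x \<eta>. 0 < x \<Longrightarrow> x < t \<Longrightarrow> 0 < \<eta> \<Longrightarrow> \<exists>\<delta>>0. \<forall>u v. u \<le> x \<and> x \<le> v \<and> 0 \<le> u \<and> v \<le> t \<and> {u..v} \<subseteq> ball x \<delta> \<longrightarrow>
      norm (g x *\<^sub>R (h v - h u) - (Fn v - Fn u)) \<le> \<eta> * (v - u)"
  shows "has_stieltjes_integral g h (Fn t - Fn 0) 0 t"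
  unfolding has_stieltjes_integral_def
proof (intro allI impI)
  fix e :: real assume e: "e > 0"
  define \<eta> where "\<eta> = e / (2 * (t + 2))"
  have \<eta>: "\<eta> > 0" using e t by (simp add: \<eta>_def)
  \<comment> \<open>\<open>P\<close> distributes the admissible error: length in the interior, a unit of mass at either end.\<close>
  define P :: "real \<Rightarrow> real" where "P s = s + (if s > 0 then 1 else 0) + (if s \<ge> t then 1 else 0)" for s
  have Pmono: "v - u \<le> P v - P u" if "u \<le> v" for u v using that by (simp add: P_def)
  have endpt: "\<exists>\<delta>>0. \<forall>w\<in>{0..t}. dist w x < \<delta> \<longrightarrow> norm (g x *\<^sub>R (h w - h x)) + norm (Fn w - Fn x) \<le> \<eta>"
    if x: "x = 0 \<or> x = t" for x
  proof -
    have "(h \<longlongrightarrow> h x) (at x within {0..t})" using h x t by (auto simp: continuous_on_def)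
    moreover have "(Fn \<longlongrightarrow> Fn x) (at x within {0..t})" using F0 Ft x by auto
    ultimately have "((\<lambda>w. norm (g x *\<^sub>R (h w - h x)) + norm (Fn w - Fn x)) \<longlongrightarrow> norm (g x *\<^sub>R (h x - h x)) + norm (Fn x - Fn x)) (at x within {0..t})"
      by (intro tendsto_intros)
    then have "eventually (\<lambda>w. norm (g x *\<^sub>R (h w - h x)) + norm (Fn w - Fn x) < \<eta>) (at x within {0..t})"
      using \<eta> by (intro order_tendstoD(2)) auto
    then obtain d where d: "d > 0" "\<And>w. w \<in> {0..t} \<Longrightarrow> w \<noteq> x \<Longrightarrow> dist w x < d \<Longrightarrow> norm (g x *\<^sub>R (h w - h x)) + norm (Fn w - Fn x) < \<eta>"
      unfolding eventually_at by auto
    have "norm (g x *\<^sub>R (h w - h x)) + norm (Fn w - Fn x) \<le> \<eta>" if "w \<in> {0..t}" "dist w x < d" for w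
      using d(2)[of w] that \<eta> by (cases "w = x") (auto simp: less_imp_le)
    then show ?thesis using d(1) by blast
  qed
  have "\<exists>\<delta>>0. \<forall>u v. u \<le> x \<and> x \<le> v \<and> 0 \<le> u \<and> v \<le> t \<and> {u..v} \<subseteq> ball x \<delta> \<longrightarrow>
      norm (g x *\<^sub>R (h v - h u) - (Fn v - Fn u)) \<le> \<eta> * (P v - P u)" for x
  proof -
    consider "x = 0" | "0 < x \<and> x < t" | "x = t" | "x < 0 \<or> x > t" by linarith
    then show ?thesis
    proof cases
      case 1
      obtain d where d: "d > 0" "\<And>w. w \<in> {0..t} \<Longrightarrow> dist w 0 < d \<Longrightarrow> norm (g 0 *\<^sub>R (h w - h 0)) + norm (Fn w - Fn 0) \<le> \<eta>"
        using endpt[of 0] by auto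
      have "norm (g x *\<^sub>R (h v - h u) - (Fn v - Fn u)) \<le> \<eta> * (P v - P u)"
        if uv: "u \<le> x" "x \<le> v" "0 \<le> u" "v \<le> t" "{u..v} \<subseteq> ball x d" for u v
      proof (cases "v = 0")
        case True
        then show ?thesis using uv 1 by simp
      next
        case False
        have u: "u = 0" and v: "v > 0" using uv 1 False by auto
        have "v \<in> ball 0 d" using subsetD[OF uv(5), of v] uv 1 by simp
        then have "norm (g 0 *\<^sub>R (h v - h 0)) + norm (Fn v - Fn 0) \<le> \<eta>"
          using d(2)[of v] uv v by (simp add: dist_commute)
        then have "norm (g 0 *\<^sub>R (h v - h 0) - (Fn v - Fn 0)) \<le> \<eta>"
          using norm_triangle_ineq4[of "g 0 *\<^sub>R (h v - h 0)" "Fn v - Fn 0"] by linarith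
        also have "\<eta> \<le> \<eta> * (P v - P u)" using v u \<eta> t by (simp add: P_def)
        finally show ?thesis using 1 u by simp
      qed
      then show ?thesis using d(1) by blast
    next
      case 2
      then obtain d where d: "d > 0" "\<And>u v. u \<le> x \<and> x \<le> v \<and> 0 \<le> u \<and> v \<le> t \<and> {u..v} \<subseteq> ball x d \<Longrightarrow>
        norm (g x *\<^sub>R (h v - h u) - (Fn v - Fn u)) \<le> \<eta> * (v - u)" using loc[of x \<eta>] \<eta> by blast
      have "norm (g x *\<^sub>R (h v - h u) - (Fn v - Fn u)) \<le> \<eta> * (P v - P u)"
        if uv: "u \<le> x \<and> x \<le> v \<and> 0 \<le> u \<and> v \<le> t \<and> {u..v} \<subseteq> ball x d" for u v
      proof -
        have "\<eta> * (v - u) \<le> \<eta> * (P v - P u)" using \<eta> uv by (intro mult_left_mono Pmono) auto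
        then show ?thesis using d(2)[OF uv] by linarith
      qed
      then show ?thesis using d(1) by blast
    next
      case 3
      obtain d where d: "d > 0" "\<And>w. w \<in> {0..t} \<Longrightarrow> dist w t < d \<Longrightarrow> norm (g t *\<^sub>R (h w - h t)) + norm (Fn w - Fn t) \<le> \<eta>"
        using endpt[of t] by auto
      have "norm (g x *\<^sub>R (h v - h u) - (Fn v - Fn u)) \<le> \<eta> * (P v - P u)"
        if uv: "u \<le> x" "x \<le> v" "0 \<le> u" "v \<le> t" "{u..v} \<subseteq> ball x d" for u v
      proof (cases "u = t")
        case True
        then show ?thesis using uv 3 by simp
      next
        case False
        have v: "v = t" and u: "u < t" using uv 3 False by auto
        have "u \<in> ball t d" using subsetD[OF uv(5), of u] uv 3 by simp
        then have "norm (g t *\<^sub>R (h u - h t)) + norm (Fn u - Fn t) \<le> \<eta>"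
          using d(2)[of u] uv u by (simp add: dist_commute)
        then have "norm (g t *\<^sub>R (h t - h u) - (Fn t - Fn u)) \<le> \<eta>"
          using norm_triangle_ineq4[of "g t *\<^sub>R (h t - h u)" "Fn t - Fn u"] 
          by (simp add: norm_minus_commute)
        also have "\<eta> \<le> \<eta> * (P v - P u)" using v u \<eta> t by (simp add: P_def)
        finally show ?thesis using 3 v by simp
      qed
      then show ?thesis using d(1) by blast
    next
      case 4
      then show ?thesis by (intro exI[of _ 1]) auto
    qed
  qed
  then have "\<exists>\<delta>. \<forall>x. \<delta> x > 0 \<and> (\<forall>u v. u \<le> x \<and> x \<le> v \<and> 0 \<le> u \<and> v \<le> t \<and> {u..v} \<subseteq> ball x (\<delta> x) \<longrightarrow>
      norm (g x *\<^sub>R (h v - h u) - (Fn v - Fn u)) \<le> \<eta> * (P v - P u))"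
    by (intro choice allI)
  then obtain \<delta> where \<delta>: "\<And>x. \<delta> x > 0"
    and \<delta>': "\<And>x u v. u \<le> x \<Longrightarrow> x \<le> v \<Longrightarrow> 0 \<le> u \<Longrightarrow> v \<le> t \<Longrightarrow> {u..v} \<subseteq> ball x (\<delta> x) \<Longrightarrow>
      norm (g x *\<^sub>R (h v - h u) - (Fn v - Fn u)) \<le> \<eta> * (P v - P u)"
    by blast
  have main: "norm ((\<Sum>(x, K)\<in>p. g x *\<^sub>R (h (Sup K) - h (Inf K))) - (Fn t - Fn 0)) < e"
    if p: "p tagged_division_of {0..t}" and fine: "(\<lambda>x. ball x (\<delta> x)) fine p" for p
  proof -
    have "(\<Sum>(x, K)\<in>p. g x *\<^sub>R (h (Sup K) - h (Inf K))) - (Fn t - Fn 0)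
        = (\<Sum>(x, K)\<in>p. g x *\<^sub>R (h (Sup K) - h (Inf K)) - (Fn (Sup K) - Fn (Inf K)))"
      using additive_tagged_division_1[OF _ p, of Fn] t by (simp add: sum_subtractf split_def)
    also have "norm \<dots> \<le> (\<Sum>(x, K)\<in>p. \<eta> * (P (Sup K) - P (Inf K)))"
    proof (rule sum_norm_le, clarify)
      fix x K assume xK: "(x, K) \<in> p"
      obtain u v where K: "K = {u..v}"
        using tagged_division_ofD(4)[OF p xK] by (auto simp: cbox_interval)
      have x: "x \<in> K" and sub: "K \<subseteq> {0..t}"
        using tagged_division_ofD(2,3)[OF p xK] by auto
      have uv: "u \<le> x" "x \<le> v" "u \<le> v" using x K by auto
      have "K \<subseteq> ball x (\<delta> x)" using fine xK by (auto simp: fine_def)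
      then show "norm (g x *\<^sub>R (h (Sup K) - h (Inf K)) - (Fn (Sup K) - Fn (Inf K)))
          \<le> \<eta> * (P (Sup K) - P (Inf K))"
        using \<delta>'[of u x v] uv sub by (simp add: K)
    qed
    also have "\<dots> = \<eta> * (\<Sum>(x, K)\<in>p. P (Sup K) - P (Inf K))"
      by (simp add: sum_distrib_left split_def)
    also have "(\<Sum>(x, K)\<in>p. P (Sup K) - P (Inf K)) = P t - P 0"
      using additive_tagged_division_1[OF _ p, of P] t by simp
    also have "\<eta> * (P t - P 0) = e / 2" using t by (simp add: \<eta>_def P_def field_simps)
    also have "\<dots> < e" using e by simp
    finally show ?thesis .
  qed
  have "gauge (\<lambda>x. ball x (\<delta> x))" using \<delta> by (auto simp: gauge_def)
  then show "\<exists>\<gamma>. gauge \<gamma> \<and> (\<forall>p. p tagged_division_of {0..t} \<and> \<gamma> fine p \<longrightarrow>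
      norm ((\<Sum>(x, K)\<in>p. g x *\<^sub>R (h (Sup K) - h (Inf K))) - (Fn t - Fn 0)) < e)"
    using main by (intro exI[of _ "\<lambda>x. ball x (\<delta> x)"] conjI allI impI) simp_all
qed

lemma tagged_division_interval_endpoints:
  assumes "p tagged_division_of {0..t::real}" and "(x, K) \<in> p"
  shows "Sup K \<in> {0..t}" "Inf K \<in> {0..t}"
proof -
  obtain u v where K: "K = {u..v}"
    using tagged_division_ofD(4)[OF assms] by (auto simp: cbox_interval)
  have x: "x \<in> K" and sub: "K \<subseteq> {0..t}"
    using tagged_division_ofD(2,3)[OF assms] by auto
  show "Sup K \<in> {0..t}" "Inf K \<in> {0..t}" using x sub by (auto simp: K)
qed

lemma has_stieltjes_integral_cong:
  assumes "has_stieltjes_integral g h I 0 t" and "\<And>s. s \<in> {0..t} \<Longrightarrow> h s - c = h' s"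
  shows "has_stieltjes_integral g h' I 0 t"
proof -
  have "(\<Sum>(x, K)\<in>p. g x *\<^sub>R (h' (Sup K) - h' (Inf K))) = (\<Sum>(x, K)\<in>p. g x *\<^sub>R (h (Sup K) - h (Inf K)))"
    if "p tagged_division_of {0..t}" for p
  proof (rule sum.cong[OF refl], clarify)
    fix x K assume "(x, K) \<in> p"
    from assms(2)[OF tagged_division_interval_endpoints(1)[OF that this]] assms(2)[OF tagged_division_interval_endpoints(2)[OF that this]]
    show "g x *\<^sub>R (h' (Sup K) - h' (Inf K)) = g x *\<^sub>R (h (Sup K) - h (Inf K))"
      by (metis add_diff_cancel diff_diff_eq2 diff_add_cancel)
  qed
  then have "(p tagged_division_of {0..t} \<and> \<gamma> fine p \<longrightarrow> norm ((\<Sum>(x, K)\<in>p. g x *\<^sub>R (h' (Sup K) - h' (Inf K))) - I) < e)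
     \<longleftrightarrow> (p tagged_division_of {0..t} \<and> \<gamma> fine p \<longrightarrow> norm ((\<Sum>(x, K)\<in>p. g x *\<^sub>R (h (Sup K) - h (Inf K))) - I) < e)" for p \<gamma> e
    by (cases "p tagged_division_of {0..t}") simp_all
  then show ?thesis using assms(1) unfolding has_stieltjes_integral_def by simp
qed

lemma has_stieltjes_integral_add:
  fixes h1 h2 :: "real \<Rightarrow> 'a::real_normed_vector"
  assumes "has_stieltjes_integral g h1 I1 0 t" and "has_stieltjes_integral g h2 I2 0 t"
  shows "has_stieltjes_integral g (\<lambda>s. h1 s + h2 s) (I1 + I2) 0 t"
  unfolding has_stieltjes_integral_def
proof (intro allI impI)
  fix e :: real assume "e > 0"
  then have e: "e / 2 > 0" by simp
  obtain \<gamma>1 where \<gamma>1: "gauge \<gamma>1" "\<And>p. p tagged_division_of {0..t} \<Longrightarrow> \<gamma>1 fine p \<Longrightarrow>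
        norm ((\<Sum>(x, K)\<in>p. g x *\<^sub>R (h1 (Sup K) - h1 (Inf K))) - I1) < e / 2"
    using assms(1) e unfolding has_stieltjes_integral_def by meson
  obtain \<gamma>2 where \<gamma>2: "gauge \<gamma>2" "\<And>p. p tagged_division_of {0..t} \<Longrightarrow> \<gamma>2 fine p \<Longrightarrow>
        norm ((\<Sum>(x, K)\<in>p. g x *\<^sub>R (h2 (Sup K) - h2 (Inf K))) - I2) < e / 2"
    using assms(2) e unfolding has_stieltjes_integral_def by meson
  have "norm ((\<Sum>(x, K)\<in>p. g x *\<^sub>R (h1 (Sup K) + h2 (Sup K) - (h1 (Inf K) + h2 (Inf K)))) - (I1 + I2)) < e"
    if p: "p tagged_division_of {0..t}" and f: "(\<lambda>x. \<gamma>1 x \<inter> \<gamma>2 x) fine p" for p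
  proof -
    have "(\<Sum>(x, K)\<in>p. g x *\<^sub>R (h1 (Sup K) + h2 (Sup K) - (h1 (Inf K) + h2 (Inf K))))
        = (\<Sum>(x, K)\<in>p. g x *\<^sub>R (h1 (Sup K) - h1 (Inf K))) + (\<Sum>(x, K)\<in>p. g x *\<^sub>R (h2 (Sup K) - h2 (Inf K)))"
      unfolding sum.distrib[symmetric] by (rule sum.cong) (auto simp: algebra_simps)
    then have eq: "(\<Sum>(x, K)\<in>p. g x *\<^sub>R (h1 (Sup K) + h2 (Sup K) - (h1 (Inf K) + h2 (Inf K)))) - (I1 + I2)
      = ((\<Sum>(x, K)\<in>p. g x *\<^sub>R (h1 (Sup K) - h1 (Inf K))) - I1) + ((\<Sum>(x, K)\<in>p. g x *\<^sub>R (h2 (Sup K) - h2 (Inf K))) - I2)"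
      by simp
    have "\<gamma>1 fine p" "\<gamma>2 fine p" using f by (simp_all add: fine_Int)
    then have "norm ((\<Sum>(x, K)\<in>p. g x *\<^sub>R (h1 (Sup K) - h1 (Inf K))) - I1) + norm ((\<Sum>(x, K)\<in>p. g x *\<^sub>R (h2 (Sup K) - h2 (Inf K))) - I2) < e / 2 + e / 2"
      by (intro add_strict_mono \<gamma>1(2)[OF p] \<gamma>2(2)[OF p])
    then show ?thesis unfolding eq by (intro norm_triangle_lt) simp
  qed
  then show "\<exists>\<gamma>. gauge \<gamma> \<and> (\<forall>p. p tagged_division_of {0..t} \<and> \<gamma> fine p \<longrightarrow>
      norm ((\<Sum>(x, K)\<in>p. g x *\<^sub>R (h1 (Sup K) + h2 (Sup K) - (h1 (Inf K) + h2 (Inf K)))) - (I1 + I2)) < e)"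
    using gauge_Int[OF \<gamma>1(1) \<gamma>2(1)] by (intro exI[of _ "\<lambda>x. \<gamma>1 x \<inter> \<gamma>2 x"] conjI allI impI) simp_all
qed

lemma has_stieltjes_integral_linear:
  fixes h :: "real \<Rightarrow> 'a::real_normed_vector" and L :: "'a \<Rightarrow> 'b::real_normed_vector"
  assumes "has_stieltjes_integral g h I 0 t" and L: "bounded_linear L"
  shows "has_stieltjes_integral g (\<lambda>s. L (h s)) (L I) 0 t"
  unfolding has_stieltjes_integral_def
proof (intro allI impI)
  fix e :: real assume e: "e > 0"
  interpret bounded_linear L by fact
  obtain K where K: "K > 0" "\<And>x. norm (L x) \<le> norm x * K" using pos_bounded by blast
  have "e / K > 0" using e K by simp
  then obtain \<gamma> where \<gamma>: "gauge \<gamma>" "\<And>p. p tagged_division_of {0..t} \<Longrightarrow> \<gamma> fine p \<Longrightarrow>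
        norm ((\<Sum>(x, K)\<in>p. g x *\<^sub>R (h (Sup K) - h (Inf K))) - I) < e / K"
    using assms(1) unfolding has_stieltjes_integral_def by meson
  have "norm ((\<Sum>(x, K)\<in>p. g x *\<^sub>R (L (h (Sup K)) - L (h (Inf K)))) - L I) < e"
    if p: "p tagged_division_of {0..t}" and f: "\<gamma> fine p" for p
  proof -
    have "(\<Sum>(x, K)\<in>p. g x *\<^sub>R (L (h (Sup K)) - L (h (Inf K)))) - L I
      = L ((\<Sum>(x, K)\<in>p. g x *\<^sub>R (h (Sup K) - h (Inf K))) - I)"
      by (simp add: diff sum scaleR split_def)
    also have "norm \<dots> \<le> norm ((\<Sum>(x, K)\<in>p. g x *\<^sub>R (h (Sup K) - h (Inf K))) - I) * K" by (rule K)
    also have "\<dots> < e / K * K" using \<gamma>(2)[OF p f] K by (intro mult_strict_right_mono)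
    finally show ?thesis using K by simp
  qed
  then show "\<exists>\<gamma>. gauge \<gamma> \<and> (\<forall>p. p tagged_division_of {0..t} \<and> \<gamma> fine p \<longrightarrow>
      norm ((\<Sum>(x, K)\<in>p. g x *\<^sub>R (L (h (Sup K)) - L (h (Inf K)))) - L I) < e)"
    using \<gamma>(1) by (intro exI[of _ \<gamma>] conjI allI impI) simp_all
qed

text \<open>
  If \<open>g\<close> is smooth, integration by parts gives the indefinite integral even when \<open>h\<close> is only continuous:
  the error on \<open>[u,v]\<close> is the oscillation of \<open>h\<close> times the Lipschitz constant of \<open>g\<close> times the length.
\<close>

lemma by_parts_local:
  fixes h :: "real \<Rightarrow> 'a::banach"
  assumes h: "continuous_on {0..b} h" and g': "continuous_on {0..<t} g'" and bt: "b \<le> t"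
    and der: "\<And>s. 0 \<le> s \<Longrightarrow> s < t \<Longrightarrow> (g has_real_derivative g' s) (at s)"
    and Fn: "\<And>c. 0 \<le> c \<Longrightarrow> c < b \<Longrightarrow> Fn c = g c *\<^sub>R h c - integral {0..c} (\<lambda>s. g' s *\<^sub>R h s)"
    and x: "0 < x" "x < b" and \<eta>: "0 < \<eta>"
  shows "\<exists>\<delta>>0. \<forall>u v. u \<le> x \<and> x \<le> v \<and> 0 \<le> u \<and> v \<le> b \<and> {u..v} \<subseteq> ball x \<delta> \<longrightarrow>
      norm (g x *\<^sub>R (h v - h u) - (Fn v - Fn u)) \<le> \<eta> * (v - u)"
proof -
  define y where "y = (x + b) / 2"
  have y: "x < y" "y < b" "0 < y" using x by (auto simp: y_def)
  have g'y: "continuous_on {0..y} g'" using g' y bt by (auto intro: continuous_on_subset)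
  have "bounded (g' ` {0..y})" by (intro compact_imp_bounded compact_continuous_image g'y) simp
  then obtain L where L: "L > 0" "\<And>s. s \<in> {0..y} \<Longrightarrow> \<bar>g' s\<bar> \<le> L" by (auto simp: bounded_pos)
  define \<omega> where "\<omega> = \<eta> / (2 * L)"
  have \<omega>: "\<omega> > 0" using \<eta> L by (simp add: \<omega>_def)
  obtain d where d: "d > 0" "\<And>s. s \<in> {0..b} \<Longrightarrow> dist s x < d \<Longrightarrow> dist (h s) (h x) < \<omega>"
    using h x \<omega> unfolding continuous_on_iff by (metis atLeastAtMost_iff less_eq_real_def)
  have glip: "\<bar>g v - g u\<bar> \<le> L * (v - u)" if "0 \<le> u" "u \<le> v" "v \<le> y" for u v
  proof (cases "u = v")
    case False
    then have "u < v" using that by simp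
    moreover have "(g has_real_derivative g' s) (at s)" if "u \<le> s" "s \<le> v" for s
      using der[of s] that \<open>0 \<le> u\<close> \<open>v \<le> y\<close> y bt by auto
    ultimately obtain z where "u < z" "z < v" "g v - g u = (v - u) * g' z"
      using MVT2[of u v g g'] by blast
    then show ?thesis using L(2)[of z] that \<open>u < v\<close> by (simp add: abs_mult mult.commute)
  qed simp
  have "norm (g x *\<^sub>R (h v - h u) - (Fn v - Fn u)) \<le> \<eta> * (v - u)"
    if uv: "u \<le> x" "x \<le> v" "0 \<le> u" "v \<le> b" "{u..v} \<subseteq> ball x (min d (y - x))" for u v
  proof -
    have "v \<in> ball x (min d (y - x))" using subsetD[OF uv(5), of v] uv(1,2) by simp
    then have vy: "v < y" using uv by (auto simp: dist_real_def)
    define k where "k s = h s - h x" for s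
    have hk: "h s = k s + h x" for s by (simp add: k_def)
    have kb: "norm (k s) \<le> \<omega>" if "s \<in> {u..v}" for s
    proof -
      have "dist x s < d" using subsetD[OF uv(5) that] by simp
      then have "dist (h s) (h x) < \<omega>" using d(2)[of s] that uv(3,4) by (simp add: dist_commute)
      then show ?thesis by (simp add: k_def dist_norm less_imp_le)
    qed
    have hc: "continuous_on {0..v} h" using h uv by (auto intro: continuous_on_subset)
    have g'c: "continuous_on {0..v} g'" using g'y vy by (auto intro: continuous_on_subset)
    have int_h: "(\<lambda>s. g' s *\<^sub>R h s) integrable_on {0..v}"
      by (intro integrable_continuous_real continuous_intros hc g'c)
    have kc: "continuous_on {u..v} k" unfolding k_def using hc uv by (auto intro!: continuous_intros intro: continuous_on_subset)
    have g'uv: "continuous_on {u..v} g'" using g'c uv by (auto intro: continuous_on_subset)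
    have int_k: "(\<lambda>s. g' s *\<^sub>R k s) integrable_on {u..v}"
      by (intro integrable_continuous_real continuous_intros kc g'uv)
    have ftc: "(g' has_integral (g v - g u)) {u..v}"
      by (rule fundamental_theorem_of_calculus)
         (use uv vy y bt der in \<open>auto simp flip: has_real_derivative_iff_has_vector_derivative intro: has_field_derivative_at_within\<close>)
    have "integral {0..v} (\<lambda>s. g' s *\<^sub>R h s) - integral {0..u} (\<lambda>s. g' s *\<^sub>R h s) = integral {u..v} (\<lambda>s. g' s *\<^sub>R h s)"
      using Henstock_Kurzweil_Integration.integral_combine[OF _ _ int_h, of u] uv by (simp add: algebra_simps)
    also have "\<dots> = integral {u..v} (\<lambda>s. g' s *\<^sub>R k s + g' s *\<^sub>R h x)"
      by (rule integral_cong) (simp add: k_def algebra_simps)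
    also have "\<dots> = integral {u..v} (\<lambda>s. g' s *\<^sub>R k s) + (g v - g u) *\<^sub>R h x"
      using has_integral_add[OF integrable_integral[OF int_k] has_integral_scaleR_left[OF ftc, of "h x"]]
      by (rule integral_unique)
    finally have Iv: "integral {0..v} (\<lambda>s. g' s *\<^sub>R h s) = integral {0..u} (\<lambda>s. g' s *\<^sub>R h s) + (integral {u..v} (\<lambda>s. g' s *\<^sub>R k s) + (g v - g u) *\<^sub>R h x)"
      by (simp only: diff_eq_eq add.commute)
    have "u < b" "v < b" "0 \<le> v" using uv vy y by auto
    then have "g x *\<^sub>R (h v - h u) - (Fn v - Fn u)
       = (g x - g v) *\<^sub>R k v - (g x - g u) *\<^sub>R k u + integral {u..v} (\<lambda>s. g' s *\<^sub>R k s)"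
      unfolding Fn[OF \<open>0 \<le> u\<close> \<open>u < b\<close>] Fn[OF \<open>0 \<le> v\<close> \<open>v < b\<close>] Iv hk[of u] hk[of v] by (simp add: algebra_simps)
    also have "norm \<dots> \<le> norm ((g x - g v) *\<^sub>R k v) + norm ((g x - g u) *\<^sub>R k u) + norm (integral {u..v} (\<lambda>s. g' s *\<^sub>R k s))"
      by (meson add_mono norm_triangle_ineq norm_triangle_ineq4 order_refl order_trans)
    also have "\<dots> \<le> L * (v - x) * \<omega> + L * (x - u) * \<omega> + L * \<omega> * (v - u)"
    proof (intro add_mono)
      show "norm ((g x - g v) *\<^sub>R k v) \<le> L * (v - x) * \<omega>"
        unfolding norm_scaleR using glip[of x v] uv vy y x kb[of v] L by (intro mult_mono) auto
      show "norm ((g x - g u) *\<^sub>R k u) \<le> L * (x - u) * \<omega>"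
        unfolding norm_scaleR using glip[of u x] uv vy y x kb[of u] L by (intro mult_mono) auto
      have "norm (integral (cbox u v) (\<lambda>s. g' s *\<^sub>R k s)) \<le> L * \<omega> * measure lborel (cbox u v)"
      proof (rule integrable_bound)
        show "norm (g' s *\<^sub>R k s) \<le> L * \<omega>" if "s \<in> cbox u v" for s
          unfolding norm_scaleR using L(2)[of s] kb[of s] that uv vy L \<omega> by (intro mult_mono) auto
      qed (use L \<omega> int_k in auto)
      then show "norm (integral {u..v} (\<lambda>s. g' s *\<^sub>R k s)) \<le> L * \<omega> * (v - u)" using uv by simp
    qed
    also have "\<dots> = \<eta> * (v - u)" using L by (simp add: \<omega>_def field_simps)
    finally show ?thesis .
  qed
  then show ?thesis using d(1) y by (intro exI[of _ "min d (y - x)"]) auto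
qed

lemma has_stieltjes_integral_by_parts:
  fixes h :: "real \<Rightarrow> 'a::banach"
  assumes b: "0 < b" "b < t" and h: "continuous_on {0..b} h" and g': "continuous_on {0..<t} g'"
    and der: "\<And>s. 0 \<le> s \<Longrightarrow> s < t \<Longrightarrow> (g has_real_derivative g' s) (at s)"
  shows "has_stieltjes_integral g h (g b *\<^sub>R h b - g 0 *\<^sub>R h 0 - integral {0..b} (\<lambda>s. g' s *\<^sub>R h s)) 0 b"
proof -
  define Fn where "Fn c = g c *\<^sub>R h c - integral {0..c} (\<lambda>s. g' s *\<^sub>R h s)" for c
  have gc: "continuous_on {0..b} g"
    using der b by (intro continuous_at_imp_continuous_on) (force intro: DERIV_isCont)
  have g'b: "continuous_on {0..b} g'" using g' b by (auto intro: continuous_on_subset)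
  have Fc: "continuous_on {0..b} Fn" unfolding Fn_def
    by (intro continuous_intros gc h indefinite_integral_continuous_1 integrable_continuous_real g'b)
  have "has_stieltjes_integral g h (Fn b - Fn 0) 0 b"
  proof (rule has_stieltjes_integral_of_indefinite[OF b(1) h])
    show "(Fn \<longlongrightarrow> Fn 0) (at 0 within {0..b})" "(Fn \<longlongrightarrow> Fn b) (at b within {0..b})"
      using Fc b by (auto simp: continuous_on_def)
    show "\<exists>\<delta>>0. \<forall>u v. u \<le> x \<and> x \<le> v \<and> 0 \<le> u \<and> v \<le> b \<and> {u..v} \<subseteq> ball x \<delta> \<longrightarrow>
      norm (g x *\<^sub>R (h v - h u) - (Fn v - Fn u)) \<le> \<eta> * (v - u)" if "0 < x" "x < b" "0 < \<eta>" for x \<eta>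
      by (rule by_parts_local[OF h g' _ der _ that]) (use b in \<open>auto simp: Fn_def\<close>)
  qed
  then show ?thesis by (simp add: Fn_def algebra_simps)
qed

lemma has_real_derivative_frac_weight:
  assumes "s < t"
  shows "((\<lambda>s. (t - s) powr (-\<rho>)) has_real_derivative \<rho> * (t - s) powr (-\<rho> - 1)) (at s)"
  using assms by (auto intro!: derivative_eq_intros)

lemma continuous_on_frac_weight_deriv: "continuous_on {0..<t} (\<lambda>s. \<rho> * (t - s) powr (-\<rho> - 1) :: real)"
  by (intro continuous_intros) auto

text \<open>
  Let \<open>k = h - h t \<le> 0\<close> and suppose \<open>I < 0\<close>.  A gauge for \<open>I\<close> may use the tag \<open>t\<close>, where the weight is \<open>0\<close>,
  on \<open>[c,t]\<close>; hence the integral of \<open>g dk\<close> over \<open>[0,c]\<close> is at most \<open>-e\<close> for all \<open>c\<close> near \<open>t\<close>.  After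
  integration by parts this is a differential inequality for \<open>N\<close>, by which \<open>N / g\<close> increases and
  keeps \<open>k\<close> away from \<open>0\<close>, in contradiction to \<open>k t = 0\<close>.
\<close>

lemma stieltjes_nonneg_at_max:
  fixes h :: "real \<Rightarrow> real"
  assumes t: "0 < t" and \<rho>: "0 < \<rho>" and h: "continuous_on {0..t} h"
    and mx: "\<And>s. s \<in> {0..t} \<Longrightarrow> h s \<le> h t"
    and I: "has_stieltjes_integral (\<lambda>s. (t - s) powr (-\<rho>)) h I 0 t"
  shows "0 \<le> I"
proof (rule ccontr)
  assume "\<not> 0 \<le> I"
  define e where "e = - I / 2"
  have e: "e > 0" using \<open>\<not> 0 \<le> I\<close> by (simp add: e_def)
  define g where "g s = (t - s) powr (-\<rho>)" for s
  define g' where "g' s = \<rho> * (t - s) powr (-\<rho> - 1)" for s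
  define k where "k s = h s - h t" for s
  have der: "(g has_real_derivative g' s) (at s)" if "s < t" for s
    unfolding g_def[abs_def] g'_def by (rule has_real_derivative_frac_weight[OF that])
  have g'c: "continuous_on {0..<t} g'" unfolding g'_def by (rule continuous_on_frac_weight_deriv)
  have gpos: "0 < g s" if "s < t" for s using that by (simp add: g_def)
  have g'pos: "0 \<le> g' s" for s using \<rho> by (simp add: g'_def)
  have k: "continuous_on {0..t} k" unfolding k_def by (intro continuous_intros h)
  have kneg: "k s \<le> 0" if "s \<in> {0..t}" for s using mx[OF that] by (simp add: k_def)
  have "has_stieltjes_integral g k I 0 t"
    using has_stieltjes_integral_cong[OF I, of "h t" k] by (simp add: k_def g_def[abs_def])
  then obtain \<gamma> where \<gamma>: "gauge \<gamma>" "\<And>p. p tagged_division_of {0..t} \<Longrightarrow> \<gamma> fine p \<Longrightarrow>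
      norm ((\<Sum>(x, K)\<in>p. g x *\<^sub>R (k (Sup K) - k (Inf K))) - I) < e"
    using e unfolding has_stieltjes_integral_def by meson
  obtain d where d: "d > 0" "ball t d \<subseteq> \<gamma> t"
    using \<gamma>(1) open_contains_ball[of "\<gamma> t"] unfolding gauge_def by blast
  define c0 where "c0 = max (t / 2) (t - d / 2)"
  have c0: "0 < c0" "c0 < t" using t d by (auto simp: c0_def)
  \<comment> \<open>Integration by parts turns the Stieltjes integral of \<open>g dk\<close> over \<open>[0,c]\<close> into \<open>g c * k c + N c - e\<close>.\<close>
  define N where "N c = e - g 0 * k 0 - integral {0..c} (\<lambda>s. g' s * k s)" for c
  have F: "g c * k c + N c \<le> 0" if c: "c0 \<le> c" "c < t" for c
  proof -
    define F where "F = g c * k c - g 0 * k 0 - integral {0..c} (\<lambda>s. g' s * k s)"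
    have c': "0 < c" using c c0 by simp
    have "has_stieltjes_integral g k F 0 c"
      unfolding F_def using has_stieltjes_integral_by_parts[OF c' c(2) continuous_on_subset[OF k] g'c der] c
      by simp
    then have "F < -e + e'" if e': "e' > 0" for e'
    proof -
      obtain \<gamma>' where \<gamma>': "gauge \<gamma>'" "\<And>p. p tagged_division_of {0..c} \<Longrightarrow> \<gamma>' fine p \<Longrightarrow>
          norm ((\<Sum>(x, K)\<in>p. g x *\<^sub>R (k (Sup K) - k (Inf K))) - F) < e'"
        using \<open>has_stieltjes_integral g k F 0 c\<close> e' unfolding has_stieltjes_integral_def by meson
      obtain p where p: "p tagged_division_of {0..c}" "(\<lambda>x. \<gamma> x \<inter> \<gamma>' x) fine p"
        using fine_division_exists_real[OF gauge_Int[OF \<gamma>(1) \<gamma>'(1)]] by blast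
      have pf: "\<gamma> fine p" "\<gamma>' fine p" using p(2) by (auto simp: fine_Int)
      have q: "{(t, {c..t})} tagged_division_of {c..t}"
        using tagged_division_of_self_real[of t c t] c by simp
      have un: "p \<union> {(t, {c..t})} tagged_division_of {0..t}"
      proof -
        have "{0..t} \<inter> {x. x \<le> c} = {0..c}" "{0..t} \<inter> {x. c \<le> x} = {c..t}" using c c' by auto
        then show ?thesis
          using tagged_division_Un_interval_real[of p 0 t 1 c "{(t, {c..t})}"] p(1) q by simp
      qed
      have fin: "\<gamma> fine (p \<union> {(t, {c..t})})"
      proof -
        have "{c..t} \<subseteq> ball t d" using c c0 d by (auto simp: c0_def dist_real_def)
        then show ?thesis using pf(1) d by (auto simp: fine_def)
      qed
      have notin: "(t, {c..t}) \<notin> p"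
        using tagged_division_ofD(2,3)[OF p(1), of t "{c..t}"] c by auto
      have "(\<Sum>(x, K)\<in>p \<union> {(t, {c..t})}. g x *\<^sub>R (k (Sup K) - k (Inf K))) = (\<Sum>(x, K)\<in>p. g x *\<^sub>R (k (Sup K) - k (Inf K)))"
        using tagged_division_ofD(1)[OF p(1)] notin by (simp add: g_def)
      then have "norm ((\<Sum>(x, K)\<in>p. g x *\<^sub>R (k (Sup K) - k (Inf K))) - I) < e"
        using \<gamma>(2)[OF un fin] by simp
      then show ?thesis using \<gamma>'(2)[OF p(1) pf(2)] unfolding e_def real_norm_def by argo
    qed
    then have "F \<le> -e" by (meson field_le_epsilon less_imp_le)
    then show ?thesis by (simp add: F_def N_def)
  qed
  have Nder: "(N has_real_derivative - (g' c * k c)) (at c)" if c: "0 < c" "c < t" for c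
  proof -
    define y where "y = (c + t) / 2"
    have y: "c < y" "y < t" using c by (auto simp: y_def)
    have "continuous_on {0..y} (\<lambda>s. g' s * k s)"
      using y c by (intro continuous_on_mult continuous_on_subset[OF g'c] continuous_on_subset[OF k]) auto
    from integral_has_real_derivative[OF this, of c]
    have "((\<lambda>u. integral {0..u} (\<lambda>s. g' s * k s)) has_real_derivative g' c * k c) (at c)"
      using c y by (simp add: at_within_interior[of c "{0..y}"])
    then show ?thesis unfolding N_def[abs_def] by (auto intro!: derivative_eq_intros)
  qed
  have N0: "0 < N c0"
  proof -
    have "integral {0..c0} (\<lambda>s. g' s * k s) \<le> 0"
    proof -
      have "(\<lambda>s. g' s * k s) integrable_on {0..c0}"
        using c0 by (intro integrable_continuous_real continuous_on_mult continuous_on_subset[OF g'c] continuous_on_subset[OF k]) auto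
      then have "integral {0..c0} (\<lambda>s. g' s * k s) \<le> integral {0..c0} (\<lambda>_. 0)"
        by (rule integral_le[OF _ integrable_0]) (rule mult_nonneg_nonpos, rule g'pos, rule kneg, use c0 in simp)
      then show ?thesis by simp
    qed
    moreover have "g 0 * k 0 \<le> 0" using gpos[of 0] kneg[of 0] t by (simp add: mult_nonneg_nonpos)
    ultimately show ?thesis using e by (simp add: N_def)
  qed
  define \<mu> where "\<mu> = N c0 / g c0"
  have \<mu>: "\<mu> > 0" using N0 gpos[of c0] c0 by (simp add: \<mu>_def)
  have kbig: "k c \<le> - \<mu>" if c: "c0 \<le> c" "c < t" for c
  proof -
    \<comment> \<open>The derivative of \<open>N / g\<close> is \<open>- g' (g k + N) / g\<^sup>2\<close>, which is nonnegative by \<open>F\<close>.\<close>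
    have "N c0 / g c0 \<le> N c / g c"
    proof (rule DERIV_nonneg_imp_nondecreasing[OF c(1)])
      fix x assume x: "c0 \<le> x" "x \<le> c"
      then have xt: "0 < x" "x < t" using c c0 by auto
      have "((\<lambda>c. N c / g c) has_real_derivative (- (g' x * k x) * g x - N x * g' x) / (g x * g x)) (at x)"
        using gpos[of x] xt by (intro DERIV_divide Nder der) auto
      moreover have "0 \<le> (- (g' x * k x) * g x - N x * g' x) / (g x * g x)"
      proof -
        have "- (g' x * k x) * g x - N x * g' x = g' x * (- (g x * k x + N x))" by (simp add: algebra_simps)
        also have "\<dots> \<ge> 0" using F[of x] x xt g'pos[of x] by (intro mult_nonneg_nonneg) auto
        finally show ?thesis by simp
      qed
      ultimately show "\<exists>y. DERIV (\<lambda>c. N c / g c) x :> y \<and> 0 \<le> y" by blast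
    qed
    moreover have "N c / g c \<le> - k c"
      using F[OF c] gpos[OF c(2)] by (simp add: divide_le_eq mult.commute)
    ultimately show ?thesis by (simp add: \<mu>_def)
  qed
  have "(k \<longlongrightarrow> k t) (at t within {0..t})" using k t by (auto simp: continuous_on_def)
  then have "eventually (\<lambda>c. - \<mu> < k c) (at t within {0..t})"
    using \<mu> by (intro order_tendstoD(1)[of k "k t"]) (simp_all add: k_def)
  then obtain d' where d': "d' > 0" "\<And>c. c \<in> {0..t} \<Longrightarrow> c \<noteq> t \<Longrightarrow> dist c t < d' \<Longrightarrow> - \<mu> < k c"
    unfolding eventually_at by auto
  define c where "c = max c0 (t - d' / 2)"
  have c: "c0 \<le> c" "c < t" "dist c t < d'" using c0 d' by (auto simp: c_def dist_real_def)
  then show False using kbig[of c] d'(2)[of c] c0 by auto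
qed

lemma has_caputo_derivative_add:
  fixes h1 h2 :: "real \<Rightarrow> 'a::real_normed_vector"
  assumes "has_caputo_derivative \<sigma> h1 d1 t" and "has_caputo_derivative \<sigma> h2 d2 t"
  shows "has_caputo_derivative \<sigma> (\<lambda>s. h1 s + h2 s) (d1 + d2) t"
proof -
  obtain I1 I2 where "has_stieltjes_integral (\<lambda>s. (t - s) powr (-\<sigma>)) h1 I1 0 t" "d1 = (1 / Gamma (1 - \<sigma>)) *\<^sub>R I1"
    "has_stieltjes_integral (\<lambda>s. (t - s) powr (-\<sigma>)) h2 I2 0 t" "d2 = (1 / Gamma (1 - \<sigma>)) *\<^sub>R I2"
    using assms unfolding has_caputo_derivative_def by blast
  then show ?thesis unfolding has_caputo_derivative_def
    by (intro exI[of _ "I1 + I2"] conjI has_stieltjes_integral_add) (simp_all add: scaleR_add_right)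
qed

lemma has_caputo_derivative_linear:
  fixes h :: "real \<Rightarrow> 'a::real_normed_vector" and L :: "'a \<Rightarrow> 'b::real_normed_vector"
  assumes "has_caputo_derivative \<sigma> h d t" and L: "bounded_linear L"
  shows "has_caputo_derivative \<sigma> (\<lambda>s. L (h s)) (L d) t"
proof -
  obtain I where I: "has_stieltjes_integral (\<lambda>s. (t - s) powr (-\<sigma>)) h I 0 t" "d = (1 / Gamma (1 - \<sigma>)) *\<^sub>R I"
    using assms(1) unfolding has_caputo_derivative_def by blast
  have "L d = (1 / Gamma (1 - \<sigma>)) *\<^sub>R L I"
    unfolding I(2) by (rule linear_cmul[OF bounded_linear.linear[OF L]])
  then show ?thesis unfolding has_caputo_derivative_def
    using has_stieltjes_integral_linear[OF I(1) L] by blast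
qed

lemma caputo_nonneg_at_max:
  fixes h :: "real \<Rightarrow> real"
  assumes "0 < t" "0 < \<sigma>" "\<sigma> < 1" "continuous_on {0..t} h" "\<And>s. s \<in> {0..t} \<Longrightarrow> h s \<le> h t"
    and d: "has_caputo_derivative \<sigma> h d t"
  shows "0 \<le> d"
proof -
  obtain I where I: "has_stieltjes_integral (\<lambda>s. (t - s) powr (-\<sigma>)) h I 0 t" "d = (1 / Gamma (1 - \<sigma>)) *\<^sub>R I"
    using d unfolding has_caputo_derivative_def by blast
  have "0 \<le> I" using stieltjes_nonneg_at_max[OF assms(1,2,4,5) I(1)] .
  moreover have "0 < Gamma (1 - \<sigma>)" using assms by (intro Gamma_real_pos) simp
  ultimately show ?thesis using I(2) by simp
qed

section \<open>Caputo derivatives of fractional integrals\<close>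

lemma integrable_powr_over_one_plus:
  fixes \<rho> :: real
  assumes \<rho>: "0 < \<rho>" "\<rho> < 1"
  shows "integrable lborel (\<lambda>z. indicator {0<..} z * (z powr (\<rho> - 1) / (1 + z)))"
proof -
  have 1: "integrable lborel (\<lambda>z. indicator {0<..<1} z * z powr (\<rho> - 1))"
    using set_integrable_powr_Ioo[OF \<rho>(1), of 1] by (simp add: set_integrable_def)
  have "(\<lambda>z. z powr (\<rho> - 2)) integrable_on {1..}"
    using has_integral_powr_to_inf[of "\<rho> - 2" 1] \<rho> by (auto simp: integrable_on_def)
  then have "(\<lambda>z. z powr (\<rho> - 2)) absolutely_integrable_on {1..}"
    by (rule nonnegative_absolutely_integrable_1) simp
  then have 2: "integrable lborel (\<lambda>z. indicator {1..} z * z powr (\<rho> - 2))"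
    unfolding set_integrable_def by (subst (asm) integrable_completion) auto
  show ?thesis
  proof (rule Bochner_Integration.integrable_bound[OF Bochner_Integration.integrable_add[OF 1 2]])
    show "AE z in lborel. norm (indicator {0<..} z * (z powr (\<rho> - 1) / (1 + z)))
       \<le> norm (indicator {0<..<1} z * z powr (\<rho> - 1) + indicator {1..} z * z powr (\<rho> - 2))"
    proof (rule AE_I2)
      fix z :: real
      consider "z \<le> 0" | "0 < z" "z < 1" | "1 \<le> z" by linarith
      then show "norm (indicator {0<..} z * (z powr (\<rho> - 1) / (1 + z)))
         \<le> norm (indicator {0<..<1} z * z powr (\<rho> - 1) + indicator {1..} z * z powr (\<rho> - 2))"
      proof cases
        case 2
        then show ?thesis by (simp add: field_simps)
      next
        case 3
        have "z powr (\<rho> - 1) / (1 + z) \<le> z powr (\<rho> - 1) / z"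
          using 3 by (intro divide_left_mono) auto
        also have "\<dots> = z powr (\<rho> - 2)" using 3 by (simp add: powr_diff power2_eq_square)
        finally show ?thesis using 3 by simp
      qed simp
    qed
  qed measurable
qed

text \<open>
  An antiderivative is \<open>- ((y - s) / (d + s)) powr \<rho> / (d + y)\<close>.
\<close>

lemma integral_frac_weight_kernel:
  fixes \<rho> :: real
  assumes \<rho>: "0 < \<rho>" "\<rho> < 1" and d: "0 < d" and y: "0 < y"
  shows "(LINT s:{0<..<y}|lborel. \<rho> * (d + s) powr (-\<rho> - 1) * (y - s) powr (\<rho> - 1)) = (y / d) powr \<rho> / (d + y)"
proof -
  define f where "f s = - (((y - s) / (d + s)) powr \<rho> / (d + y))" for s
  have "((\<lambda>s. \<rho> * (d + s) powr (-\<rho> - 1) * (y - s) powr (\<rho> - 1)) has_integral (f y - f 0)) {0..y}"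
  proof (rule fundamental_theorem_of_calculus_interior)
    show "continuous_on {0..y} f"
      unfolding f_def using d y \<rho> by (intro continuous_intros continuous_on_powr') auto
    fix s assume s: "s \<in> {0<..<y}"
    define b where "b = (y - s) / (d + s)"
    have b: "0 < b" using s d by (simp add: b_def)
    have "(f has_real_derivative - (\<rho> * b powr (\<rho> - 1) * (((-1) * (d + s) - (y - s) * 1) / ((d + s) * (d + s))) / (d + y))) (at s)"
    proof -
      have "((\<lambda>s. (y - s) / (d + s)) has_real_derivative (((-1) * (d + s) - (y - s) * 1) / ((d + s) * (d + s)))) (at s)"
        using s d by (intro DERIV_divide) (auto intro!: derivative_eq_intros)
      from DERIV_minus[OF DERIV_cdivide[OF DERIV_fun_powr[OF this b[unfolded b_def], of \<rho>], of "d + y"]]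
      show ?thesis unfolding f_def b_def by simp
    qed
    moreover have "- (\<rho> * b powr (\<rho> - 1) * (((-1) * (d + s) - (y - s) * 1) / ((d + s) * (d + s))) / (d + y)) = \<rho> * (d + s) powr (-\<rho> - 1) * (y - s) powr (\<rho> - 1)"
    proof -
      have "((-1) * (d + s) - (y - s) * 1) = - (d + y)" by simp
      then have "- (\<rho> * b powr (\<rho> - 1) * (((-1) * (d + s) - (y - s) * 1) / ((d + s) * (d + s))) / (d + y)) = \<rho> * b powr (\<rho> - 1) / ((d + s) * (d + s))"
        using d y by (simp only: minus_divide_left mult_minus_right minus_minus times_divide_eq_right) simp
      also have "\<dots> = \<rho> * (y - s) powr (\<rho> - 1) * ((d + s) powr (1 - \<rho>) / ((d + s) * (d + s)))"
      proof -
        have "b powr (\<rho> - 1) = (y - s) powr (\<rho> - 1) * (d + s) powr (1 - \<rho>)"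
          using s d powr_minus_divide[of "d + s" "\<rho> - 1"] by (simp add: b_def powr_divide)
        then show ?thesis by simp
      qed
      also have "(d + s) powr (1 - \<rho>) / ((d + s) * (d + s)) = (d + s) powr (-\<rho> - 1)"
      proof -
        have "(d + s) * (d + s) = (d + s) powr 2" using s d by (simp add: power2_eq_square)
        moreover have "1 - \<rho> - 2 = -\<rho> - 1" by simp
        ultimately show ?thesis by (simp only: powr_diff[symmetric])
      qed
      finally show ?thesis by simp
    qed
    ultimately show "(f has_vector_derivative \<rho> * (d + s) powr (-\<rho> - 1) * (y - s) powr (\<rho> - 1)) (at s)"
      by (simp add: has_real_derivative_iff_has_vector_derivative)
  qed (use y in simp)
  moreover have "f y - f 0 = (y / d) powr \<rho> / (d + y)" by (simp add: f_def)
  ultimately have hi: "((\<lambda>s. \<rho> * (d + s) powr (-\<rho> - 1) * (y - s) powr (\<rho> - 1)) has_integral (y / d) powr \<rho> / (d + y)) {0..y}" by simp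
  then have "(\<lambda>s. \<rho> * (d + s) powr (-\<rho> - 1) * (y - s) powr (\<rho> - 1)) absolutely_integrable_on {0..y}"
    using \<rho> by (intro nonnegative_absolutely_integrable_1) auto
  then have "(\<lambda>s. \<rho> * (d + s) powr (-\<rho> - 1) * (y - s) powr (\<rho> - 1)) absolutely_integrable_on {0<..<y}"
    by (rule set_integrable_subset) auto
  then have "set_integrable lborel {0<..<y} (\<lambda>s. \<rho> * (d + s) powr (-\<rho> - 1) * (y - s) powr (\<rho> - 1))"
    unfolding set_integrable_def by (subst (asm) integrable_completion) auto
  from set_borel_integral_eq_integral(2)[OF this] show ?thesis
    using hi by (simp add: integral_open_interval_real has_integral_iff)
qed

text \<open>
  In infinite dimensions the two integrals are compared through inner products with fixed vectors.
\<close>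

lemma integral_eq_lebesgue_if_continuous:
  fixes f :: "real \<Rightarrow> 'b::{real_inner, banach, second_countable_topology}"
  assumes f: "continuous_on {a..b} f"
  shows "integral {a..b} f = (LINT s:{a<..<b}|lborel. f s)"
proof (rule vector_eq_ldot[THEN iffD1], rule allI)
  fix z
  have int: "set_integrable lborel {a<..<b} f" if "continuous_on {a..b} f" for f :: "real \<Rightarrow> 'c::{banach, second_countable_topology}"
    by (rule set_integrable_subset[OF borel_integrable_atLeastAtMost'[OF that]]) auto
  have c: "continuous_on {a..b} (\<lambda>s. inner z (f s))" by (intro continuous_intros f)
  have "inner z (integral {a..b} f) = integral {a..b} (\<lambda>s. inner z (f s))"
    using integral_linear[OF integrable_continuous_real[OF f] bounded_linear_inner_right[of z]] by (simp add: comp_def)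
  also have "\<dots> = integral {a<..<b} (\<lambda>s. inner z (f s))" by (simp add: integral_open_interval_real)
  also have "\<dots> = (LINT s:{a<..<b}|lborel. inner z (f s))"
    by (rule set_borel_integral_eq_integral(2)[symmetric]) (rule int[OF c])
  also have "\<dots> = inner z (LINT s:{a<..<b}|lborel. f s)"
    using integral_bounded_linear[OF bounded_linear_inner_right int[OF f, unfolded set_integrable_def], of z]
    by (simp add: set_lebesgue_integral_def)
  finally show "inner z (integral {a..b} f) = inner z (LINT s:{a<..<b}|lborel. f s)" .
qed

text \<open>
  Let \<open>h\<close> be the fractional integral of \<open>\<phi>\<close> and \<open>d = t - c\<close>.  Integration by parts and Fubini turn the
  integral over \<open>[0,c]\<close> into that of \<open>\<phi>(c - y)\<close> against
  \<open>d powr (1 - \<rho>) * y powr (\<rho> - 1) / (d + y) / \<Gamma>(\<rho>)\<close>.  Substituting \<open>y = d z\<close> leaves the fixed integrable kernel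
  \<open>W(z) = z powr (\<rho> - 1) / (1 + z) / \<Gamma>(\<rho>)\<close> and the argument \<open>c - d z\<close>, which tends to \<open>t\<close> as \<open>c\<close> does.
\<close>

lemma stieltjes_frac_integral_zero:
  fixes \<phi> :: "real \<Rightarrow> 'b::{real_inner, banach, second_countable_topology}"
  assumes \<rho>: "0 < \<rho>" "\<rho> < 1" and t: "0 < t" "t \<le> T" and \<phi>: "continuous_on {0..T} \<phi>" and \<phi>t: "\<phi> t = 0"
  shows "has_stieltjes_integral (\<lambda>s. (t - s) powr (-\<rho>)) (conv (cutoff T (frac_kernel \<rho>)) (cutoff T \<phi>)) 0 0 t"
proof -
  define k where "k = cutoff T (frac_kernel \<rho>)"
  define p where "p = cutoff T \<phi>"
  define h where "h = conv k p"
  define g where "g s = (t - s) powr (-\<rho>)" for s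
  define g' where "g' s = \<rho> * (t - s) powr (-\<rho> - 1)" for s
  define Fn where "Fn c = (if c < t then g c *\<^sub>R h c - integral {0..c} (\<lambda>s. g' s *\<^sub>R h s) else 0)" for c
  have der: "(g has_real_derivative g' s) (at s)" if "s < t" for s
    unfolding g_def[abs_def] g'_def by (rule has_real_derivative_frac_weight[OF that])
  have g'c: "continuous_on {0..<t} g'" unfolding g'_def by (rule continuous_on_frac_weight_deriv)
  have kint: "integrable lborel k" unfolding k_def by (rule integrable_cutoff_frac_kernel[OF \<rho>(1)])
  obtain K where K: "0 \<le> K" "\<And>s. s \<in> {0..T} \<Longrightarrow> norm (\<phi> s) \<le> K" using continuous_bounded_on_Icc[OF \<phi>] by blast
  have pbd: "norm (p s) \<le> K" for s unfolding p_def using K by (rule norm_cutoff_le)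
  have pmeas [measurable]: "p \<in> borel_measurable borel"
    unfolding p_def by (rule cutoff_measurable) (rule continuous_on_subset[OF \<phi>], auto)
  have hcont: "continuous_on A h" for A
    unfolding h_def p_def using continuous_conv[OF kint \<phi>] by (rule continuous_on_subset) simp
  have hcausal: "causal h" unfolding h_def k_def p_def by (intro causal_conv) auto
  have h0: "h 0 = 0" using hcausal by (simp add: causal_def)
  define W where "W z = indicator {0<..} z * (z powr (\<rho> - 1) / (1 + z)) / Gamma \<rho>" for z :: real
  have Wint: "integrable lborel W" unfolding W_def
    by (rule integrable_divide[OF integrable_powr_over_one_plus[OF \<rho>]])
  have Wnn: "0 \<le> W z" for z unfolding W_def using \<rho> by (auto simp: indicator_def less_imp_le)
  have key: "Fn c = (LINT z|lborel. W z *\<^sub>R p (c - (t - c) * z))" if c: "0 \<le> c" "c < t" for c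
  proof (cases "c = 0")
    case True
    have "(\<lambda>z. W z *\<^sub>R p (c - (t - c) * z)) = (\<lambda>z. 0)"
    proof
      fix z show "W z *\<^sub>R p (c - (t - c) * z) = 0"
        using True t by (cases "0 < z") (auto simp: W_def p_def cutoff_def mult_less_0_iff)
    qed
    then have "(LINT z|lborel. W z *\<^sub>R p (c - (t - c) * z)) = 0" by (simp only: integral_zero)
    then show ?thesis using True t by (simp add: Fn_def h0)
  next
    case False
    then have c0: "0 < c" using c by simp
    define d where "d = t - c"
    have d: "0 < d" using c by (simp add: d_def)
    \<comment> \<open>The integral of \<open>g' h\<close> over \<open>[0,c]\<close> is the value at \<open>c\<close> of a convolution, so that associativity
      moves the weight onto the kernel of \<open>h\<close>.\<close>
    define a where "a s = (if 0 < s \<and> s < c then g' (c - s) else 0)" for s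
    have aint: "integrable lborel a"
    proof -
      have "continuous_on {0..c} (\<lambda>s. g' (c - s))"
        unfolding g'_def using c by (intro continuous_intros) auto
      then have "set_integrable lborel {0..c} (\<lambda>s. g' (c - s))"
        by (rule borel_integrable_atLeastAtMost')
      then have "set_integrable lborel {0<..<c} (\<lambda>s. g' (c - s))" by (rule set_integrable_subset) auto
      moreover have "a = (\<lambda>s. indicator {0<..<c} s *\<^sub>R g' (c - s))" by (auto simp: a_def indicator_def fun_eq_iff)
      ultimately show ?thesis by (simp add: set_integrable_def)
    qed
    have acausal: "causal a" by (simp add: causal_def a_def)
    have "integral {0..c} (\<lambda>s. g' s *\<^sub>R h s) = (LINT s:{0<..<c}|lborel. g' s *\<^sub>R h s)"
      using c by (intro integral_eq_lebesgue_if_continuous continuous_intros hcont continuous_on_subset[OF g'c]) auto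
    also have "\<dots> = conv a h c"
      unfolding conv_commuted set_lebesgue_integral_def
      by (rule Bochner_Integration.integral_cong[OF refl]) (auto simp: a_def indicator_def)
    also have "\<dots> = conv (conv a k) p c"
      unfolding h_def by (rule conv_assoc[OF aint kint pmeas pbd])
    finally have I: "integral {0..c} (\<lambda>s. g' s *\<^sub>R h s) = conv (conv a k) p c" .
    have "Fn c = (LINT y|lborel. g c *\<^sub>R (k y *\<^sub>R p (c - y))) - (LINT y|lborel. conv a k y *\<^sub>R p (c - y))"
      using c unfolding Fn_def I by (simp add: h_def conv_def del: scaleR_scaleR)
    also have "\<dots> = (LINT y|lborel. g c *\<^sub>R (k y *\<^sub>R p (c - y)) - conv a k y *\<^sub>R p (c - y))"
      by (intro Bochner_Integration.integral_diff[symmetric] integrable_scaleR_right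
          integrable_conv_integrand[OF kint pmeas pbd] integrable_conv_integrand[OF integrable_conv[OF aint kint] pmeas pbd])
    also have "\<dots> = (LINT y|lborel. (indicator {0<..} y * (d powr (1 - \<rho>) * y powr (\<rho> - 1) / (d + y)) / Gamma \<rho>) *\<^sub>R p (c - y))"
    proof (rule Bochner_Integration.integral_cong[OF refl])
      fix y :: real
      have cz: "causal (conv a k)" unfolding k_def by (intro causal_conv acausal causal_cutoff)
      consider "y \<le> 0" | "c \<le> y" | "0 < y" "y < c" by linarith
      then show "g c *\<^sub>R (k y *\<^sub>R p (c - y)) - conv a k y *\<^sub>R p (c - y)
        = (indicator {0<..} y * (d powr (1 - \<rho>) * y powr (\<rho> - 1) / (d + y)) / Gamma \<rho>) *\<^sub>R p (c - y)"
      proof cases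
        case 1
        then show ?thesis using cz by (simp add: causal_def k_def cutoff_def)
      next
        case 2
        then show ?thesis by (simp add: p_def cutoff_def)
      next
        case 3
        have "conv a k y = (LINT s:{0<..<y}|lborel. a s *\<^sub>R k (y - s))"
          by (rule conv_eq_integral_Ioo[OF acausal]) (simp add: k_def)
        also have "\<dots> = (LINT s:{0<..<y}|lborel. (\<rho> * (d + s) powr (-\<rho> - 1) * (y - s) powr (\<rho> - 1)) / Gamma \<rho>)"
          unfolding set_lebesgue_integral_def
        proof (rule Bochner_Integration.integral_cong[OF refl])
          fix s
          show "indicat_real {0<..<y} s *\<^sub>R a s *\<^sub>R k (y - s) = indicat_real {0<..<y} s *\<^sub>R (\<rho> * (d + s) powr (-\<rho> - 1) * (y - s) powr (\<rho> - 1) / Gamma \<rho>)"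
          proof (cases "0 < s \<and> s < y")
            case True
            then have "t - (c - s) = d + s" "y - s \<le> T" using 3 c t by (auto simp: d_def)
            moreover from this(1) have "g' (c - s) = \<rho> * (d + s) powr (-\<rho> - 1)" by (simp only: g'_def)
            ultimately show ?thesis using True 3 by (simp add: a_def k_def cutoff_def frac_kernel_def)
          qed auto
        qed
        also have "\<dots> = (y / d) powr \<rho> / (d + y) / Gamma \<rho>"
          using integral_frac_weight_kernel[OF \<rho> d 3(1)] by simp
        finally have ck: "conv a k y = (y / d) powr \<rho> / (d + y) / Gamma \<rho>" .
        have ky: "k y = y powr (\<rho> - 1) / Gamma \<rho>" using 3 c t by (simp add: k_def cutoff_def frac_kernel_def)
        have gc: "g c = d powr (-\<rho>)" by (simp add: g_def d_def)
        have "d powr (-\<rho>) * y powr (\<rho> - 1) - (y / d) powr \<rho> / (d + y) = d powr (1 - \<rho>) * y powr (\<rho> - 1) / (d + y)"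
        proof -
          have e1: "(y / d) powr \<rho> = y * (y powr (\<rho> - 1) * d powr (-\<rho>))"
            using 3 d by (simp add: powr_divide powr_diff powr_minus field_simps)
          have e2: "d powr (1 - \<rho>) = d * d powr (-\<rho>)"
            using d by (simp add: powr_diff powr_minus field_simps)
          show ?thesis unfolding e1 e2 using 3 d by (simp add: field_simps)
        qed
        then have "g c * k y - conv a k y = d powr (1 - \<rho>) * y powr (\<rho> - 1) / (d + y) / Gamma \<rho>"
          unfolding ck ky gc by (metis diff_divide_distrib times_divide_eq_right)
        then have "(g c * k y - conv a k y) *\<^sub>R p (c - y) = (d powr (1 - \<rho>) * y powr (\<rho> - 1) / (d + y) / Gamma \<rho>) *\<^sub>R p (c - y)" by simp
        then show ?thesis using 3 by (simp add: scaleR_diff_left)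
      qed
    qed
    also have "\<dots> = d *\<^sub>R (LINT z|lborel. (indicator {0<..} (d * z) * (d powr (1 - \<rho>) * (d * z) powr (\<rho> - 1) / (d + d * z)) / Gamma \<rho>) *\<^sub>R p (c - d * z))"
      using d by (subst lborel_integral_real_affine[of d _ 0]) simp_all
    also have "\<dots> = (LINT z|lborel. d *\<^sub>R ((indicator {0<..} (d * z) * (d powr (1 - \<rho>) * (d * z) powr (\<rho> - 1) / (d + d * z)) / Gamma \<rho>) *\<^sub>R p (c - d * z)))"
      by (rule integral_scaleR_right[symmetric])
    also have "\<dots> = (LINT z|lborel. W z *\<^sub>R p (c - d * z))"
    proof (rule Bochner_Integration.integral_cong[OF refl])
      fix z
      have "d * (indicator {0<..} (d * z) * (d powr (1 - \<rho>) * (d * z) powr (\<rho> - 1) / (d + d * z)) / Gamma \<rho>) = W z"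
      proof (cases "0 < z")
        case True
        have "d * (d powr (1 - \<rho>) * (d * z) powr (\<rho> - 1) / (d + d * z)) = z powr (\<rho> - 1) / (1 + z)"
        proof -
          have "d powr (1 - \<rho>) * d powr (\<rho> - 1) = 1" using d by (simp add: powr_add[symmetric])
          then have "d powr (1 - \<rho>) * (d * z) powr (\<rho> - 1) = z powr (\<rho> - 1)" using d True by (simp add: powr_mult)
          moreover have "d + d * z = d * (1 + z)" by (simp add: algebra_simps)
          ultimately show ?thesis using d True by simp
        qed
        then have "d * (d powr (1 - \<rho>) * (d * z) powr (\<rho> - 1) / (d + d * z)) / Gamma \<rho> = z powr (\<rho> - 1) / (1 + z) / Gamma \<rho>"
          by (simp only:)
        then show ?thesis using True d by (simp add: W_def)
      next
        case False
        then have "\<not> 0 < d * z" using d by (simp add: zero_less_mult_iff)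
        then show ?thesis using False by (simp add: W_def)
      qed
      then show "d *\<^sub>R ((indicator {0<..} (d * z) * (d powr (1 - \<rho>) * (d * z) powr (\<rho> - 1) / (d + d * z)) / Gamma \<rho>) *\<^sub>R p (c - d * z)) = W z *\<^sub>R p (c - d * z)"
        by (simp only: scaleR_scaleR)
    qed
    finally show ?thesis by (simp add: d_def)
  qed
  have lim: "(Fn \<longlongrightarrow> 0) (at t within {0..t})"
    unfolding tendsto_at_iff_sequentially
  proof (intro allI impI)
    fix X :: "nat \<Rightarrow> real" assume X: "\<forall>i. X i \<in> {0..t} - {t}" "X \<longlonglongrightarrow> t"
    have Xi: "0 \<le> X i" "X i < t" for i using X(1) by (auto simp: less_le)
    have "(\<lambda>i. LINT z|lborel. W z *\<^sub>R p (X i - (t - X i) * z)) \<longlonglongrightarrow> integral\<^sup>L lborel (\<lambda>z::real. 0::'b)"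
    proof (rule integral_dominated_convergence)
      show "integrable lborel (\<lambda>z. W z * K)" using Wint by simp
      have [measurable]: "W \<in> borel_measurable borel" using Wint by (simp add: borel_measurable_integrable)
      show "(\<lambda>z. W z *\<^sub>R p (X i - (t - X i) * z)) \<in> borel_measurable lborel" for i by measurable
      show "AE z in lborel. norm (W z *\<^sub>R p (X i - (t - X i) * z)) \<le> W z * K" for i
        using Wnn pbd by (intro AE_I2) (simp add: mult_left_mono)
      show "AE z in lborel. (\<lambda>i. W z *\<^sub>R p (X i - (t - X i) * z)) \<longlonglongrightarrow> 0"
      proof (rule AE_I2)
        fix z
        show "(\<lambda>i. W z *\<^sub>R p (X i - (t - X i) * z)) \<longlonglongrightarrow> 0"
        proof (cases "0 < z")
          case False
          then show ?thesis by (simp add: W_def)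
        next
          case True
          have l: "(\<lambda>i. X i - (t - X i) * z) \<longlonglongrightarrow> t - (t - t) * z" by (intro tendsto_intros X)
          then have "eventually (\<lambda>i. 0 < X i - (t - X i) * z) sequentially"
            using t by (intro order_tendstoD(1)) auto
          then have ev: "eventually (\<lambda>i. X i - (t - X i) * z \<in> {0..T} \<and> p (X i - (t - X i) * z) = \<phi> (X i - (t - X i) * z)) sequentially"
          proof eventually_elim
            case (elim i)
            have "0 \<le> (t - X i) * z" using Xi[of i] True by (intro mult_nonneg_nonneg) auto
            then have "X i - (t - X i) * z \<le> T" using Xi[of i] t by linarith
            then show ?case using elim by (simp add: p_def cutoff_def)
          qed
          have "(\<lambda>i. \<phi> (X i - (t - X i) * z)) \<longlonglongrightarrow> \<phi> t"
            by (rule continuous_on_tendsto_compose[OF \<phi>]) (use l t ev in \<open>auto elim: eventually_mono\<close>)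
          then have "(\<lambda>i. p (X i - (t - X i) * z)) \<longlonglongrightarrow> 0"
            unfolding \<phi>t by (rule Lim_transform_eventually) (use ev in \<open>auto elim: eventually_mono\<close>)
          from tendsto_scaleR[OF tendsto_const this] show ?thesis by simp
        qed
      qed
    qed simp
    then show "(Fn \<circ> X) \<longlonglongrightarrow> 0" using key[OF Xi] by (simp add: comp_def)
  qed
  have lim0: "(Fn \<longlongrightarrow> Fn 0) (at 0 within {0..t})"
  proof -
    define b where "b = t / 2"
    have b: "0 < b" "b < t" using t by (auto simp: b_def)
    have "continuous_on {0..b} (\<lambda>c. g c *\<^sub>R h c - integral {0..c} (\<lambda>s. g' s *\<^sub>R h s))"
    proof (intro continuous_intros hcont indefinite_integral_continuous_1 integrable_continuous_real)
      show "continuous_on {0..b} g" unfolding g_def using b by (intro continuous_intros) auto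
      show "continuous_on {0..b} g'" using b by (intro continuous_on_subset[OF g'c]) auto
    qed
    then have "continuous_on {0..b} Fn"
      by (rule continuous_on_eq) (use b in \<open>auto simp: Fn_def\<close>)
    then have "(Fn \<longlongrightarrow> Fn 0) (at 0 within {0..b})" using b by (auto simp: continuous_on_def)
    then show ?thesis using b t by (simp add: at_within_Icc_at_right)
  qed
  have "has_stieltjes_integral g h (Fn t - Fn 0) 0 t"
  proof (rule has_stieltjes_integral_of_indefinite[OF t(1) hcont lim0])
    show "(Fn \<longlongrightarrow> Fn t) (at t within {0..t})" using lim by (simp add: Fn_def)
    show "\<exists>\<delta>>0. \<forall>u v. u \<le> x \<and> x \<le> v \<and> 0 \<le> u \<and> v \<le> t \<and> {u..v} \<subseteq> ball x \<delta> \<longrightarrow>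
      norm (g x *\<^sub>R (h v - h u) - (Fn v - Fn u)) \<le> \<eta> * (v - u)" if "0 < x" "x < t" "0 < \<eta>" for x \<eta>
      by (rule by_parts_local[OF hcont g'c order_refl der _ that]) (simp_all add: Fn_def)
  qed
  moreover have "Fn t - Fn 0 = 0" using t by (simp add: Fn_def h0)
  ultimately show ?thesis by (simp add: g_def[abs_def] h_def k_def p_def)
qed

lemma caputo_frac_integral_const:
  fixes y :: "'b::{banach, second_countable_topology}"
  assumes \<rho>: "0 < \<rho>" "\<rho> < 1" and t: "0 < t" "t \<le> T"
  shows "has_caputo_derivative \<rho> (conv (cutoff T (frac_kernel \<rho>)) (cutoff T (\<lambda>_. y))) y t"
proof -
  define h where "h = conv (cutoff T (frac_kernel \<rho>)) (cutoff T (\<lambda>_. y))"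
  have "cutoff T (\<lambda>_. y) = (\<lambda>s. cutoff T (frac_kernel 1) s *\<^sub>R y)"
    by (auto simp: cutoff_def frac_kernel_def fun_eq_iff)
  then have heq: "h s = frac_kernel (\<rho> + 1) s *\<^sub>R y" if "0 < s" "s \<le> T" for s
  proof -
    have "conv (cutoff T (frac_kernel \<rho>)) (\<lambda>s. cutoff T (frac_kernel 1) s *\<^sub>R y) s = conv (cutoff T (frac_kernel \<rho>)) (cutoff T (frac_kernel 1)) s *\<^sub>R y"
      by (rule conv_scaleR_const[OF integrable_cutoff_frac_kernel[OF \<rho>(1)], of _ 1])
         (auto intro!: cutoff_measurable_borel simp: cutoff_def frac_kernel_def)
    then show ?thesis
      unfolding h_def \<open>cutoff T (\<lambda>_. y) = (\<lambda>s. cutoff T (frac_kernel 1) s *\<^sub>R y)\<close>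
      using conv_frac_kernel[OF \<rho>(1) _ that, of 1] by simp
  qed
  have hc: "continuous_on A h" for A
    unfolding h_def
    by (rule continuous_on_subset[OF continuous_conv[OF integrable_cutoff_frac_kernel[OF \<rho>(1)] continuous_on_const]]) simp
  have "(h has_vector_derivative frac_kernel \<rho> s *\<^sub>R y) (at s)" if s: "0 < s" "s < t" for s
  proof -
    have "((\<lambda>s. s powr \<rho> / Gamma (\<rho> + 1)) has_real_derivative \<rho> * s powr (\<rho> - 1) / Gamma (\<rho> + 1)) (at s)"
      using s by (intro DERIV_cdivide) (auto intro!: derivative_eq_intros)
    moreover have "\<rho> * s powr (\<rho> - 1) / Gamma (\<rho> + 1) = frac_kernel \<rho> s"
    proof -
      have "Gamma (\<rho> + 1) = \<rho> * Gamma \<rho>" using \<rho> nonpos_Ints_nonpos[of \<rho>] by (intro Gamma_plus1) auto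
      then show ?thesis using \<rho> s by (simp add: frac_kernel_def)
    qed
    ultimately have "((\<lambda>s. s powr \<rho> / Gamma (\<rho> + 1)) has_real_derivative frac_kernel \<rho> s) (at s)" by simp
    from has_vector_derivative_scaleR[OF this has_vector_derivative_const[of y]]
    have "((\<lambda>s. (s powr \<rho> / Gamma (\<rho> + 1)) *\<^sub>R y) has_vector_derivative frac_kernel \<rho> s *\<^sub>R y) (at s)"
      by simp
    then show ?thesis
      by (rule has_vector_derivative_transform_within_open[of _ _ _ "{0<..<t}"])
        (use s t heq in \<open>auto simp: frac_kernel_def\<close>)
  qed
  moreover have "((\<lambda>s. (1 / (t - s) powr \<rho>) *\<^sub>R frac_kernel \<rho> s *\<^sub>R y) has_integral Gamma (1 - \<rho>) *\<^sub>R y) {0..t}"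
  proof -
    have 1: "(LINT s:{0<..<t}|lborel. frac_kernel \<rho> s * frac_kernel (1 - \<rho>) (t - s)) = 1"
    proof -
      have "conv (cutoff T (frac_kernel \<rho>)) (cutoff T (frac_kernel (1 - \<rho>))) t = 1"
        using conv_frac_kernel[of \<rho> "1 - \<rho>" t T] \<rho> t by (simp add: frac_kernel_def)
      moreover have "conv (cutoff T (frac_kernel \<rho>)) (cutoff T (frac_kernel (1 - \<rho>))) t = (LINT s:{0<..<t}|lborel. frac_kernel \<rho> s * frac_kernel (1 - \<rho>) (t - s))"
        unfolding conv_eq_integral_Ioo[OF causal_cutoff causal_cutoff] set_lebesgue_integral_def
        by (rule Bochner_Integration.integral_cong[OF refl]) (use t in \<open>auto simp: cutoff_def indicator_def\<close>)
      ultimately show ?thesis by simp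
    qed
    then have "set_integrable lborel {0<..<t} (\<lambda>s. frac_kernel \<rho> s * frac_kernel (1 - \<rho>) (t - s))"
      unfolding set_integrable_def set_lebesgue_integral_def using not_integrable_integral_eq by force
    then have "((\<lambda>s. frac_kernel \<rho> s * frac_kernel (1 - \<rho>) (t - s)) has_integral 1) {0<..<t}"
      using set_borel_integral_eq_integral[of "{0<..<t}"] 1 by (metis integrable_integral)
    from has_integral_scaleR_left[OF this, of "Gamma (1 - \<rho>) *\<^sub>R y"]
    have "((\<lambda>s. (frac_kernel \<rho> s * frac_kernel (1 - \<rho>) (t - s)) *\<^sub>R Gamma (1 - \<rho>) *\<^sub>R y) has_integral Gamma (1 - \<rho>) *\<^sub>R y) {0<..<t}" by simp
    moreover have "(frac_kernel \<rho> s * frac_kernel (1 - \<rho>) (t - s)) *\<^sub>R Gamma (1 - \<rho>) *\<^sub>R y = (1 / (t - s) powr \<rho>) *\<^sub>R frac_kernel \<rho> s *\<^sub>R y" if "s \<in> {0<..<t}" for s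
    proof -
      have "Gamma (1 - \<rho>) > 0" using \<rho> by (intro Gamma_real_pos) simp
      then have "Gamma (1 - \<rho>) \<noteq> 0" by simp
      then show ?thesis using that by (simp add: frac_kernel_def[of "1 - \<rho>"] powr_minus_divide)
    qed
    ultimately have "((\<lambda>s. (1 / (t - s) powr \<rho>) *\<^sub>R frac_kernel \<rho> s *\<^sub>R y) has_integral Gamma (1 - \<rho>) *\<^sub>R y) {0<..<t}"
      by (rule has_integral_cong[THEN iffD1, rotated]) 
    then show ?thesis by (simp add: has_integral_Icc_iff_Ioo)
  qed
  ultimately have "has_caputo_derivative \<rho> h ((1 / Gamma (1 - \<rho>)) *\<^sub>R (Gamma (1 - \<rho>) *\<^sub>R y)) t"
    by (intro has_caputo_derivative_classical[OF t(1) hc]) auto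
  moreover have "Gamma (1 - \<rho>) > 0" using \<rho> by (intro Gamma_real_pos) simp
  then have "Gamma (1 - \<rho>) \<noteq> 0" by simp
  ultimately show ?thesis by (simp add: h_def)
qed

text \<open>
  Fractional differentiation inverts fractional integration at every point of continuity.  Subtracting the
  constant \<open>\<phi> t\<close>, whose fractional integral is a power, reduces the claim to the case \<open>\<phi> t = 0\<close>.
\<close>

lemma caputo_frac_integral:
  fixes \<phi> :: "real \<Rightarrow> 'b::{real_inner, banach, second_countable_topology}"
  assumes \<rho>: "0 < \<rho>" "\<rho> < 1" and t: "0 < t" "t \<le> T" and \<phi>: "continuous_on {0..T} \<phi>"
  shows "has_caputo_derivative \<rho> (conv (cutoff T (frac_kernel \<rho>)) (cutoff T \<phi>)) (\<phi> t) t"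
proof -
  define \<psi> where "\<psi> s = \<phi> s - \<phi> t" for s
  have \<psi>: "continuous_on {0..T} \<psi>" unfolding \<psi>_def by (intro continuous_intros \<phi>)
  obtain I where I: "has_stieltjes_integral (\<lambda>s. (t - s) powr (-\<rho>)) (conv (cutoff T (frac_kernel \<rho>)) (cutoff T (\<lambda>_. \<phi> t))) I 0 t"
     "\<phi> t = (1 / Gamma (1 - \<rho>)) *\<^sub>R I"
    using caputo_frac_integral_const[OF \<rho> t, of "\<phi> t"] unfolding has_caputo_derivative_def by blast
  obtain K where K: "0 \<le> K" "\<And>s. s \<in> {0..T} \<Longrightarrow> norm (\<psi> s) \<le> K" using continuous_bounded_on_Icc[OF \<psi>] by blast
  have split: "conv (cutoff T (frac_kernel \<rho>)) (cutoff T \<psi>) s + conv (cutoff T (frac_kernel \<rho>)) (cutoff T (\<lambda>_. \<phi> t)) s = conv (cutoff T (frac_kernel \<rho>)) (cutoff T \<phi>) s" for s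
  proof -
    have "cutoff T \<phi> = (\<lambda>s. cutoff T \<psi> s + cutoff T (\<lambda>_. \<phi> t) s)" by (auto simp: cutoff_def \<psi>_def)
    moreover have "conv (cutoff T (frac_kernel \<rho>)) (\<lambda>s. cutoff T \<psi> s + cutoff T (\<lambda>_. \<phi> t) s) s = conv (cutoff T (frac_kernel \<rho>)) (cutoff T \<psi>) s + conv (cutoff T (frac_kernel \<rho>)) (cutoff T (\<lambda>_. \<phi> t)) s"
    proof (rule conv_add[OF integrable_cutoff_frac_kernel[OF \<rho>(1)]])
      show "cutoff T \<psi> \<in> borel_measurable borel" by (rule cutoff_measurable) (rule continuous_on_subset[OF \<psi>], auto)
      show "norm (cutoff T \<psi> s) \<le> K" for s using K by (rule norm_cutoff_le)
      show "cutoff T (\<lambda>_. \<phi> t) \<in> borel_measurable borel" by (rule cutoff_measurable) simp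
      show "norm (cutoff T (\<lambda>_. \<phi> t) s) \<le> norm (\<phi> t)" for s by (simp add: cutoff_def)
    qed
    ultimately show ?thesis by simp
  qed
  have "has_stieltjes_integral (\<lambda>s. (t - s) powr (-\<rho>)) (conv (cutoff T (frac_kernel \<rho>)) (cutoff T \<psi>)) 0 0 t"
    by (rule stieltjes_frac_integral_zero[OF \<rho> t \<psi>]) (simp add: \<psi>_def)
  from has_stieltjes_integral_add[OF this I(1)]
  have "has_stieltjes_integral (\<lambda>s. (t - s) powr (-\<rho>)) (conv (cutoff T (frac_kernel \<rho>)) (cutoff T \<phi>)) I 0 t"
    unfolding split by simp
  then show ?thesis using I(2) unfolding has_caputo_derivative_def by blast
qed

text \<open>
  By the semigroup law the fractional integral of order \<open>\<alpha>\<close> is one of order \<open>\<sigma>\<close>.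
\<close>

lemma caputo_frac_integral_lower:
  fixes \<phi> :: "real \<Rightarrow> 'b::{real_inner, banach, second_countable_topology}"
  assumes \<sigma>: "0 < \<sigma>" "\<sigma> < \<alpha>" and \<alpha>: "\<alpha> < 1" and t: "0 < t" "t \<le> T" and \<phi>: "continuous_on {0..T} \<phi>"
  shows "has_caputo_derivative \<sigma> (conv (cutoff T (frac_kernel \<alpha>)) (cutoff T \<phi>)) (conv (cutoff T (frac_kernel (\<alpha> - \<sigma>))) (cutoff T \<phi>) t) t"
proof -
  define \<psi> where "\<psi> = conv (cutoff T (frac_kernel (\<alpha> - \<sigma>))) (cutoff T \<phi>)"
  have i1: "integrable lborel (cutoff T (frac_kernel \<sigma>))" and i2: "integrable lborel (cutoff T (frac_kernel (\<alpha> - \<sigma>)))"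
    using \<sigma> by (auto intro: integrable_cutoff_frac_kernel)
  have \<psi>c: "continuous_on {0..T} \<psi>" unfolding \<psi>_def by (rule continuous_on_subset[OF continuous_conv[OF i2 \<phi>]]) simp
  have \<psi>0: "causal \<psi>" unfolding \<psi>_def by (simp add: causal_conv)
  obtain K where K: "0 \<le> K" "\<And>s. s \<in> {0..T} \<Longrightarrow> norm (\<phi> s) \<le> K" using continuous_bounded_on_Icc[OF \<phi>] by blast
  have pm: "cutoff T \<phi> \<in> borel_measurable borel" by (rule cutoff_measurable) (rule continuous_on_subset[OF \<phi>], auto)
  have pb: "norm (cutoff T \<phi> s) \<le> K" for s using K by (rule norm_cutoff_le)
  have eq: "conv (cutoff T (frac_kernel \<sigma>)) (cutoff T \<psi>) s = conv (cutoff T (frac_kernel \<alpha>)) (cutoff T \<phi>) s" if s: "s \<in> {0..t}" for s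
  proof -
    have "conv (cutoff T (frac_kernel \<sigma>)) (cutoff T \<psi>) s = conv (cutoff T (frac_kernel \<sigma>)) \<psi> s"
      by (rule conv_cong) (use s t \<psi>0 in \<open>auto simp: cutoff_eq\<close>)
    also have "\<dots> = conv (conv (cutoff T (frac_kernel \<sigma>)) (cutoff T (frac_kernel (\<alpha> - \<sigma>)))) (cutoff T \<phi>) s"
      unfolding \<psi>_def by (rule conv_assoc[OF i1 i2 pm pb])
    also have "\<dots> = conv (cutoff T (frac_kernel \<alpha>)) (cutoff T \<phi>) s"
    proof (rule conv_cong)
      fix x assume x: "0 < x" "x < s"
      then show "conv (cutoff T (frac_kernel \<sigma>)) (cutoff T (frac_kernel (\<alpha> - \<sigma>))) x = cutoff T (frac_kernel \<alpha>) x"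
        using conv_frac_kernel[of \<sigma> "\<alpha> - \<sigma>" x T] \<sigma> s t by (simp add: cutoff_eq)
    qed (simp_all add: causal_conv)
    finally show ?thesis .
  qed
  have "has_caputo_derivative \<sigma> (conv (cutoff T (frac_kernel \<sigma>)) (cutoff T \<psi>)) (\<psi> t) t"
    by (rule caputo_frac_integral) (use \<sigma> \<alpha> t \<psi>c in auto)
  then obtain I where I: "has_stieltjes_integral (\<lambda>s. (t - s) powr (-\<sigma>)) (conv (cutoff T (frac_kernel \<sigma>)) (cutoff T \<psi>)) I 0 t"
    "\<psi> t = (1 / Gamma (1 - \<sigma>)) *\<^sub>R I" unfolding has_caputo_derivative_def by blast
  have "has_stieltjes_integral (\<lambda>s. (t - s) powr (-\<sigma>)) (conv (cutoff T (frac_kernel \<alpha>)) (cutoff T \<phi>)) I 0 t"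
    by (rule has_stieltjes_integral_cong[OF I(1), of 0]) (simp add: eq)
  then show ?thesis
    unfolding has_caputo_derivative_def \<psi>_def[symmetric] using I(2) by blast
qed

section \<open>Diagonal operators in an orthonormal basis\<close>

definition diag :: "(nat \<Rightarrow> 'a::real_inner) \<Rightarrow> (nat \<Rightarrow> real) \<Rightarrow> 'a \<Rightarrow> 'a" where
  "diag v \<mu> z = (\<Sum>k. (\<mu> k * inner z (v k)) *\<^sub>R v k)"

locale hilbert_basis =
  fixes v :: "nat \<Rightarrow> 'a::{real_inner, banach, second_countable_topology}"
  assumes ortho: "inner (v i) (v j) = (if i = j then 1 else 0)"
    and total: "closure (span (range v)) = UNIV"
begin

lemma norm_sum_basis: "finite A \<Longrightarrow> (norm (\<Sum>k\<in>A. c k *\<^sub>R v k))\<^sup>2 = (\<Sum>k\<in>A. (c k)\<^sup>2)"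
proof -
  assume A: "finite A"
  have nv: "norm (v k) = 1" for k by (simp add: norm_eq_sqrt_inner ortho)
  have "(norm (\<Sum>k\<in>A. c k *\<^sub>R v k))\<^sup>2 = (\<Sum>k\<in>A. (norm (c k *\<^sub>R v k))\<^sup>2)"
    by (rule norm_sum_Pythagorean[OF A]) (auto simp: pairwise_def orthogonal_def ortho)
  then show ?thesis by (simp add: nv)
qed

lemma zero_if_coeffs_zero:
  assumes "\<And>k. inner z (v k) = 0"
  shows "z = 0"
proof -
  have "subspace {x. inner z x = 0}" by (simp add: subspace_def inner_add_right)
  then have "span (range v) \<subseteq> {x. inner z x = 0}" using assms by (intro span_minimal) auto
  then have "closure (span (range v)) \<subseteq> {x. inner z x = 0}"
    by (rule closure_minimal) (simp add: closed_Collect_eq continuous_on_inner)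
  then have "z \<in> {x. inner z x = 0}" unfolding total by blast
  then show ?thesis by simp
qed

lemma eq_if_coeffs_eq:
  assumes "\<And>k. inner x (v k) = inner y (v k)"
  shows "x = y"
  using zero_if_coeffs_zero[of "x - y"] assms by (simp add: inner_diff_left)

lemma summable_basis_series:
  assumes "summable (\<lambda>k. (c k)\<^sup>2)"
  shows "summable (\<lambda>k. c k *\<^sub>R v k)"
  unfolding summable_Cauchy
proof (intro allI impI)
  fix e :: real assume e: "0 < e"
  then obtain N where N: "\<And>m n. N \<le> m \<Longrightarrow> norm (sum (\<lambda>k. (c k)\<^sup>2) {m..<n}) < e\<^sup>2"
    using assms unfolding summable_Cauchy by (metis zero_less_power)
  have "norm (sum (\<lambda>k. c k *\<^sub>R v k) {m..<n}) < e" if "N \<le> m" for m n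
  proof -
    have "(norm (sum (\<lambda>k. c k *\<^sub>R v k) {m..<n}))\<^sup>2 < e\<^sup>2"
      using N[OF that, of n] by (simp add: norm_sum_basis sum_nonneg)
    then show ?thesis by (rule power2_less_imp_less) (use e in simp)
  qed
  then show "\<exists>N. \<forall>m\<ge>N. \<forall>n. norm (sum (\<lambda>k. c k *\<^sub>R v k) {m..<n}) < e" by blast
qed

lemma coeff_basis_series:
  assumes "summable (\<lambda>k. c k *\<^sub>R v k)"
  shows "inner (\<Sum>k. c k *\<^sub>R v k) (v j) = c j"
proof -
  have "(\<lambda>k. inner (c k *\<^sub>R v k) (v j)) sums inner (\<Sum>k. c k *\<^sub>R v k) (v j)"
    using bounded_linear.sums[OF bounded_linear_inner_left summable_sums[OF assms]] .
  moreover have "(\<lambda>k. inner (c k *\<^sub>R v k) (v j)) = (\<lambda>k. if k = j then c k else 0)"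
    by (auto simp: ortho)
  moreover have "(\<lambda>k. if k = j then c k else 0) sums c j" by (rule sums_single)
  ultimately show ?thesis using sums_unique2 by metis
qed

lemma bessel: "(\<Sum>k\<in>{..<n}. (inner z (v k))\<^sup>2) \<le> (norm z)\<^sup>2"
proof -
  define p where "p = (\<Sum>k\<in>{..<n}. inner z (v k) *\<^sub>R v k)"
  have "inner z p = (\<Sum>k\<in>{..<n}. (inner z (v k))\<^sup>2)"
    by (simp add: p_def inner_sum_right power2_eq_square)
  moreover have "inner p p = (\<Sum>k\<in>{..<n}. (inner z (v k))\<^sup>2)"
    using norm_sum_basis[of "{..<n}" "\<lambda>k. inner z (v k)"] by (simp add: p_def power2_norm_eq_inner)
  moreover have "0 \<le> inner (z - p) (z - p)" by simp
  ultimately show ?thesis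
    by (simp add: inner_diff_left inner_diff_right inner_commute power2_norm_eq_inner)
qed

lemma summable_coeffs_square: "summable (\<lambda>k. (inner z (v k))\<^sup>2)"
  by (rule summableI_nonneg_bounded[of _ "(norm z)\<^sup>2"], simp, rule bessel)

lemma expansion: "(\<lambda>k. inner z (v k) *\<^sub>R v k) sums z"
proof -
  have s: "summable (\<lambda>k. inner z (v k) *\<^sub>R v k)"
    by (rule summable_basis_series[OF summable_coeffs_square])
  have "(\<Sum>k. inner z (v k) *\<^sub>R v k) = z"
    by (rule eq_if_coeffs_eq) (simp add: coeff_basis_series[OF s])
  then show ?thesis using summable_sums[OF s] by simp
qed

lemma parseval: "(\<lambda>k. (inner z (v k))\<^sup>2) sums (norm z)\<^sup>2"
proof -
  have "(\<lambda>n. (norm (\<Sum>k<n. inner z (v k) *\<^sub>R v k))\<^sup>2) \<longlonglongrightarrow> (norm z)\<^sup>2"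
    using expansion[of z] unfolding sums_def by (intro tendsto_intros)
  then show ?thesis unfolding sums_def by (simp add: norm_sum_basis)
qed

lemma norm_le_if_coeffs_le:
  assumes C: "0 \<le> C" and le: "\<And>k. \<bar>inner x (v k)\<bar> \<le> C * \<bar>inner z (v k)\<bar>"
  shows "norm x \<le> C * norm z"
proof -
  have "(inner x (v k))\<^sup>2 \<le> C\<^sup>2 * (inner z (v k))\<^sup>2" for k
    using power_mono[OF le[of k], of 2] by (simp add: power_mult_distrib)
  then have "(norm x)\<^sup>2 \<le> C\<^sup>2 * (norm z)\<^sup>2"
    using sums_le[OF _ parseval sums_mult[OF parseval]] by blast
  then have "(norm x)\<^sup>2 \<le> (C * norm z)\<^sup>2" by (simp add: power_mult_distrib)
  then show ?thesis by (rule power2_le_imp_le) (use C in simp)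
qed

lemma summable_diag:
  assumes "\<And>k. \<bar>\<mu> k\<bar> \<le> C"
  shows "summable (\<lambda>k. (\<mu> k * inner z (v k)) *\<^sub>R v k)"
proof (rule summable_basis_series, rule summable_comparison_test)
  have "(\<mu> k * inner z (v k))\<^sup>2 \<le> C\<^sup>2 * (inner z (v k))\<^sup>2" for k
    using power_mono[OF assms[of k], of 2] by (simp add: power_mult_distrib mult_right_mono)
  then show "\<exists>N. \<forall>n\<ge>N. norm ((\<mu> n * inner z (v n))\<^sup>2) \<le> C\<^sup>2 * (inner z (v n))\<^sup>2" by auto
  show "summable (\<lambda>n. C\<^sup>2 * (inner z (v n))\<^sup>2)" by (intro summable_mult summable_coeffs_square)
qed

lemma coeff_diag:
  assumes "\<And>k. \<bar>\<mu> k\<bar> \<le> C"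
  shows "inner (diag v \<mu> z) (v j) = \<mu> j * inner z (v j)"
  unfolding diag_def by (rule coeff_basis_series[OF summable_diag[OF assms]])

lemma norm_diag_le:
  assumes "\<And>k. \<bar>\<mu> k\<bar> \<le> C"
  shows "norm (diag v \<mu> z) \<le> C * norm z"
proof (rule norm_le_if_coeffs_le)
  show "0 \<le> C" using assms[of 0] by linarith
  show "\<bar>inner (diag v \<mu> z) (v k)\<bar> \<le> C * \<bar>inner z (v k)\<bar>" for k
    using assms[of k] by (simp add: coeff_diag[OF assms] abs_mult mult_right_mono)
qed

lemma diag_diff:
  assumes "\<And>k. \<bar>\<mu> k\<bar> \<le> C"
  shows "diag v \<mu> (x - y) = diag v \<mu> x - diag v \<mu> y"
  by (rule eq_if_coeffs_eq) (simp add: coeff_diag[OF assms] inner_diff_left right_diff_distrib)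

lemma diag_diff_multiplier:
  assumes "\<And>k. \<bar>\<mu> k\<bar> \<le> C" "\<And>k. \<bar>\<nu> k\<bar> \<le> E"
  shows "diag v (\<lambda>k. \<mu> k - \<nu> k) z = diag v \<mu> z - diag v \<nu> z"
proof (rule eq_if_coeffs_eq)
  have "\<bar>\<mu> k - \<nu> k\<bar> \<le> C + E" for k using assms(1)[of k] assms(2)[of k] by linarith
  from coeff_diag[of "\<lambda>k. \<mu> k - \<nu> k", OF this]
  show "inner (diag v (\<lambda>k. \<mu> k - \<nu> k) z) (v k) = inner (diag v \<mu> z - diag v \<nu> z) (v k)" for k
    by (simp only: coeff_diag[OF assms(1)] coeff_diag[OF assms(2)] inner_diff_left left_diff_distrib)
qed

lemma diag_zero: "diag v (\<lambda>_. 0) z = 0" "diag v \<mu> 0 = 0"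
  by (simp_all add: diag_def)

text \<open>
  Dominated convergence for multipliers: up to a small tail of \<open>z\<close> only finitely many modes matter.
\<close>

lemma tendsto_diag:
  assumes bd: "eventually (\<lambda>x. \<forall>k. \<bar>\<mu> x k\<bar> \<le> C) F" and lim: "\<And>k. ((\<lambda>x. \<mu> x k) \<longlongrightarrow> \<nu> k) F"
    and nbd: "\<And>k. \<bar>\<nu> k\<bar> \<le> C"
  shows "((\<lambda>x. diag v (\<mu> x) z) \<longlongrightarrow> diag v \<nu> z) F"
proof (rule tendstoI)
  fix e :: real assume e: "0 < e"
  have C0: "0 \<le> C" using nbd[of 0] by linarith
  define d where "d = e / (2 * (2 * C + 1))"
  have d: "0 < d" using e C0 by (simp add: d_def)
  obtain n where n: "norm ((\<Sum>k<n. inner z (v k) *\<^sub>R v k) - z) < d"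
    using LIMSEQ_D[OF expansion[of z, unfolded sums_def] d] by blast
  define p where "p = (\<Sum>k<n. inner z (v k) *\<^sub>R v k)"
  have cp: "inner p (v j) = (if j < n then inner z (v j) else 0)" for j
    by (simp add: p_def inner_sum_left ortho if_distrib cong: if_cong)
  have "((\<lambda>x. norm (\<Sum>k<n. ((\<mu> x k - \<nu> k) * inner z (v k)) *\<^sub>R v k)) \<longlongrightarrow> norm (\<Sum>k<n. ((\<nu> k - \<nu> k) * inner z (v k)) *\<^sub>R v k)) F"
    by (intro tendsto_intros lim)
  then have "eventually (\<lambda>x. norm (\<Sum>k<n. ((\<mu> x k - \<nu> k) * inner z (v k)) *\<^sub>R v k) < e / 2) F"
    using e by (intro order_tendstoD(2)) auto
  with bd show "eventually (\<lambda>x. dist (diag v (\<mu> x) z) (diag v \<nu> z) < e) F"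
  proof eventually_elim
    case (elim x)
    then have b: "\<bar>\<mu> x k\<bar> \<le> C" for k by blast
    have b2: "\<bar>\<mu> x k - \<nu> k\<bar> \<le> 2 * C" for k using b[of k] nbd[of k] by linarith
    define D where "D = (\<lambda>y. diag v (\<lambda>k. \<mu> x k - \<nu> k) y)"
    have "diag v (\<mu> x) z - diag v \<nu> z = D z" unfolding D_def by (rule diag_diff_multiplier[OF b nbd, symmetric])
    also have "D z = D p + D (z - p)" unfolding D_def by (simp add: diag_diff[OF b2])
    also have "D p = (\<Sum>k<n. ((\<mu> x k - \<nu> k) * inner z (v k)) *\<^sub>R v k)"
      unfolding D_def by (rule eq_if_coeffs_eq) (simp add: coeff_diag[OF b2] cp inner_sum_left ortho if_distrib cong: if_cong)
    finally have "norm (diag v (\<mu> x) z - diag v \<nu> z) \<le> norm (\<Sum>k<n. ((\<mu> x k - \<nu> k) * inner z (v k)) *\<^sub>R v k) + norm (D (z - p))"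
      using norm_triangle_ineq by metis
    moreover have "norm (D (z - p)) \<le> 2 * C * d"
    proof -
      have "norm (D (z - p)) \<le> 2 * C * norm (z - p)" unfolding D_def by (rule norm_diag_le[OF b2])
      also have "\<dots> \<le> 2 * C * d" using n C0 by (intro mult_left_mono) (auto simp: p_def norm_minus_commute)
      finally show ?thesis .
    qed
    moreover have "2 * C * d \<le> e / 2" using e C0 by (simp add: d_def field_simps)
    ultimately show ?case using elim by (simp add: dist_norm)
  qed
qed

lemma diag_measurable:
  fixes x :: "real \<Rightarrow> 'a"
  assumes [measurable]: "x \<in> borel_measurable borel" "\<And>k. (\<lambda>\<sigma>. \<mu> \<sigma> k) \<in> borel_measurable borel"
    and bd: "\<And>\<sigma> k. \<bar>\<mu> \<sigma> k\<bar> \<le> C \<sigma>"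
  shows "(\<lambda>\<sigma>. diag v (\<mu> \<sigma>) (x \<sigma>)) \<in> borel_measurable borel"
proof (rule borel_measurable_LIMSEQ_metric)
  have "(\<lambda>\<sigma>. (\<mu> \<sigma> k * inner (x \<sigma>) (v k)) *\<^sub>R v k) \<in> borel_measurable borel" for k
    by (rule borel_measurable_scaleR[OF borel_measurable_times[OF assms(2) borel_measurable_inner[OF assms(1) borel_measurable_const]] borel_measurable_const])
  then show "(\<lambda>\<sigma>. \<Sum>k<n. (\<mu> \<sigma> k * inner (x \<sigma>) (v k)) *\<^sub>R v k) \<in> borel_measurable borel" for n
    by (rule borel_measurable_sum)
  show "(\<lambda>n. \<Sum>k<n. (\<mu> \<sigma> k * inner (x \<sigma>) (v k)) *\<^sub>R v k) \<longlonglongrightarrow> diag v (\<mu> \<sigma>) (x \<sigma>)" for \<sigma>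
    unfolding diag_def by (rule summable_LIMSEQ[OF summable_diag[OF bd]])
qed

end

lemma (in hilbert_basis) bounded_linear_diag:
  assumes "\<And>n. \<bar>\<mu> n\<bar> \<le> C"
  shows "bounded_linear (diag v \<mu>)"
proof (rule bounded_linear_intro)
  show "diag v \<mu> (x + y) = diag v \<mu> x + diag v \<mu> y" for x y
    by (rule eq_if_coeffs_eq) (simp add: coeff_diag[OF assms] inner_add_left distrib_left)
  show "diag v \<mu> (r *\<^sub>R x) = r *\<^sub>R diag v \<mu> x" for r x
    by (rule eq_if_coeffs_eq) (simp add: coeff_diag[OF assms])
  show "norm (diag v \<mu> x) \<le> norm x * C" for x
    using norm_diag_le[OF assms] by (simp add: mult.commute)
qed

lemma (in hilbert_basis) coeff_frac_power:
  assumes "y \<in> frac_domain v lam \<epsilon>"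
  shows "inner (frac_power v lam \<epsilon> y) (v n) = lam n powr \<epsilon> * inner y (v n)"
    and "summable (\<lambda>n. (lam n powr \<epsilon> * inner y (v n)) *\<^sub>R v n)"
proof -
  have "(lam n powr \<epsilon> * inner y (v n))\<^sup>2 = lam n powr (2 * \<epsilon>) * \<bar>inner y (v n)\<bar>\<^sup>2" for n
  proof -
    have "(lam n powr \<epsilon>)\<^sup>2 = lam n powr (2 * \<epsilon>)" by (simp only: power2_eq_square powr_add[symmetric] mult_2)
    then show ?thesis by (simp add: power_mult_distrib)
  qed
  then have "summable (\<lambda>n. (lam n powr \<epsilon> * inner y (v n))\<^sup>2)"
    using assms by (simp add: frac_domain_def)
  then show 1: "summable (\<lambda>n. (lam n powr \<epsilon> * inner y (v n)) *\<^sub>R v n)" by (rule summable_basis_series)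
  show "inner (frac_power v lam \<epsilon> y) (v n) = lam n powr \<epsilon> * inner y (v n)"
    unfolding frac_power_def by (rule coeff_basis_series[OF 1])
qed

lemma (in hilbert_basis) continuous_on_frac_power:
  assumes "frac_continuous_on v lam \<epsilon> S f"
  shows "continuous_on S (\<lambda>t. frac_power v lam \<epsilon> (f t))"
  unfolding continuous_on_def
proof
  fix t assume t: "t \<in> S"
  have dom: "f s \<in> frac_domain v lam \<epsilon>" if "s \<in> S" for s
    using assms that by (simp add: frac_continuous_on_def)
  have "((\<lambda>s. frac_norm v lam \<epsilon> (f s - f t)) \<longlongrightarrow> 0) (at t within S)"
    using assms t by (simp add: frac_continuous_on_def)
  moreover have "eventually (\<lambda>s. norm (frac_power v lam \<epsilon> (f s) - frac_power v lam \<epsilon> (f t)) \<le> frac_norm v lam \<epsilon> (f s - f t)) (at t within S)"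
  proof -
    have "eventually (\<lambda>s. s \<in> S) (at t within S)" by (simp add: eventually_at_filter)
    then show ?thesis
    proof eventually_elim
      case (elim s)
      have "frac_power v lam \<epsilon> (f s) - frac_power v lam \<epsilon> (f t) = frac_power v lam \<epsilon> (f s - f t)"
        unfolding frac_power_def suminf_diff[OF coeff_frac_power(2)[OF dom[OF elim]] coeff_frac_power(2)[OF dom[OF t]]]
        by (simp add: inner_diff_left algebra_simps)
      then show ?case by (simp add: frac_norm_def)
    qed
  qed
  ultimately have "((\<lambda>s. frac_power v lam \<epsilon> (f s) - frac_power v lam \<epsilon> (f t)) \<longlongrightarrow> 0) (at t within S)"
    by (rule Lim_null_comparison[rotated])
  then show "((\<lambda>t. frac_power v lam \<epsilon> (f t)) \<longlongrightarrow> frac_power v lam \<epsilon> (f t)) (at t within S)"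
    by (simp add: LIM_zero_iff)
qed

lemma set_borel_primitive_eq:
  fixes f :: "real \<Rightarrow> real"
  assumes f: "set_integrable lborel {0<..<t} f" and v: "v \<le> t"
  shows "(LINT s:{0<..<v}|lborel. f s) = integral {0..v} f"
proof -
  have "set_integrable lborel {0<..<v} f" by (rule set_integrable_subset[OF f]) (use v in auto)
  from set_borel_integral_eq_integral(2)[OF this] show ?thesis by (simp add: integral_open_interval_real)
qed

lemma continuous_primitive:
  fixes f :: "real \<Rightarrow> real"
  assumes f: "set_integrable lborel {0<..<t} f"
  shows "continuous_on {0..t} (\<lambda>v. LINT s:{0<..<v}|lborel. f s)"
proof -
  have "f integrable_on {0..t}"
    using set_borel_integral_eq_integral(1)[OF f] by (simp add: integrable_on_Icc_iff_Ioo)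
  then have "continuous_on {0..t} (\<lambda>v. integral {0..v} f)" by (rule indefinite_integral_continuous_1)
  then show ?thesis
    by (rule continuous_on_eq) (simp add: set_borel_primitive_eq[OF f])
qed

lemma primitive_increment:
  fixes f :: "real \<Rightarrow> real"
  assumes f: "set_integrable lborel {0<..<t} f" and u: "0 < u" "u \<le> v" "v \<le> t"
  shows "set_integrable lborel {u..<v} f"
    and "(LINT s:{0<..<v}|lborel. f s) - (LINT s:{0<..<u}|lborel. f s) = (LINT s:{u..<v}|lborel. f s)"
proof -
  have i1: "set_integrable lborel {0<..<u} f" by (rule set_integrable_subset[OF f]) (use u in auto)
  show i2: "set_integrable lborel {u..<v} f" by (rule set_integrable_subset[OF f]) (use u in auto)
  have "{0<..<u} \<inter> {u..<v} = {}" "{0<..<u} \<union> {u..<v} = {0<..<v}" using u by auto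
  from set_integral_Un[OF this(1) i1 i2] this(2)
  show "(LINT s:{0<..<v}|lborel. f s) - (LINT s:{0<..<u}|lborel. f s) = (LINT s:{u..<v}|lborel. f s)" by simp
qed

context hilbert_basis
begin

lemma continuous_on_diag:
  assumes bd: "\<And>x n. x \<in> S \<Longrightarrow> \<bar>\<mu> n x\<bar> \<le> C" and c: "\<And>n. continuous_on S (\<mu> n)"
  shows "continuous_on S (\<lambda>x. diag v (\<lambda>n. \<mu> n x) z)"
  unfolding continuous_on_def
proof
  fix x assume x: "x \<in> S"
  have "eventually (\<lambda>y. y \<in> S) (at x within S)" by (simp add: eventually_at_filter)
  then have "eventually (\<lambda>y. \<forall>n. \<bar>\<mu> n y\<bar> \<le> C) (at x within S)"
    by eventually_elim (use bd in auto)
  then show "((\<lambda>x. diag v (\<lambda>n. \<mu> n x) z) \<longlongrightarrow> diag v (\<lambda>n. \<mu> n x) z) (at x within S)"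
    by (rule tendsto_diag) (use c x bd in \<open>auto simp: continuous_on_def\<close>)
qed

text \<open>
  In each mode the function is an indefinite integral of \<open>- R n\<close>.  The bound \<open>R n s \<le> 1 / s\<close> makes it
  Lipschitz away from \<open>0\<close> uniformly in \<open>n\<close>, which is what the criterion for Stieltjes integrals asks for in the
  interior; at the end points continuity follows by dominated convergence over the modes, although the
  densities need not be summable near \<open>0\<close>.
\<close>

lemma caputo_diag_relaxation:
  fixes R :: "nat \<Rightarrow> real \<Rightarrow> real" and y :: 'a
  assumes \<rho>: "0 < \<rho>" "\<rho> < 1" and t: "0 < t"
    and R0: "\<And>n s. 0 < s \<Longrightarrow> 0 \<le> R n s" and Rd: "\<And>n s. 0 < s \<Longrightarrow> R n s \<le> 1 / s"
    and Ri: "\<And>n. set_integrable lborel {0<..<t} (R n)"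
    and R1: "\<And>n b. b \<le> t \<Longrightarrow> (LINT s:{0<..<b}|lborel. R n s) \<le> 1"
    and wi: "\<And>n. set_integrable lborel {0<..<t} (\<lambda>s. frac_kernel (1 - \<rho>) (t - s) * R n s)"
    and wC: "\<And>n. (LINT s:{0<..<t}|lborel. frac_kernel (1 - \<rho>) (t - s) * R n s) \<le> C"
  shows "continuous_on {0..t} (\<lambda>\<tau>. diag v (\<lambda>n. 1 - (LINT s:{0<..<\<tau>}|lborel. R n s)) y)"
    and "has_caputo_derivative \<rho> (\<lambda>\<tau>. diag v (\<lambda>n. 1 - (LINT s:{0<..<\<tau>}|lborel. R n s)) y)
       (diag v (\<lambda>n. - (LINT s:{0<..<t}|lborel. frac_kernel (1 - \<rho>) (t - s) * R n s)) y) t"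
proof -
  define G where "G = Gamma (1 - \<rho>)"
  have G: "0 < G" unfolding G_def using \<rho> by (intro Gamma_real_pos) simp
  define g where "g s = (t - s) powr (-\<rho>)" for s
  have gR: "set_integrable lborel {0<..<t} (\<lambda>s. g s * R n s)" and
    gRv: "(LINT s:{0<..<t}|lborel. g s * R n s) = G * (LINT s:{0<..<t}|lborel. frac_kernel (1 - \<rho>) (t - s) * R n s)" for n
  proof -
    have eq: "indicat_real {0<..<t} s *\<^sub>R (g s * R n s) = G * (indicat_real {0<..<t} s *\<^sub>R (frac_kernel (1 - \<rho>) (t - s) * R n s))" for s
      using G by (auto simp: indicator_def g_def frac_kernel_def G_def)
    show "set_integrable lborel {0<..<t} (\<lambda>s. g s * R n s)"
      using wi[of n] unfolding set_integrable_def eq by simp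
    show "(LINT s:{0<..<t}|lborel. g s * R n s) = G * (LINT s:{0<..<t}|lborel. frac_kernel (1 - \<rho>) (t - s) * R n s)"
      unfolding set_lebesgue_integral_def eq by simp
  qed
  define S where "S n x = 1 - (LINT s:{0<..<x}|lborel. R n s)" for n x
  define Q where "Q n x = - (LINT s:{0<..<x}|lborel. g s * R n s)" for n x
  have nnint: "0 \<le> (LINT s:{0<..<x}|lborel. f s)" if "\<And>s. 0 < s \<Longrightarrow> 0 \<le> f s" for f :: "real \<Rightarrow> real" and x
    unfolding set_lebesgue_integral_def using that by (intro Bochner_Integration.integral_nonneg) (auto simp: indicator_def)
  have S1: "\<bar>S n x\<bar> \<le> 1" if "x \<in> {0..t}" for n x
    using R1[of x n] nnint[of "R n" x] R0 that by (auto simp: S_def)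
  have gR0: "0 \<le> g s * R n s" if "0 < s" for n s using R0[OF that] by (simp add: g_def)
  have Q1: "\<bar>Q n x\<bar> \<le> G * C" if "x \<in> {0..t}" for n x
  proof -
    have "(LINT s:{0<..<x}|lborel. g s * R n s) \<le> (LINT s:{0<..<t}|lborel. g s * R n s)"
      using gR[of n] gR0 that unfolding set_lebesgue_integral_def
      by (intro integral_mono set_integrable_subset[OF gR[of n], unfolded set_integrable_def]) 
         (auto simp: indicator_def set_integrable_def)
    also have "\<dots> \<le> G * C" unfolding gRv using wC G by (simp add: mult_left_mono)
    finally show ?thesis using nnint[of "\<lambda>s. g s * R n s" x] gR0 by (simp add: Q_def)
  qed
  have Sc: "continuous_on {0..t} (S n)" for n
    unfolding S_def by (intro continuous_intros continuous_primitive Ri)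
  have Qc: "continuous_on {0..t} (Q n)" for n
    unfolding Q_def by (intro continuous_intros continuous_primitive gR)
  define h where "h x = diag v (\<lambda>n. S n x) y" for x
  define Fn where "Fn x = diag v (\<lambda>n. Q n x) y" for x
  have hc: "continuous_on {0..t} h" unfolding h_def by (rule continuous_on_diag[OF S1 Sc])
  then show "continuous_on {0..t} (\<lambda>\<tau>. diag v (\<lambda>n. 1 - (LINT s:{0<..<\<tau>}|lborel. R n s)) y)"
    by (simp add: h_def[abs_def] S_def)
  have Fc: "continuous_on {0..t} Fn" unfolding Fn_def by (rule continuous_on_diag[OF Q1 Qc])
  have "has_stieltjes_integral g h (Fn t - Fn 0) 0 t"
  proof (rule has_stieltjes_integral_of_indefinite[OF t hc])
    show "(Fn \<longlongrightarrow> Fn 0) (at 0 within {0..t})" "(Fn \<longlongrightarrow> Fn t) (at t within {0..t})"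
      using Fc t by (auto simp: continuous_on_def)
    fix x \<eta> :: real assume x: "0 < x" "x < t" and \<eta>: "0 < \<eta>"
    define \<omega> where "\<omega> = \<eta> * x / (2 * (norm y + 1))"
    have ny: "0 < norm y + 1" by (simp add: add_nonneg_pos)
    have \<omega>: "0 < \<omega>" unfolding \<omega>_def using x \<eta> ny by (intro divide_pos_pos mult_pos_pos) auto
    have "isCont g x" unfolding g_def using x by (intro continuous_intros) auto
    then obtain d where d: "0 < d" "\<And>s. dist s x < d \<Longrightarrow> dist (g s) (g x) < \<omega>"
      using \<omega> unfolding continuous_at_eps_delta by blast
    define \<delta> where "\<delta> = min d (x / 2)"
    have "norm (g x *\<^sub>R (h w - h u) - (Fn w - Fn u)) \<le> \<eta> * (w - u)"
      if uw: "u \<le> x" "x \<le> w" "0 \<le> u" "w \<le> t" "{u..w} \<subseteq> ball x \<delta>" for u w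
    proof -
      have u2: "x / 2 < u" using subsetD[OF uw(5), of u] uw x by (simp add: \<delta>_def dist_real_def)
      then have u0: "0 < u" "u \<le> w" using x uw by auto
      have uT: "u \<in> {0..t}" "w \<in> {0..t}" using uw u0 by auto
      define \<nu> where "\<nu> n = g x * (S n w - S n u) - (Q n w - Q n u)" for n
      have nu: "\<bar>\<nu> n\<bar> \<le> \<omega> * (2 / x) * (w - u)" for n
      proof -
        note iR = primitive_increment[OF Ri[of n] u0 uw(4)]
        note igR = primitive_increment[OF gR[of n] u0 uw(4)]
        have i3: "set_integrable lborel {u..<w} (\<lambda>s. g s * R n s - g x * R n s)"
          using iR(1) igR(1) by (intro set_integral_diff(1)) auto
        have "(LINT s:{u..<w}|lborel. g s * R n s - g x * R n s) = (LINT s:{u..<w}|lborel. g s * R n s) - g x * (LINT s:{u..<w}|lborel. R n s)"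
          using iR(1) igR(1) by (subst set_integral_diff(2)) auto
        then have "\<nu> n = (LINT s:{u..<w}|lborel. g s * R n s - g x * R n s)"
          unfolding iR(2)[symmetric] igR(2)[symmetric] by (simp add: \<nu>_def S_def Q_def algebra_simps)
        also have "\<bar>\<dots>\<bar> \<le> (LINT s:{u..<w}|lborel. norm (g s * R n s - g x * R n s))"
          using set_integral_norm_bound[OF i3] by simp
        also have "\<dots> \<le> (LINT s:{u..<w}|lborel. \<omega> * (2 / x))"
        proof (rule set_integral_mono)
          show "set_integrable lborel {u..<w} (\<lambda>s. norm (g s * R n s - g x * R n s))" by (rule set_integrable_norm[OF i3])
          show "set_integrable lborel {u..<w} (\<lambda>s. \<omega> * (2 / x))"
            by (rule set_integrable_subset[OF borel_integrable_atLeastAtMost'[of u w]]) auto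
          fix s assume s: "s \<in> {u..<w}"
          have "dist s x < d" using subsetD[OF uw(5), of s] s by (simp add: \<delta>_def dist_commute)
          then have 1: "\<bar>g s - g x\<bar> \<le> \<omega>" using d(2)[of s] by (simp add: dist_real_def)
          have "R n s \<le> 1 / s" using Rd[of s n] s u0 by auto
          also have "\<dots> \<le> 2 / x" using s u2 x by (simp add: field_simps)
          finally have "\<bar>g s - g x\<bar> * R n s \<le> \<omega> * (2 / x)"
            using 1 R0[of s n] s u0 \<omega> by (intro mult_mono) auto
          moreover have "norm (g s * R n s - g x * R n s) = \<bar>g s - g x\<bar> * R n s"
            using R0[of s n] s u0 by (simp add: left_diff_distrib[symmetric] abs_mult)
          ultimately show "norm (g s * R n s - g x * R n s) \<le> \<omega> * (2 / x)" by simp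
        qed
        also have "\<dots> = \<omega> * (2 / x) * (w - u)"
          unfolding set_lebesgue_integral_def using u0 by simp
        finally show ?thesis .
      qed
      have cf: "inner (g x *\<^sub>R (h w - h u) - (Fn w - Fn u)) (v n) = \<nu> n * inner y (v n)" for n
      proof -
        have "inner (h w) (v n) = S n w * inner y (v n)" "inner (h u) (v n) = S n u * inner y (v n)"
          unfolding h_def by (rule coeff_diag[OF S1[OF uT(2)]], rule coeff_diag[OF S1[OF uT(1)]])
        moreover have "inner (Fn w) (v n) = Q n w * inner y (v n)" "inner (Fn u) (v n) = Q n u * inner y (v n)"
          unfolding Fn_def by (rule coeff_diag[OF Q1[OF uT(2)]], rule coeff_diag[OF Q1[OF uT(1)]])
        ultimately show ?thesis by (simp add: \<nu>_def inner_diff_left algebra_simps)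
      qed
      have "norm (g x *\<^sub>R (h w - h u) - (Fn w - Fn u)) \<le> (\<omega> * (2 / x) * (w - u)) * norm y"
      proof (rule norm_le_if_coeffs_le)
        show "0 \<le> \<omega> * (2 / x) * (w - u)" using \<omega> x u0 by simp
        show "\<bar>inner (g x *\<^sub>R (h w - h u) - (Fn w - Fn u)) (v n)\<bar> \<le> \<omega> * (2 / x) * (w - u) * \<bar>inner y (v n)\<bar>" for n
          unfolding cf abs_mult by (rule mult_right_mono[OF nu]) simp
      qed
      also have "\<dots> \<le> (\<omega> * (2 / x) * (w - u)) * (norm y + 1)"
        using \<omega> x u0 by (intro mult_left_mono) auto
      also have "\<dots> = \<eta> * (w - u)" using x ny by (simp add: \<omega>_def field_simps)
      finally show ?thesis .
    qed
    moreover have "0 < \<delta>" using d x by (simp add: \<delta>_def)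
    ultimately show "\<exists>\<delta>>0. \<forall>u w. u \<le> x \<and> x \<le> w \<and> 0 \<le> u \<and> w \<le> t \<and> {u..w} \<subseteq> ball x \<delta> \<longrightarrow>
      norm (g x *\<^sub>R (h w - h u) - (Fn w - Fn u)) \<le> \<eta> * (w - u)" by (intro exI[of _ \<delta>]) simp
  qed
  moreover have "Fn 0 = 0"
    by (simp add: Fn_def Q_def set_lebesgue_integral_def diag_zero)
  moreover have "diag v (\<lambda>n. - (LINT s:{0<..<t}|lborel. frac_kernel (1 - \<rho>) (t - s) * R n s)) y = (1 / G) *\<^sub>R Fn t"
  proof (rule eq_if_coeffs_eq)
    fix n
    have tt: "t \<in> {0..t}" using t by simp
    have Qt: "- (LINT s:{0<..<t}|lborel. frac_kernel (1 - \<rho>) (t - s) * R n s) = Q n t / G" for n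
      using G by (simp add: Q_def gRv)
    have "\<bar>Q n t / G\<bar> \<le> C" for n using Q1[OF tt, of n] G by (simp add: abs_divide divide_le_eq mult.commute)
    then have "inner (diag v (\<lambda>n. Q n t / G) y) (v n) = Q n t / G * inner y (v n)" by (rule coeff_diag)
    moreover have "inner (Fn t) (v n) = Q n t * inner y (v n)"
      unfolding Fn_def by (rule coeff_diag[OF Q1[OF tt]])
    ultimately show "inner (diag v (\<lambda>n. - (LINT s:{0<..<t}|lborel. frac_kernel (1 - \<rho>) (t - s) * R n s)) y) (v n) = inner ((1 / G) *\<^sub>R Fn t) (v n)"
      unfolding Qt by simp
  qed
  ultimately show "has_caputo_derivative \<rho> (\<lambda>\<tau>. diag v (\<lambda>n. 1 - (LINT s:{0<..<\<tau>}|lborel. R n s)) y)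
       (diag v (\<lambda>n. - (LINT s:{0<..<t}|lborel. frac_kernel (1 - \<rho>) (t - s) * R n s)) y) t"
    unfolding has_caputo_derivative_def G_def g_def[abs_def] h_def[abs_def] S_def by auto
qed

end

section \<open>The multi-term kernel and its resolvents\<close>

text \<open>
  Sums of log-convex functions are log-convex, by the Cauchy-Schwarz inequality.
\<close>

lemma log_convex_sum:
  fixes a b c :: "'i \<Rightarrow> real"
  assumes "finite I" and "\<And>i. i \<in> I \<Longrightarrow> 0 \<le> a i" "\<And>i. i \<in> I \<Longrightarrow> 0 \<le> b i" "\<And>i. i \<in> I \<Longrightarrow> 0 \<le> c i"
    and "\<And>i. i \<in> I \<Longrightarrow> (a i)\<^sup>2 \<le> b i * c i"
  shows "(\<Sum>i\<in>I. a i)\<^sup>2 \<le> (\<Sum>i\<in>I. b i) * (\<Sum>i\<in>I. c i)"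
proof -
  have "a i \<le> sqrt (b i) * sqrt (c i)" if "i \<in> I" for i
    using assms(5)[OF that] by (simp add: real_le_rsqrt flip: real_sqrt_mult)
  then have "(\<Sum>i\<in>I. a i) \<le> (\<Sum>i\<in>I. sqrt (b i) * sqrt (c i))" by (rule sum_mono)
  then have "(\<Sum>i\<in>I. a i)\<^sup>2 \<le> (\<Sum>i\<in>I. sqrt (b i) * sqrt (c i))\<^sup>2"
    using assms(2) by (intro power_mono sum_nonneg) auto
  also have "\<dots> \<le> (\<Sum>i\<in>I. (sqrt (b i))\<^sup>2) * (\<Sum>i\<in>I. (sqrt (c i))\<^sup>2)"
    by (rule Cauchy_Schwarz_ineq_sum)
  also have "\<dots> = (\<Sum>i\<in>I. b i) * (\<Sum>i\<in>I. c i)"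
    using assms(3,4) by (simp cong: sum.cong)
  finally show ?thesis .
qed

text \<open>
  The left-hand side of the equation is the convolution of this kernel with the differential of \<open>u\<close>.
\<close>

definition multi_kernel :: "nat \<Rightarrow> (nat \<Rightarrow> real) \<Rightarrow> (nat \<Rightarrow> real) \<Rightarrow> real \<Rightarrow> real" where
  "multi_kernel M \<rho> q t = (\<Sum>j=1..M. q j * frac_kernel (1 - \<rho> j) t)"

locale multi_term =
  fixes M :: nat and \<rho> q :: "nat \<Rightarrow> real"
  assumes M1: "1 \<le> M" and rho: "\<And>j. j \<in> {1..M} \<Longrightarrow> 0 < \<rho> j \<and> \<rho> j < 1"
    and rho_dec: "\<And>j. j \<in> {2..M} \<Longrightarrow> \<rho> j < \<rho> 1"
    and q_pos: "\<And>j. j \<in> {1..M} \<Longrightarrow> 0 < q j" and q1: "q 1 = 1"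
begin

abbreviation "k \<equiv> multi_kernel M \<rho> q"

lemma rho1: "0 < \<rho> 1" "\<rho> 1 < 1" using rho[of 1] M1 by auto

lemma k_nonneg: "0 \<le> k s"
  unfolding multi_kernel_def using rho q_pos by (intro sum_nonneg mult_nonneg_nonneg frac_kernel_nonneg) (auto simp: less_imp_le)

lemma k_ge: "frac_kernel (1 - \<rho> 1) s \<le> k s"
proof -
  have "q 1 * frac_kernel (1 - \<rho> 1) s \<le> k s"
    unfolding multi_kernel_def
    by (rule member_le_sum) (use M1 rho q_pos in \<open>auto intro!: mult_nonneg_nonneg frac_kernel_nonneg simp: less_imp_le\<close>)
  then show ?thesis unfolding q1 by simp
qed

lemma k_pos: "0 < s \<Longrightarrow> 0 < k s"
  using k_ge[of s] frac_kernel_pos[of "1 - \<rho> 1" s] rho1 by linarith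

lemma k_antimono: "0 < s \<Longrightarrow> s \<le> u \<Longrightarrow> k u \<le> k s"
  unfolding multi_kernel_def using rho q_pos
  by (intro sum_mono mult_left_mono frac_kernel_antimono) (auto simp: less_imp_le)

lemma k_measurable [measurable]: "k \<in> borel_measurable borel"
  unfolding multi_kernel_def[abs_def] by measurable

lemma k_set_integrable: "set_integrable lborel {0<..<b} k"
proof -
  have "set_integrable lborel {0<..<b} (\<lambda>s. q j * frac_kernel (1 - \<rho> j) s)" if "j \<in> {1..M}" for j
    by (intro set_integrable_mult_right set_integrable_frac_kernel) (use rho[OF that] in auto)
  then show ?thesis
    unfolding multi_kernel_def[abs_def] set_integrable_def scaleR_sum_right
    by (intro Bochner_Integration.integrable_sum) auto
qed

lemma k_cutoff_integrable: "integrable lborel (cutoff T k)"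
  using k_set_integrable[of T] by (simp add: integrable_cutoff_iff_Ioo)

lemma partner_exists:
  assumes lam: "0 \<le> \<mu>"
  shows "\<exists>r. r \<in> borel_measurable borel \<and> (\<forall>s>0. 0 \<le> r s) \<and> (\<forall>s>0. \<forall>u\<ge>s. r u \<le> r s) \<and>
    (\<forall>s>0. r s \<le> s powr (\<rho> 1 - 1) * Gamma (1 - \<rho> 1)) \<and>
    (\<forall>t>0. (LINT s:{0<..<t}|lborel. (\<mu> + k (t - s)) * r s) = 1)"
proof -
  have Gp: "0 < Gamma (1 - \<rho> 1)" using rho1 by (intro Gamma_real_pos) simp
  define \<kappa> where "\<kappa> s = \<mu> + k s" for s
  obtain r where "r \<in> borel_measurable borel"
    "\<And>s. 0 < s \<Longrightarrow> 0 \<le> r s" "\<And>s u. 0 < s \<Longrightarrow> s \<le> u \<Longrightarrow> r u \<le> r s"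
    "\<And>s. 0 < s \<Longrightarrow> r s \<le> s powr (\<rho> 1 - 1) / (1 / Gamma (1 - \<rho> 1))"
    "\<And>t. 0 < t \<Longrightarrow> (LINT s:{0<..<t}|lborel. \<kappa> (t - s) * r s) = 1"
  proof (rule sonine_partner_exists[OF rho1, of "1 / Gamma (1 - \<rho> 1)" \<kappa>])
    show "0 < 1 / Gamma (1 - \<rho> 1)" using Gp by simp
    show "1 / Gamma (1 - \<rho> 1) * s powr - \<rho> 1 \<le> \<kappa> s" if "0 < s" for s
      using k_ge[of s] that lam by (simp add: \<kappa>_def frac_kernel_def)
    show "\<kappa> u \<le> \<kappa> s" if "0 < s" "s \<le> u" for s u
      using k_antimono[OF that] by (simp add: \<kappa>_def)
    show "continuous_on {0<..} \<kappa>" unfolding \<kappa>_def multi_kernel_def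
      by (intro continuous_intros continuous_on_frac_kernel)
    show "(\<kappa> s)\<^sup>2 \<le> \<kappa> (s - h) * \<kappa> (s + h)" if h: "0 < h" "h < s" for s h
    proof -
      \<comment> \<open>The constant \<open>\<mu>\<close> joins the sum as the term with index \<open>0\<close>.\<close>
      define a where "a x j = (if j = 0 then \<mu> else q j * frac_kernel (1 - \<rho> j) x)" for x :: real and j :: nat
      have eq: "\<kappa> x = (\<Sum>j\<in>{0..M}. a x j)" for x
      proof -
        have "(\<Sum>j\<in>{0..M}. a x j) = a x 0 + (\<Sum>j\<in>{1..M}. a x j)"
          by (subst sum.atLeast_Suc_atMost) auto
        then show ?thesis by (simp add: \<kappa>_def multi_kernel_def a_def)
      qed
      show ?thesis unfolding eq
      proof (rule log_convex_sum)
        have a0: "0 \<le> a x j" if "j \<in> {0..M}" for x j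
          unfolding a_def using lam rho[of j] q_pos[of j] that by (auto intro!: mult_nonneg_nonneg frac_kernel_nonneg)
        then show "j \<in> {0..M} \<Longrightarrow> 0 \<le> a s j" "j \<in> {0..M} \<Longrightarrow> 0 \<le> a (s - h) j" "j \<in> {0..M} \<Longrightarrow> 0 \<le> a (s + h) j" for j
          by blast+
        show "(a s j)\<^sup>2 \<le> a (s - h) j * a (s + h) j" if j: "j \<in> {0..M}" for j
        proof (cases "j = 0")
          case False
          have "(frac_kernel (1 - \<rho> j) s)\<^sup>2 \<le> frac_kernel (1 - \<rho> j) (s - h) * frac_kernel (1 - \<rho> j) (s + h)"
            using rho[of j] False j h by (intro frac_kernel_log_convex) auto
          then have "(q j)\<^sup>2 * (frac_kernel (1 - \<rho> j) s)\<^sup>2 \<le> (q j)\<^sup>2 * (frac_kernel (1 - \<rho> j) (s - h) * frac_kernel (1 - \<rho> j) (s + h))"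
            by (rule mult_left_mono) simp
          then show ?thesis using False by (simp add: a_def power_mult_distrib power2_eq_square[of "q j"] mult_ac)
        qed (simp add: a_def power2_eq_square)
      qed simp
    qed
    show "set_integrable lborel {0<..<b} \<kappa>" for b
      unfolding \<kappa>_def by (intro set_integral_add set_integrable_const_Ioo k_set_integrable)
    have "((\<lambda>s. s * \<mu> + (\<Sum>j=1..M. q j * (s * frac_kernel (1 - \<rho> j) s))) \<longlongrightarrow> 0 * \<mu> + (\<Sum>j=1..M. q j * 0)) (at_right 0)"
      by (intro tendsto_intros tendsto_mult_frac_kernel) (use rho in auto)
    then show "((\<lambda>s. s * \<kappa> s) \<longlongrightarrow> 0) (at_right 0)"
      by (simp add: \<kappa>_def multi_kernel_def distrib_left sum_distrib_left mult.left_commute)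
  qed (rule that)
  then show ?thesis unfolding \<kappa>_def by (intro exI[of _ r]) auto
qed

text \<open>
  The function with Laplace transform \<open>1 / (\<mu> + \<Sum>j. q j * z powr \<rho> j)\<close>.
\<close>

definition resolvent :: "real \<Rightarrow> real \<Rightarrow> real" where
  "resolvent \<mu> = (SOME r. r \<in> borel_measurable borel \<and> (\<forall>s>0. 0 \<le> r s) \<and> (\<forall>s>0. \<forall>u\<ge>s. r u \<le> r s) \<and>
    (\<forall>s>0. r s \<le> s powr (\<rho> 1 - 1) * Gamma (1 - \<rho> 1)) \<and>
    (\<forall>t>0. (LINT s:{0<..<t}|lborel. (\<mu> + k (t - s)) * r s) = 1))"

text \<open>
  The solution of the homogeneous scalar equation with initial value \<open>1\<close>; for a single term it is the
  Mittag-Leffler function of \<open>- \<mu> t powr \<rho> 1\<close>.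
\<close>

definition relaxation :: "real \<Rightarrow> real \<Rightarrow> real" where
  "relaxation \<mu> t = 1 - \<mu> * (LINT s:{0<..<t}|lborel. resolvent \<mu> s)"

context
  fixes \<mu> :: real
  assumes lam: "0 \<le> \<mu>"
begin

lemma resolvent_measurable: "resolvent \<mu> \<in> borel_measurable borel"
  and resolvent_nonneg: "0 < s \<Longrightarrow> 0 \<le> resolvent \<mu> s"
  and resolvent_antimono: "0 < s \<Longrightarrow> s \<le> u \<Longrightarrow> resolvent \<mu> u \<le> resolvent \<mu> s"
  and resolvent_le: "0 < s \<Longrightarrow> resolvent \<mu> s \<le> s powr (\<rho> 1 - 1) * Gamma (1 - \<rho> 1)"
  and resolvent_conv: "0 < t \<Longrightarrow> (LINT s:{0<..<t}|lborel. (\<mu> + k (t - s)) * resolvent \<mu> s) = 1"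
  using someI_ex[OF partner_exists[OF lam]] unfolding resolvent_def[symmetric] by auto

lemma resolvent_conv_integrable:
  assumes "0 < t"
  shows "set_integrable lborel {0<..<t} (\<lambda>s. (\<mu> + k (t - s)) * resolvent \<mu> s)"
  using resolvent_conv[OF assms] not_integrable_integral_eq
  unfolding set_integrable_def set_lebesgue_integral_def by force

lemma resolvent_set_integrable: "set_integrable lborel {0<..<t} (resolvent \<mu>)"
proof (rule set_integrable_bound)
  show "set_integrable lborel {0<..<t} (\<lambda>s. s powr (\<rho> 1 - 1) * Gamma (1 - \<rho> 1))"
    by (intro set_integrable_mult_left set_integrable_powr_Ioo rho1)
  show "set_borel_measurable lborel {0<..<t} (resolvent \<mu>)"
    unfolding set_borel_measurable_def using resolvent_measurable by measurable
  show "AE s\<in>{0<..<t} in lborel. norm (resolvent \<mu> s) \<le> norm (s powr (\<rho> 1 - 1) * Gamma (1 - \<rho> 1))"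
    using order_trans[OF resolvent_le abs_ge_self] resolvent_nonneg by (intro AE_I2 impI) auto
qed

lemma resolvent_cutoff_integrable: "integrable lborel (cutoff T (resolvent \<mu>))"
  using resolvent_set_integrable resolvent_measurable by (simp add: integrable_cutoff_iff_Ioo)

text \<open>
  The source of all decay estimates: on \<open>(0,s)\<close> both factors of the convolution are at least their values at \<open>s\<close>.
\<close>

lemma resolvent_mult_le_one:
  assumes s: "0 < s"
  shows "s * (\<mu> + k s) * resolvent \<mu> s \<le> 1"
proof -
  have "(LINT u:{0<..<s}|lborel. (\<mu> + k s) * resolvent \<mu> s) \<le> (LINT u:{0<..<s}|lborel. (\<mu> + k (s - u)) * resolvent \<mu> u)"
  proof (rule set_integral_mono[OF set_integrable_const_Ioo resolvent_conv_integrable[OF s]])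
    fix u assume u: "u \<in> {0<..<s}"
    show "(\<mu> + k s) * resolvent \<mu> s \<le> (\<mu> + k (s - u)) * resolvent \<mu> u"
      using u s lam k_antimono[of "s - u" s] resolvent_antimono[of u s] resolvent_nonneg[of s] k_nonneg[of "s - u"]
      by (intro mult_mono) auto
  qed
  then show ?thesis using resolvent_conv[OF s] s by (simp add: set_integral_const_Ioo mult_ac)
qed

lemma resolvent_decay: "0 < s \<Longrightarrow> \<mu> * resolvent \<mu> s \<le> 1 / s"
proof -
  assume s: "0 < s"
  have "s * \<mu> * resolvent \<mu> s \<le> s * (\<mu> + k s) * resolvent \<mu> s"
    using s lam k_nonneg[of s] resolvent_nonneg[OF s] by (intro mult_right_mono mult_left_mono) auto
  then have "s * \<mu> * resolvent \<mu> s \<le> 1" using resolvent_mult_le_one[OF s] by linarith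
  then show ?thesis using s by (simp add: field_simps)
qed

text \<open>
  Interpolation: \<open>\<mu> powr (1 - \<epsilon>) * k powr \<epsilon> \<le> \<mu> + k\<close>.
\<close>

lemma resolvent_interpolated_le:
  assumes s: "0 < s" and \<epsilon>: "0 < \<epsilon>" "\<epsilon> < 1"
  shows "\<mu> powr (1 - \<epsilon>) * resolvent \<mu> s \<le> Gamma (1 - \<rho> 1) powr \<epsilon> * s powr (\<rho> 1 * \<epsilon> - 1)"
proof -
  have Gp: "0 < Gamma (1 - \<rho> 1)" using rho1 by (intro Gamma_real_pos) simp
  define c where "c = frac_kernel (1 - \<rho> 1) s"
  have c: "0 < c" "c \<le> k s" unfolding c_def using frac_kernel_pos[of "1 - \<rho> 1" s] rho1 s k_ge by auto
  have "\<mu> powr (1 - \<epsilon>) * c powr \<epsilon> \<le> (\<mu> + k s) powr (1 - \<epsilon>) * (\<mu> + k s) powr \<epsilon>"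
    using c lam \<epsilon> by (intro mult_mono powr_mono2) auto
  also have "\<dots> = \<mu> + k s" using c lam by (simp add: powr_add[symmetric])
  finally have 1: "\<mu> powr (1 - \<epsilon>) * c powr \<epsilon> \<le> \<mu> + k s" .
  have "s * (\<mu> powr (1 - \<epsilon>) * c powr \<epsilon>) * resolvent \<mu> s \<le> s * (\<mu> + k s) * resolvent \<mu> s"
    using s 1 resolvent_nonneg[OF s] by (intro mult_right_mono mult_left_mono) auto
  then have "s * (\<mu> powr (1 - \<epsilon>) * c powr \<epsilon>) * resolvent \<mu> s \<le> 1" using resolvent_mult_le_one[OF s] by linarith
  then have "\<mu> powr (1 - \<epsilon>) * resolvent \<mu> s \<le> 1 / (s * c powr \<epsilon>)"
    using s c by (simp add: pos_le_divide_eq mult_ac)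
  also have "\<dots> = Gamma (1 - \<rho> 1) powr \<epsilon> * s powr (\<rho> 1 * \<epsilon> - 1)"
  proof -
    have cp: "c powr \<epsilon> = s powr (- (\<rho> 1 * \<epsilon>)) / Gamma (1 - \<rho> 1) powr \<epsilon>"
      unfolding c_def frac_kernel_def using s Gp by (simp add: powr_divide powr_powr)
    show ?thesis unfolding cp using s Gp by (simp add: powr_diff powr_minus field_simps)
  qed
  finally show ?thesis .
qed

text \<open>
  Splitting the constant off the defining equation of the resolvent expresses the relaxation as \<open>k * r\<close>.
\<close>

lemma relaxation_eq_conv:
  assumes t: "0 < t" "t \<le> T"
  shows "conv (cutoff T k) (cutoff T (resolvent \<mu>)) t = relaxation \<mu> t"
    and "set_integrable lborel {0<..<t} (\<lambda>s. k (t - s) * resolvent \<mu> s)"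
    and "(LINT s:{0<..<t}|lborel. k (t - s) * resolvent \<mu> s) = relaxation \<mu> t"
proof -
  have i1: "set_integrable lborel {0<..<t} (\<lambda>s. \<mu> * resolvent \<mu> s)" using resolvent_set_integrable by simp
  have "set_integrable lborel {0<..<t} (\<lambda>s. (\<mu> + k (t - s)) * resolvent \<mu> s - \<mu> * resolvent \<mu> s)"
    by (rule set_integral_diff(1)[OF resolvent_conv_integrable[OF t(1)] i1])
  then show 2: "set_integrable lborel {0<..<t} (\<lambda>s. k (t - s) * resolvent \<mu> s)" by (simp add: algebra_simps)
  have "(LINT s:{0<..<t}|lborel. (\<mu> + k (t - s)) * resolvent \<mu> s) = (LINT s:{0<..<t}|lborel. \<mu> * resolvent \<mu> s) + (LINT s:{0<..<t}|lborel. k (t - s) * resolvent \<mu> s)"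
    using set_integral_add(2)[OF i1 2] by (simp add: algebra_simps)
  then show 3: "(LINT s:{0<..<t}|lborel. k (t - s) * resolvent \<mu> s) = relaxation \<mu> t"
    using resolvent_conv[OF t(1)] by (simp add: relaxation_def)
  have "conv (cutoff T k) (cutoff T (resolvent \<mu>)) t = conv (cutoff T (resolvent \<mu>)) (cutoff T k) t" by (rule conv_commute)
  also have "\<dots> = (LINT s:{0<..<t}|lborel. k (t - s) * resolvent \<mu> s)"
    unfolding conv_eq_integral_Ioo[OF causal_cutoff causal_cutoff] set_lebesgue_integral_def
    by (rule Bochner_Integration.integral_cong[OF refl]) (use t in \<open>auto simp: cutoff_def indicator_def\<close>)
  finally show "conv (cutoff T k) (cutoff T (resolvent \<mu>)) t = relaxation \<mu> t" using 3 by simp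
qed

lemma resolvent_integral_nonneg: "0 \<le> (LINT s:{0<..<t}|lborel. resolvent \<mu> s)"
  unfolding set_lebesgue_integral_def using resolvent_nonneg by (intro Bochner_Integration.integral_nonneg) (auto simp: indicator_def)

lemma relaxation_le_one: "relaxation \<mu> t \<le> 1"
  using resolvent_integral_nonneg[of t] lam by (simp add: relaxation_def)

text \<open>
  In the convolution \<open>k * r\<close> that represents the relaxation the kernel is at least \<open>k t\<close>.
\<close>

lemma relaxation_lower:
  assumes t: "0 < t"
  shows "k t \<le> (\<mu> + k t) * relaxation \<mu> t"
proof -
  have "(LINT s:{0<..<t}|lborel. k t * resolvent \<mu> s) \<le> (LINT s:{0<..<t}|lborel. k (t - s) * resolvent \<mu> s)"
    by (rule set_integral_mono)
       (use resolvent_set_integrable[of t] relaxation_eq_conv(2)[OF t order_refl] k_antimono resolvent_nonneg in \<open>auto intro!: mult_right_mono\<close>)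
  then have 1: "k t * (LINT s:{0<..<t}|lborel. resolvent \<mu> s) \<le> relaxation \<mu> t"
    using relaxation_eq_conv(3)[OF t order_refl] by simp
  have "\<mu> * (k t * (LINT s:{0<..<t}|lborel. resolvent \<mu> s)) \<le> \<mu> * relaxation \<mu> t" by (rule mult_left_mono[OF 1 lam])
  then show ?thesis unfolding relaxation_def by (simp add: algebra_simps)
qed

lemma relaxation_pos: "0 < t \<Longrightarrow> 0 < relaxation \<mu> t"
  using relaxation_lower[of t] k_pos[of t] lam by (smt (verit) mult_nonneg_nonpos)

lemma relaxation_nonneg: "0 \<le> relaxation \<mu> t"
proof (cases "0 < t")
  case True then show ?thesis using relaxation_pos by (simp add: less_imp_le)
next
  case False
  then have "{0<..<t} = {}" by auto
  then show ?thesis by (simp add: relaxation_def set_lebesgue_integral_def)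
qed

text \<open>
  A bound that does not depend on \<open>\<mu>\<close>: on the first half of \<open>(0,t)\<close> the mass of \<open>\<mu> r\<close> is at most \<open>1\<close>, on the
  second half \<open>\<mu> r\<close> is at most \<open>2 / t\<close>.
\<close>

lemma lam_conv_resolvent_le:
  assumes t: "0 < t" and g0: "\<And>s. 0 < s \<Longrightarrow> 0 \<le> g s" and gdec: "\<And>s u. 0 < s \<Longrightarrow> s \<le> u \<Longrightarrow> g u \<le> g s"
    and gm: "g \<in> borel_measurable borel" and gi: "set_integrable lborel {0<..<t} g"
  shows "set_integrable lborel {0<..<t} (\<lambda>s. g (t - s) * (\<mu> * resolvent \<mu> s))"
    and "(LINT s:{0<..<t}|lborel. g (t - s) * (\<mu> * resolvent \<mu> s)) \<le> g (t/2) + 2 / t * (LINT s:{0<..<t}|lborel. g (t - s))"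
proof -
  have gi': "set_integrable lborel {0<..<t} (\<lambda>s. g (t - s))"
    using gi unfolding set_integrable_def
    by (subst (asm) lborel_integrable_real_affine_iff[of "-1" _ t, symmetric])
       (simp_all add: indicator_def conj_commute cong: if_cong)
  have i: "set_integrable lborel {0<..<t} (\<lambda>s. g (t/2) * (\<mu> * resolvent \<mu> s) + 2 / t * g (t - s))"
    using resolvent_set_integrable[of t] gi' by (intro set_integral_add(1) set_integrable_mult_right) auto
  have le: "g (t - s) * (\<mu> * resolvent \<mu> s) \<le> g (t/2) * (\<mu> * resolvent \<mu> s) + 2 / t * g (t - s)" if s: "s \<in> {0<..<t}" for s
  proof (cases "s \<le> t / 2")
    case True
    then have "g (t - s) * (\<mu> * resolvent \<mu> s) \<le> g (t/2) * (\<mu> * resolvent \<mu> s)"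
      using gdec[of "t/2" "t - s"] t s resolvent_nonneg[of s] lam by (intro mult_right_mono) auto
    then show ?thesis using g0[of "t - s"] s t by (simp add: add_increasing2)
  next
    case False
    have "\<mu> * resolvent \<mu> s \<le> 1 / s" using resolvent_decay[of s] s by simp
    also have "\<dots> \<le> 2 / t" using False t by (simp add: field_simps)
    finally have "g (t - s) * (\<mu> * resolvent \<mu> s) \<le> g (t - s) * (2 / t)"
      using g0[of "t - s"] s by (intro mult_left_mono) auto
    moreover have "0 \<le> g (t/2) * (\<mu> * resolvent \<mu> s)" using g0[of "t/2"] t s resolvent_nonneg[of s] lam by auto
    ultimately show ?thesis by (simp add: mult.commute)
  qed
  have nn: "0 \<le> g (t - s) * (\<mu> * resolvent \<mu> s)" if "s \<in> {0<..<t}" for s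
    using that g0[of "t - s"] resolvent_nonneg[of s] lam by auto
  show 1: "set_integrable lborel {0<..<t} (\<lambda>s. g (t - s) * (\<mu> * resolvent \<mu> s))"
  proof (rule set_integrable_bound[OF i])
    show "set_borel_measurable lborel {0<..<t} (\<lambda>s. g (t - s) * (\<mu> * resolvent \<mu> s))"
      unfolding set_borel_measurable_def using resolvent_measurable gm by measurable
    show "AE s\<in>{0<..<t} in lborel. norm (g (t - s) * (\<mu> * resolvent \<mu> s)) \<le> norm (g (t/2) * (\<mu> * resolvent \<mu> s) + 2 / t * g (t - s))"
      using le nn by (intro AE_I2 impI) (smt (verit) real_norm_def)
  qed
  have "(LINT s:{0<..<t}|lborel. g (t - s) * (\<mu> * resolvent \<mu> s)) \<le> (LINT s:{0<..<t}|lborel. g (t/2) * (\<mu> * resolvent \<mu> s) + 2 / t * g (t - s))"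
    by (rule set_integral_mono[OF 1 i le])
  also have "\<dots> = g (t/2) * (\<mu> * (LINT s:{0<..<t}|lborel. resolvent \<mu> s)) + 2 / t * (LINT s:{0<..<t}|lborel. g (t - s))"
    using resolvent_set_integrable[of t] gi' by (subst set_integral_add(2)) auto
  also have "\<dots> \<le> g (t/2) * 1 + 2 / t * (LINT s:{0<..<t}|lborel. g (t - s))"
    using relaxation_nonneg[of t] g0[of "t/2"] t by (intro add_right_mono mult_left_mono) (auto simp: relaxation_def)
  finally show "(LINT s:{0<..<t}|lborel. g (t - s) * (\<mu> * resolvent \<mu> s)) \<le> g (t/2) + 2 / t * (LINT s:{0<..<t}|lborel. g (t - s))"
    by simp
qed

end

end

context multi_term
begin

text \<open>
  If \<open>\<phi>\<close> is the derivative of order \<open>\<rho> 1\<close>, convolution of \<open>\<phi>\<close> with this kernel is the sum of the lower-order terms.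
\<close>

definition low_kernel :: "real \<Rightarrow> real \<Rightarrow> real" where
  "low_kernel T s = (\<Sum>j=2..M. q j * cutoff T (frac_kernel (\<rho> 1 - \<rho> j)) s)"

lemma causal_low_kernel: "causal (low_kernel T)"
  by (simp add: causal_def low_kernel_def cutoff_def)

lemma integrable_low_kernel: "integrable lborel (low_kernel T)"
  unfolding low_kernel_def
  by (intro Bochner_Integration.integrable_sum integrable_mult_right integrable_cutoff_frac_kernel) (use rho_dec in auto)

lemma sum_split_first: "(\<Sum>j=1..M. g j) = g 1 + (\<Sum>j=2..M. g j)" for g :: "nat \<Rightarrow> 'b::comm_monoid_add"
  using M1 by (simp add: sum.atLeast_Suc_atMost numeral_2_eq_2)

text \<open>
  The forced part of a mode is a fractional integral of order \<open>\<rho> 1\<close>.  Both sides have the same convolution with \<open>k\<close>,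
  and convolving once more with the resolvent for \<open>\<mu> = 0\<close> shows that they have the same primitive.
\<close>

lemma frac_representation:
  fixes f \<phi> :: "real \<Rightarrow> real"
  assumes mu: "0 \<le> \<mu>" and T: "0 < T" and f: "continuous_on {0..T} f" and \<phi>: "continuous_on {0..T} \<phi>"
    and eq: "\<And>t. t \<in> {0..T} \<Longrightarrow> \<phi> t + conv (low_kernel T) (cutoff T \<phi>) t = f t - \<mu> * conv (cutoff T (resolvent \<mu>)) (cutoff T f) t"
    and t: "t \<in> {0..T}"
  shows "conv (cutoff T (resolvent \<mu>)) (cutoff T f) t = conv (cutoff T (frac_kernel (\<rho> 1))) (cutoff T \<phi>) t"
proof -
  define e where "e \<alpha> = cutoff T (frac_kernel \<alpha>)" for \<alpha>
  define K where "K = cutoff T k"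
  define r where "r = cutoff T (resolvent \<mu>)"
  define r0 where "r0 = cutoff T (resolvent 0)"
  define F where "F = cutoff T f"
  define P where "P = cutoff T \<phi>"
  define W where "W = conv r F"
  define V where "V = conv (e (\<rho> 1)) P"
  have ei: "integrable lborel (e \<alpha>)" if "0 < \<alpha>" for \<alpha> unfolding e_def by (rule integrable_cutoff_frac_kernel[OF that])
  have Ki: "integrable lborel K" unfolding K_def by (rule k_cutoff_integrable)
  have ri: "integrable lborel r" unfolding r_def by (rule resolvent_cutoff_integrable[OF mu])
  have r0i: "integrable lborel r0" unfolding r0_def by (rule resolvent_cutoff_integrable) simp
  have [simp]: "causal (e \<alpha>)" "causal K" "causal r" "causal r0" "causal F" "causal P" for \<alpha>
    by (simp_all add: e_def K_def r_def r0_def F_def P_def)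
  have [simp]: "causal W" "causal V" by (simp_all add: W_def V_def causal_conv)
  obtain bf where bf: "0 \<le> bf" "\<And>s. s \<in> {0..T} \<Longrightarrow> norm (f s) \<le> bf" using continuous_bounded_on_Icc[OF f] by blast
  obtain bp where bp: "0 \<le> bp" "\<And>s. s \<in> {0..T} \<Longrightarrow> norm (\<phi> s) \<le> bp" using continuous_bounded_on_Icc[OF \<phi>] by blast
  have Fm: "F \<in> borel_measurable borel" unfolding F_def by (rule cutoff_measurable) (rule continuous_on_subset[OF f], auto)
  have Pm: "P \<in> borel_measurable borel" unfolding P_def by (rule cutoff_measurable) (rule continuous_on_subset[OF \<phi>], auto)
  have Fb: "norm (F s) \<le> bf" for s unfolding F_def using bf by (rule norm_cutoff_le)
  have Pb: "norm (P s) \<le> bp" for s unfolding P_def using bp by (rule norm_cutoff_le)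
  have Wc: "continuous_on UNIV W" unfolding W_def F_def by (rule continuous_conv[OF ri f])
  have Vc: "continuous_on UNIV V" unfolding V_def P_def by (rule continuous_conv[OF ei[OF rho1(1)] \<phi>])
  have Wm: "W \<in> borel_measurable borel" and Vm: "V \<in> borel_measurable borel"
    using Wc Vc by (auto intro: borel_measurable_continuous_onI)
  have Wb: "norm (W s) \<le> (LINT s|lborel. \<bar>r s\<bar>) * bf" for s
    unfolding W_def by (rule norm_conv_le[OF ri Fm Fb])
  have Vb: "norm (V s) \<le> (LINT s|lborel. \<bar>e (\<rho> 1) s\<bar>) * bp" for s
    unfolding V_def by (rule norm_conv_le[OF ei[OF rho1(1)] Pm Pb])
  have ee: "conv (e \<alpha>) (e \<beta>) s = e (\<alpha> + \<beta>) s" if "0 < \<alpha>" "0 < \<beta>" "0 < s" "s \<le> T" for \<alpha> \<beta> s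
    using conv_frac_kernel[OF that] that by (simp add: e_def cutoff_eq)
  \<comment> \<open>\<open>K * W\<close> and \<open>K * V\<close> are both the primitive of \<open>f - \<mu> W\<close>: for \<open>W\<close> because \<open>K * r = 1 - \<mu> (1 * r)\<close>,
    for \<open>V\<close> because \<open>K * V\<close> collects the terms of the Volterra equation integrated once.\<close>
  have KW: "conv K W s = conv (e 1) F s - \<mu> * conv (e 1) W s" if s: "0 < s" "s \<le> T" for s
  proof -
    have "conv K W s = conv (conv K r) F s" unfolding W_def by (rule conv_assoc[OF Ki ri Fm Fb])
    also have "\<dots> = conv (\<lambda>x. e 1 x - \<mu> * conv (e 1) r x) F s"
    proof (rule conv_cong)
      show "causal (\<lambda>x. e 1 x - \<mu> * conv (e 1) r x)"
      proof -
        have "causal (e 1)" "causal (conv (e 1) r)" by (simp_all add: causal_conv)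
        then show ?thesis by (simp add: causal_def)
      qed
      fix x assume x: "0 < x" "x < s"
      have "conv (e 1) r x = (LINT y:{0<..<x}|lborel. r y)"
        unfolding e_def by (rule conv_one) (use x s in auto)
      also have "\<dots> = (LINT y:{0<..<x}|lborel. resolvent \<mu> y)"
        unfolding set_lebesgue_integral_def r_def
        by (rule Bochner_Integration.integral_cong[OF refl]) (use x s in \<open>auto simp: cutoff_def indicator_def\<close>)
      finally have "conv (e 1) r x = (LINT y:{0<..<x}|lborel. resolvent \<mu> y)" .
      moreover have "conv K r x = relaxation \<mu> x" unfolding K_def r_def by (rule relaxation_eq_conv(1)[OF mu]) (use x s in auto)
      moreover have "e 1 x = 1" using x s by (simp add: e_def cutoff_def frac_kernel_def)
      ultimately show "conv K r x = e 1 x - \<mu> * conv (e 1) r x" by (simp add: relaxation_def)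
    qed (simp_all add: causal_conv)
    also have "\<dots> = conv (e 1) F s - \<mu> * conv (conv (e 1) r) F s"
    proof -
      have "conv (\<lambda>x. e 1 x - \<mu> * conv (e 1) r x) F s = (LINT x|lborel. e 1 x *\<^sub>R F (s - x) - \<mu> * (conv (e 1) r x *\<^sub>R F (s - x)))"
        by (simp add: conv_def left_diff_distrib mult.assoc)
      also have "\<dots> = (LINT x|lborel. e 1 x *\<^sub>R F (s - x)) - (LINT x|lborel. \<mu> * (conv (e 1) r x *\<^sub>R F (s - x)))"
        by (intro Bochner_Integration.integral_diff integrable_mult_right integrable_conv_integrand[OF _ Fm Fb] integrable_conv ei ri) auto
      finally show ?thesis by (simp add: conv_def)
    qed
    also have "conv (conv (e 1) r) F s = conv (e 1) W s"
      unfolding W_def by (rule conv_assoc[OF ei ri Fm Fb, symmetric]) simp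
    finally show ?thesis .
  qed
  have KV: "conv K V s = conv (e 1) (\<lambda>x. P x + conv (low_kernel T) P x) s" if s: "0 < s" "s \<le> T" for s
  proof -
    have Ksum: "K = (\<lambda>x. \<Sum>j=1..M. q j * e (1 - \<rho> j) x)"
      by (auto simp: K_def e_def cutoff_def multi_kernel_def fun_eq_iff)
    have pos: "0 < 1 - \<rho> j" if "j \<in> {1..M}" for j using rho[OF that] by simp
    have "conv K V s = (\<Sum>j=1..M. q j *\<^sub>R conv (e (1 - \<rho> j)) V s)"
      unfolding Ksum by (rule conv_kernel_sum[OF _ Vm Vb]) (rule ei[OF pos])
    also have "\<dots> = (\<Sum>j=1..M. q j *\<^sub>R conv (e (1 - \<rho> j + \<rho> 1)) P s)"
    proof (rule sum.cong[OF refl])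
      fix j assume j: "j \<in> {1..M}"
      have "conv (e (1 - \<rho> j)) V s = conv (conv (e (1 - \<rho> j)) (e (\<rho> 1))) P s"
        unfolding V_def by (rule conv_assoc[OF ei[OF pos[OF j]] ei[OF rho1(1)] Pm Pb])
      also have "\<dots> = conv (e (1 - \<rho> j + \<rho> 1)) P s"
        by (rule conv_cong) (use ee[OF pos[OF j] rho1(1)] s in \<open>auto simp: causal_conv\<close>)
      finally show "q j *\<^sub>R conv (e (1 - \<rho> j)) V s = q j *\<^sub>R conv (e (1 - \<rho> j + \<rho> 1)) P s" by simp
    qed
    also have "\<dots> = conv (e 1) P s + (\<Sum>j=2..M. q j *\<^sub>R conv (e (1 - \<rho> j + \<rho> 1)) P s)"
      unfolding sum_split_first q1 by simp
    also have "(\<Sum>j=2..M. q j *\<^sub>R conv (e (1 - \<rho> j + \<rho> 1)) P s) = conv (conv (e 1) (low_kernel T)) P s"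
    proof -
      have d: "0 < \<rho> 1 - \<rho> j" if "j \<in> {2..M}" for j using rho_dec[OF that] by simp
      have "conv (conv (e 1) (low_kernel T)) P s = conv (e 1) (conv (low_kernel T) P) s"
        by (rule conv_assoc[OF ei integrable_low_kernel Pm Pb, symmetric]) simp
      also have "conv (low_kernel T) P = (\<lambda>x. \<Sum>j=2..M. q j *\<^sub>R conv (e (\<rho> 1 - \<rho> j)) P x)"
        unfolding low_kernel_def e_def[symmetric] by (rule ext, rule conv_kernel_sum[OF _ Pm Pb]) (rule ei[OF d])
      also have "conv (e 1) (\<lambda>x. \<Sum>j=2..M. q j *\<^sub>R conv (e (\<rho> 1 - \<rho> j)) P x) s = (\<Sum>j=2..M. q j *\<^sub>R conv (e (1 - \<rho> j + \<rho> 1)) P s)"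
      proof -
        have "conv (e 1) (\<lambda>x. \<Sum>j=2..M. q j *\<^sub>R conv (e (\<rho> 1 - \<rho> j)) P x) s
          = (LINT y|lborel. (\<Sum>j=2..M. q j * (e 1 y *\<^sub>R conv (e (\<rho> 1 - \<rho> j)) P (s - y))))"
          unfolding conv_def[of "e 1"] real_scaleR_def sum_distrib_left
          by (intro Bochner_Integration.integral_cong[OF refl] sum.cong refl) (rule mult.left_commute)
        also have "\<dots> = (\<Sum>j=2..M. LINT y|lborel. q j * (e 1 y *\<^sub>R conv (e (\<rho> 1 - \<rho> j)) P (s - y)))"
        proof (rule Bochner_Integration.integral_sum)
          fix j assume j: "j \<in> {2..M}"
          have "continuous_on UNIV (conv (e (\<rho> 1 - \<rho> j)) P)" unfolding P_def by (rule continuous_conv[OF ei[OF d[OF j]] \<phi>])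
          then show "integrable lborel (\<lambda>y. q j * (e 1 y *\<^sub>R conv (e (\<rho> 1 - \<rho> j)) P (s - y)))"
            using integrable_conv_integrand[OF ei[of 1] borel_measurable_continuous_onI norm_conv_le[OF ei[OF d[OF j]] Pm Pb]]
            by (intro integrable_mult_right) simp
        qed
        also have "\<dots> = (\<Sum>j=2..M. q j *\<^sub>R conv (e 1) (conv (e (\<rho> 1 - \<rho> j)) P) s)"
          unfolding conv_def[of "e 1"] real_scaleR_def by (intro sum.cong refl integral_mult_right_zero)
        also have "\<dots> = (\<Sum>j=2..M. q j *\<^sub>R conv (e (1 - \<rho> j + \<rho> 1)) P s)"
        proof (rule sum.cong[OF refl])
          fix j assume j: "j \<in> {2..M}"
          have "conv (e 1) (conv (e (\<rho> 1 - \<rho> j)) P) s = conv (conv (e 1) (e (\<rho> 1 - \<rho> j))) P s"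
            by (rule conv_assoc[OF ei ei[OF d[OF j]] Pm Pb]) simp
          also have "\<dots> = conv (e (1 - \<rho> j + \<rho> 1)) P s"
            by (rule conv_cong) (use ee[OF _ d[OF j], of 1] s in \<open>auto simp: causal_conv algebra_simps\<close>)
          finally show "q j *\<^sub>R conv (e 1) (conv (e (\<rho> 1 - \<rho> j)) P) s = q j *\<^sub>R conv (e (1 - \<rho> j + \<rho> 1)) P s" by simp
        qed
        finally show ?thesis .
      qed
      finally show ?thesis by simp
    qed
    also have "conv (conv (e 1) (low_kernel T)) P s = conv (e 1) (conv (low_kernel T) P) s"
      by (rule conv_assoc[OF ei integrable_low_kernel Pm Pb, symmetric]) simp
    also have "conv (e 1) P s + conv (e 1) (conv (low_kernel T) P) s = conv (e 1) (\<lambda>x. P x + conv (low_kernel T) P x) s"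
    proof (rule conv_add[OF ei Pm Pb _ norm_conv_le[OF integrable_low_kernel Pm Pb], symmetric])
      show "conv (low_kernel T) P \<in> borel_measurable borel"
        unfolding P_def by (intro borel_measurable_continuous_onI continuous_conv[OF integrable_low_kernel \<phi>])
    qed simp
    finally show ?thesis .
  qed
  have KWV: "conv K W s = conv K V s" if s: "0 < s" "s \<le> T" for s
  proof -
    have "conv K V s = conv (e 1) (\<lambda>x. F x + (- \<mu>) * W x) s"
      unfolding KV[OF s]
    proof (rule conv_cong)
      show "causal (\<lambda>x. P x + conv (low_kernel T) P x)"
        using causal_conv[OF causal_low_kernel, of P T] by (auto simp: causal_def P_def cutoff_def)
      have "causal F" "causal W" by simp_all
      then show "causal (\<lambda>x. F x + (- \<mu>) * W x)" by (simp add: causal_def)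
      fix x assume x: "0 < x" "x < s"
      then show "P x + conv (low_kernel T) P x = F x + (- \<mu>) * W x"
        using eq[of x] s by (simp add: P_def F_def W_def r_def cutoff_eq)
    qed simp_all
    also have "\<dots> = conv (e 1) F s + conv (e 1) (\<lambda>x. (- \<mu>) * W x) s"
    proof (rule conv_add[OF ei Fm Fb])
      show "(\<lambda>x. (- \<mu>) * W x) \<in> borel_measurable borel" using Wm by (intro borel_measurable_times borel_measurable_const)
      show "norm ((- \<mu>) * W x) \<le> \<mu> * ((LINT s|lborel. \<bar>r s\<bar>) * bf)" for x
        using mult_left_mono[OF Wb[of x] mu] mu by (simp add: abs_mult)
    qed simp
    also have "conv (e 1) (\<lambda>x. (- \<mu>) * W x) s = - \<mu> * conv (e 1) W s"
    proof -
      have "(LINT x|lborel. e 1 x *\<^sub>R ((- \<mu>) * W (s - x))) = (LINT x|lborel. (- \<mu>) * (e 1 x * W (s - x)))"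
        by (rule Bochner_Integration.integral_cong[OF refl]) (simp only: real_scaleR_def mult.left_commute)
      also have "\<dots> = (- \<mu>) * (LINT x|lborel. e 1 x * W (s - x))" by (rule integral_mult_right_zero)
      finally show ?thesis unfolding conv_def real_scaleR_def .
    qed
    finally show ?thesis using KW[OF s] by simp
  qed
  \<comment> \<open>\<open>r0\<close> inverts \<open>K\<close> up to one integration, so \<open>W\<close> and \<open>V\<close> have the same primitive.\<close>
  have prim: "(LINT y:{0<..<s}|lborel. W y) = (LINT y:{0<..<s}|lborel. V y)" if s: "0 < s" "s \<le> T" for s
  proof -
    have one: "conv r0 K x = e 1 x" if "0 < x" "x < s" for x
    proof -
      have "conv r0 K x = conv K r0 x" by (rule conv_commute)
      also have "\<dots> = relaxation 0 x" unfolding r0_def K_def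
        by (rule relaxation_eq_conv(1)) (use that s in auto)
      finally have "conv r0 K x = relaxation 0 x" .
      then show ?thesis using that s by (simp add: relaxation_def e_def cutoff_def frac_kernel_def)
    qed
    have *: "(LINT y:{0<..<s}|lborel. X y) = conv r0 (conv K X) s"
      if "causal X" "X \<in> borel_measurable borel" "\<And>y. norm (X y) \<le> b" for X b
    proof -
      have "conv r0 (conv K X) s = conv (conv r0 K) X s" by (rule conv_assoc[OF r0i Ki that(2,3)])
      also have "\<dots> = conv (e 1) X s" by (rule conv_cong) (use one that(1) in \<open>auto simp: causal_conv\<close>)
      also have "\<dots> = (LINT y:{0<..<s}|lborel. X y)" unfolding e_def by (rule conv_one[OF that(1) s(2)])
      finally show ?thesis by simp
    qed
    have "conv r0 (conv K W) s = conv r0 (conv K V) s"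
      by (rule conv_cong) (use KWV s in \<open>auto simp: causal_conv\<close>)
    then show ?thesis using *[OF _ Wm Wb] *[OF _ Vm Vb] by simp
  qed
  have in0: "W s - V s = 0" if s: "0 < s" "s < T" for s
  proof (rule zero_if_primitive_zero[of T "\<lambda>s. W s - V s", OF _ _ s])
    show "continuous_on {0..T} (\<lambda>s. W s - V s)"
      by (intro continuous_intros continuous_on_subset[OF Wc] continuous_on_subset[OF Vc]) auto
    fix u assume u: "0 < u" "u < T"
    have i: "set_integrable lborel {0<..<u} X" if "continuous_on UNIV X" for X :: "real \<Rightarrow> real"
      by (rule set_integrable_subset[OF borel_integrable_atLeastAtMost'[of 0 u]])
         (auto intro: continuous_on_subset[OF that])
    show "(LINT s:{0<..<u}|lborel. W s - V s) = 0"
      using set_integral_diff(2)[OF i[OF Wc] i[OF Vc]] prim[of u] u by simp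
  qed
  have all0: "W s - V s = 0" if "s \<in> {0..T}" for s
  proof (rule continuous_constant_on_closure[of "{0<..<T}" "\<lambda>s. W s - V s"])
    show "continuous_on (closure {0<..<T}) (\<lambda>s. W s - V s)"
      by (intro continuous_intros continuous_on_subset[OF Wc] continuous_on_subset[OF Vc]) auto
    show "s \<in> closure {0<..<T}" using that T by simp
  qed (use in0 in auto)
  then show ?thesis using t by (simp add: W_def V_def r_def F_def e_def P_def)
qed

end

section \<open>The backward problem\<close>

locale backward = hilbert_basis v + multi_term M \<rho> q
  for v :: "nat \<Rightarrow> 'a::{real_inner, banach, second_countable_topology}" and M \<rho> q +
  fixes D :: "'a set" and A :: "'a \<Rightarrow> 'a" and lam :: "nat \<Rightarrow> real" and T \<epsilon> :: real
  assumes A_coeff: "x \<in> D \<Longrightarrow> inner (A x) (v n) = lam n * inner x (v n)"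
    and A_surj: "\<exists>x\<in>D. A x = z"
    and lam0: "0 < lam 0" and lam_mono: "mono lam" and T: "0 < T" and eps: "0 < \<epsilon>" "\<epsilon> < 1"
begin

lemma lam_ge: "lam 0 \<le> lam n" using lam_mono by (simp add: monoD)

lemma lam_pos: "0 < lam n" using lam_ge[of n] lam0 by simp

text \<open>
  As \<open>A\<close> maps its domain onto the whole space, the coefficients of \<open>A x\<close> decide whether \<open>x\<close> is in the domain.
\<close>

lemma in_domain_if_coeffs:
  assumes "\<And>n. inner z (v n) = lam n * inner x (v n)"
  shows "x \<in> D" and "A x = z"
proof -
  obtain y where y: "y \<in> D" "A y = z" using A_surj by blast
  have "x = y"
  proof (rule eq_if_coeffs_eq)
    fix n show "inner x (v n) = inner y (v n)"
      using A_coeff[OF y(1), of n] assms[of n] y(2) lam_pos[of n] by simp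
  qed
  then show "x \<in> D" "A x = z" using y by auto
qed

lemma conv_R_bound:
  assumes t: "0 < t" and g0: "\<And>s. 0 < s \<Longrightarrow> 0 \<le> g s" and gdec: "\<And>s u. 0 < s \<Longrightarrow> s \<le> u \<Longrightarrow> g u \<le> g s"
    and gm: "g \<in> borel_measurable borel" and gi: "set_integrable lborel {0<..<t} g"
  obtains C where "\<And>n. \<bar>LINT s:{0<..<t}|lborel. g (t - s) * (lam n * resolvent (lam n) s)\<bar> \<le> C"
proof
  fix n
  have "0 \<le> (LINT s:{0<..<t}|lborel. g (t - s) * (lam n * resolvent (lam n) s))"
    unfolding set_lebesgue_integral_def using g0 resolvent_nonneg[OF less_imp_le[OF lam_pos]] lam_pos[of n]
    by (intro Bochner_Integration.integral_nonneg) (auto simp: indicator_def less_imp_le)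
  then show "\<bar>LINT s:{0<..<t}|lborel. g (t - s) * (lam n * resolvent (lam n) s)\<bar> \<le> g (t/2) + 2 / t * (LINT s:{0<..<t}|lborel. g (t - s))"
    using lam_conv_resolvent_le(2)[OF less_imp_le[OF lam_pos] t g0 gdec gm gi, of n] by simp
qed

definition free_evolution :: "'a \<Rightarrow> real \<Rightarrow> 'a" where
  "free_evolution y t = diag v (\<lambda>n. relaxation (lam n) t) y"

lemma relaxation_bounded: "\<bar>relaxation (lam n) t\<bar> \<le> 1"
  using relaxation_le_one relaxation_nonneg lam_pos[of n] by (simp add: less_imp_le)

lemma coeff_free_evolution: "inner (free_evolution y t) (v n) = relaxation (lam n) t * inner y (v n)"
  unfolding free_evolution_def by (rule coeff_diag[OF relaxation_bounded])

lemma free_evolution_0: "free_evolution y 0 = y"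
  by (rule eq_if_coeffs_eq) (simp add: coeff_free_evolution relaxation_def set_lebesgue_integral_def)

lemma lam_relaxation_eq:
  assumes "0 < t"
  shows "lam n * relaxation (lam n) t = (LINT s:{0<..<t}|lborel. k (t - s) * (lam n * resolvent (lam n) s))"
  using relaxation_eq_conv(3)[OF less_imp_le[OF lam_pos] assms order_refl, of n]
  by (simp add: mult.left_commute)

text \<open>
  The Caputo derivatives of the modes add up to \<open>- \<mu> (k * r)\<close>, and \<open>k * r\<close> is the relaxation.
\<close>

lemma free_evolution_solves:
  assumes t: "0 < t"
  shows "continuous_on {0..t} (free_evolution y)"
    and "\<exists>d. (\<forall>j\<in>{1..M}. has_caputo_derivative (\<rho> j) (free_evolution y) (d j) t) \<and> (\<Sum>j=1..M. q j *\<^sub>R d j) + A (free_evolution y t) = 0"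
    and "free_evolution y t \<in> D"
proof -
  have lp: "0 \<le> lam n" for n using lam_pos[of n] by simp
  define R where "R n s = lam n * resolvent (lam n) s" for n s
  have homR: "free_evolution y = (\<lambda>\<tau>. diag v (\<lambda>n. 1 - (LINT s:{0<..<\<tau>}|lborel. R n s)) y)"
    by (simp add: fun_eq_iff free_evolution_def relaxation_def R_def)
  have R0: "0 \<le> R n s" if "0 < s" for n s using resolvent_nonneg[OF lp that] lp by (simp add: R_def)
  have Rd: "R n s \<le> 1 / s" if "0 < s" for n s unfolding R_def by (rule resolvent_decay[OF lp that])
  have Ri: "set_integrable lborel {0<..<b} (R n)" for n b
    unfolding R_def using resolvent_set_integrable[OF lp] by simp
  have R1: "(LINT s:{0<..<b}|lborel. R n s) \<le> 1" for n b
    using relaxation_nonneg[OF lp, of n b] by (simp add: R_def relaxation_def)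
  define m where "m j n = (LINT s:{0<..<t}|lborel. frac_kernel (1 - \<rho> j) (t - s) * R n s)" for j n
  have cap: "\<exists>C. (\<forall>n. \<bar>m j n\<bar> \<le> C) \<and> (\<forall>n. set_integrable lborel {0<..<t} (\<lambda>s. frac_kernel (1 - \<rho> j) (t - s) * R n s)) \<and>
     continuous_on {0..t} (free_evolution y) \<and> has_caputo_derivative (\<rho> j) (free_evolution y) (diag v (\<lambda>n. - m j n) y) t" if j: "j \<in> {1..M}" for j
  proof -
    have rj: "0 < \<rho> j" "\<rho> j < 1" using rho[OF j] by auto
    have g0: "0 \<le> frac_kernel (1 - \<rho> j) s" for s using rj by (intro frac_kernel_nonneg) simp
    have gdec: "frac_kernel (1 - \<rho> j) u \<le> frac_kernel (1 - \<rho> j) s" if "0 < s" "s \<le> u" for s u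
      using rj that by (intro frac_kernel_antimono) auto
    have gi: "set_integrable lborel {0<..<t} (frac_kernel (1 - \<rho> j))" using rj by (intro set_integrable_frac_kernel) simp
    obtain C where C: "\<And>n. \<bar>m j n\<bar> \<le> C"
      using conv_R_bound[OF t g0 gdec frac_kernel_measurable gi] unfolding m_def R_def by blast
    have wi: "set_integrable lborel {0<..<t} (\<lambda>s. frac_kernel (1 - \<rho> j) (t - s) * R n s)" for n
      unfolding R_def by (rule lam_conv_resolvent_le(1)[OF lp t g0 gdec frac_kernel_measurable gi])
    have mC: "m j n \<le> C" for n using C[of n] by simp
    note cr = caputo_diag_relaxation[where R = R and C = C and y = y, OF rj t R0 Rd Ri R1 wi mC[unfolded m_def]]
    show ?thesis using C wi cr unfolding homR m_def by blast
  qed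
  then show "continuous_on {0..t} (free_evolution y)" using M1 by auto
  obtain C where C: "\<And>n. \<bar>lam n * relaxation (lam n) t\<bar> \<le> C"
    using conv_R_bound[OF t k_nonneg k_antimono k_measurable k_set_integrable] unfolding lam_relaxation_eq[OF t] by blast
  define z where "z = diag v (\<lambda>n. lam n * relaxation (lam n) t) y"
  have cz: "inner z (v n) = lam n * inner (free_evolution y t) (v n)" for n
    unfolding z_def coeff_diag[OF C] coeff_free_evolution by simp
  show dom: "free_evolution y t \<in> D" by (rule in_domain_if_coeffs(1)[OF cz])
  have Ah: "A (free_evolution y t) = z" by (rule in_domain_if_coeffs(2)[OF cz])
  have summ: "(\<Sum>j=1..M. q j * m j n) = lam n * relaxation (lam n) t" for n
  proof -
    have i: "set_integrable lborel {0<..<t} (\<lambda>s. q j * (frac_kernel (1 - \<rho> j) (t - s) * R n s))" if "j \<in> {1..M}" for j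
      using cap[OF that] by auto
    have "(\<Sum>j=1..M. q j * m j n) = (\<Sum>j=1..M. LINT s:{0<..<t}|lborel. q j * (frac_kernel (1 - \<rho> j) (t - s) * R n s))"
      by (simp add: m_def)
    also have "\<dots> = (LINT s:{0<..<t}|lborel. (\<Sum>j=1..M. q j * (frac_kernel (1 - \<rho> j) (t - s) * R n s)))"
      using i unfolding set_lebesgue_integral_def set_integrable_def scaleR_sum_right
      by (intro Bochner_Integration.integral_sum[symmetric]) auto
    also have "\<dots> = lam n * relaxation (lam n) t"
      unfolding lam_relaxation_eq[OF t] by (simp add: multi_kernel_def sum_distrib_right R_def mult.assoc)
    finally show ?thesis .
  qed
  show "\<exists>d. (\<forall>j\<in>{1..M}. has_caputo_derivative (\<rho> j) (free_evolution y) (d j) t) \<and> (\<Sum>j=1..M. q j *\<^sub>R d j) + A (free_evolution y t) = 0"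
  proof (intro exI[of _ "\<lambda>j. diag v (\<lambda>n. - m j n) y"] conjI ballI)
    show "has_caputo_derivative (\<rho> j) (free_evolution y) (diag v (\<lambda>n. - m j n) y) t" if "j \<in> {1..M}" for j
      using cap[OF that] by blast
    show "(\<Sum>j=1..M. q j *\<^sub>R diag v (\<lambda>n. - m j n) y) + A (free_evolution y t) = 0"
    proof (rule zero_if_coeffs_zero)
      fix n
      have cm: "inner (diag v (\<lambda>n. - m j n) y) (v n) = - m j n * inner y (v n)" if j: "j \<in> {1..M}" for j
      proof -
        obtain B where "\<And>n. \<bar>m j n\<bar> \<le> B" using cap[OF j] by blast
        then have "\<bar>- m j n\<bar> \<le> B" for n by simp
        then show ?thesis by (rule coeff_diag)
      qed
      have "inner (\<Sum>j=1..M. q j *\<^sub>R diag v (\<lambda>n. - m j n) y) (v n) = (\<Sum>j=1..M. q j * (- m j n * inner y (v n)))"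
        unfolding inner_sum_left by (rule sum.cong) (simp_all add: cm)
      also have "\<dots> = - (\<Sum>j=1..M. q j * m j n) * inner y (v n)"
        by (simp add: sum_distrib_right sum_negf mult.assoc)
      also have "\<dots> = - (lam n * relaxation (lam n) t) * inner y (v n)" unfolding summ ..
      finally show "inner ((\<Sum>j=1..M. q j *\<^sub>R diag v (\<lambda>n. - m j n) y) + A (free_evolution y t)) (v n) = 0"
        using cz[of n] by (simp add: inner_add_left Ah coeff_free_evolution)
    qed
  qed
qed

definition smoothing_bound :: "real \<Rightarrow> real" where
  "smoothing_bound = cutoff T (\<lambda>s. Gamma (1 - \<rho> 1) powr \<epsilon> * s powr (\<rho> 1 * \<epsilon> - 1))"

text \<open>
  This is \<open>A powr (1 - \<epsilon>)\<close> times the resolvent; the missing factor \<open>A powr \<epsilon>\<close> is left on the inhomogeneity.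
\<close>

definition smoothing :: "real \<Rightarrow> 'a \<Rightarrow> 'a" where
  "smoothing \<sigma> y = diag v (\<lambda>n. cutoff T (\<lambda>s. lam n powr (1 - \<epsilon>) * resolvent (lam n) s) \<sigma>) y"

lemma smoothing_bound_integrable: "integrable lborel smoothing_bound"
  unfolding smoothing_bound_def
proof (subst integrable_cutoff_iff_Ioo)
  show "set_integrable lborel {0<..<T} (\<lambda>s. Gamma (1 - \<rho> 1) powr \<epsilon> * s powr (\<rho> 1 * \<epsilon> - 1))"
    by (intro set_integrable_mult_right set_integrable_powr_Ioo) (use rho1 eps in simp)
qed measurable

lemma smoothing_bound_nonneg: "0 \<le> smoothing_bound \<sigma>"
  by (simp add: smoothing_bound_def cutoff_def)

lemma smoothing_multiplier_le: "\<bar>cutoff T (\<lambda>s. lam n powr (1 - \<epsilon>) * resolvent (lam n) s) \<sigma>\<bar> \<le> smoothing_bound \<sigma>"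
  using resolvent_interpolated_le[OF less_imp_le[OF lam_pos] _ eps, of \<sigma> n] resolvent_nonneg[OF less_imp_le[OF lam_pos], of \<sigma> n]
  by (auto simp: cutoff_def smoothing_bound_def)

lemma coeff_smoothing: "inner (smoothing \<sigma> y) (v n) = cutoff T (\<lambda>s. lam n powr (1 - \<epsilon>) * resolvent (lam n) s) \<sigma> * inner y (v n)"
  unfolding smoothing_def by (rule coeff_diag[OF smoothing_multiplier_le])

lemma smoothing_measurable:
  assumes "x \<in> borel_measurable borel"
  shows "(\<lambda>\<sigma>. smoothing \<sigma> (x \<sigma>)) \<in> borel_measurable borel"
  unfolding smoothing_def
proof (rule diag_measurable[OF assms _ smoothing_multiplier_le])
  have [measurable]: "resolvent (lam n) \<in> borel_measurable borel" for n by (rule resolvent_measurable[OF less_imp_le[OF lam_pos]])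
  show "(\<lambda>\<sigma>. cutoff T (\<lambda>s. lam n powr (1 - \<epsilon>) * resolvent (lam n) s) \<sigma>) \<in> borel_measurable borel" for n
    by (rule cutoff_measurable_borel) measurable
qed

text \<open>
  \<open>Z = A W\<close> is built first, as an integral that converges in the Hilbert space because the
  smoothing operators have an integrable bound.  Then \<open>\<phi>\<close> solves the Volterra equation with right-hand side
  \<open>f - Z\<close>, and \<open>W\<close> is its fractional integral.
\<close>

lemma forced_solution_exists:
  assumes f: "frac_continuous_on v lam \<epsilon> {0..T} f"
  obtains W where "continuous_on {0..T} W" and "W 0 = 0" and "\<And>t. t \<in> {0..T} \<Longrightarrow> W t \<in> D"
    and "\<And>t. 0 < t \<Longrightarrow> t \<le> T \<Longrightarrow> \<exists>d. (\<forall>j\<in>{1..M}. has_caputo_derivative (\<rho> j) W (d j) t) \<and> (\<Sum>j=1..M. q j *\<^sub>R d j) + A (W t) = f t"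
    and "\<And>N. (\<And>t. t \<in> {0..T} \<Longrightarrow> frac_norm v lam \<epsilon> (f t) \<le> N) \<Longrightarrow> norm (A (W T)) \<le> integral\<^sup>L lborel smoothing_bound * N"
proof -
  have lp: "0 \<le> lam n" for n using lam_pos[of n] by simp
  define g where "g t = frac_power v lam \<epsilon> (f t)" for t
  have gc: "continuous_on {0..T} g" unfolding g_def by (rule continuous_on_frac_power[OF f])
  have fdom: "f t \<in> frac_domain v lam \<epsilon>" if "t \<in> {0..T}" for t using f that by (simp add: frac_continuous_on_def)
  have gcoef: "inner (g t) (v n) = lam n powr \<epsilon> * inner (f t) (v n)" if "t \<in> {0..T}" for t n
    unfolding g_def by (rule coeff_frac_power(1)[OF fdom[OF that]])
  have fc: "continuous_on {0..T} f"
  proof -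
    have bd: "\<bar>lam n powr (-\<epsilon>)\<bar> \<le> lam 0 powr (-\<epsilon>)" for n
      using eps lam_ge[of n] lam0 by (simp add: powr_mono2')
    have "continuous_on {0..T} (\<lambda>t. diag v (\<lambda>n. lam n powr (-\<epsilon>)) (g t))"
      by (rule bounded_linear.continuous_on[OF bounded_linear_diag[OF bd] gc])
    then show ?thesis
    proof (rule continuous_on_eq)
      fix t assume t: "t \<in> {0..T}"
      show "diag v (\<lambda>n. lam n powr (-\<epsilon>)) (g t) = f t"
      proof (rule eq_if_coeffs_eq)
        fix n
        show "inner (diag v (\<lambda>n. lam n powr (-\<epsilon>)) (g t)) (v n) = inner (f t) (v n)"
          unfolding coeff_diag[OF bd] gcoef[OF t] using lam_pos[of n] by (simp add: powr_minus)
      qed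
    qed
  qed
  define p where "p = cutoff T g"
  have pm: "p \<in> borel_measurable borel" unfolding p_def by (rule cutoff_measurable) (rule continuous_on_subset[OF gc], auto)
  have pc: "isCont p s" if "s \<notin> {0, T}" for s
    unfolding p_def by (rule isCont_cutoff[OF _ that]) (rule continuous_on_subset[OF gc], auto)
  obtain K where K: "0 \<le> K" "\<And>s. s \<in> {0..T} \<Longrightarrow> norm (g s) \<le> K" using continuous_bounded_on_Icc[OF gc] by blast
  have pb: "norm (p s) \<le> b" if "0 \<le> b" "\<And>s. s \<in> {0..T} \<Longrightarrow> norm (g s) \<le> b" for s b unfolding p_def using that by (rule norm_cutoff_le)
  have pbK: "norm (p s) \<le> K" for s using pb K by blast
  have sm0: "smoothing \<sigma> 0 = 0" for \<sigma> by (simp add: smoothing_def diag_zero)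
  have smd: "norm (smoothing \<sigma> y - smoothing \<sigma> z) \<le> smoothing_bound \<sigma> * norm (y - z)" for \<sigma> y z
    unfolding smoothing_def diag_diff[OF smoothing_multiplier_le, symmetric] by (rule norm_diag_le[OF smoothing_multiplier_le])
  note cik = smoothing_bound_integrable smoothing_bound_nonneg sm0 smd
  define Z where "Z t = (LINT \<sigma>|lborel. smoothing \<sigma> (p (t - \<sigma>)))" for t
  have Zi: "integrable lborel (\<lambda>\<sigma>. smoothing \<sigma> (p (t - \<sigma>)))" for t 
    by (rule continuous_integral_kernel(1)[OF cik _ pm pbK, of "{0, T}"]) (auto intro: smoothing_measurable pc)
  have Zc: "continuous_on {0..T} Z" unfolding Z_def

    by (rule continuous_on_subset, rule continuous_integral_kernel(3)[OF cik _ pm pbK, of "{0, T}"]) (auto intro: smoothing_measurable pc)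
  have Zb: "norm (Z t) \<le> integral\<^sup>L lborel smoothing_bound * b" if "0 \<le> b" "\<And>s. s \<in> {0..T} \<Longrightarrow> norm (g s) \<le> b" for t b
  proof -
    have "norm (p s) \<le> b" for s using pb that by blast
    then show ?thesis unfolding Z_def
      by (intro continuous_integral_kernel(2)[OF cik _ pm, of _ "{0, T}"]) (auto intro: smoothing_measurable pc)
  qed
  define fn where "fn n t = inner (f t) (v n)" for n t
  have fnc: "continuous_on {0..T} (fn n)" for n unfolding fn_def by (intro continuous_intros fc)
  have Zcoef: "inner (Z t) (v n) = lam n * conv (cutoff T (resolvent (lam n))) (cutoff T (fn n)) t" for t n
  proof -
    have "inner (Z t) (v n) = (LINT \<sigma>|lborel. inner (smoothing \<sigma> (p (t - \<sigma>))) (v n))"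
      unfolding Z_def by (rule integral_inner_left[OF Zi, symmetric])
    also have "\<dots> = (LINT \<sigma>|lborel. lam n * (cutoff T (resolvent (lam n)) \<sigma> * cutoff T (fn n) (t - \<sigma>)))"
    proof (rule Bochner_Integration.integral_cong[OF refl])
      fix \<sigma>
      have "lam n powr (1 - \<epsilon>) * lam n powr \<epsilon> = lam n" using lam_pos[of n] by (simp add: powr_add[symmetric])
      moreover have "inner (p (t - \<sigma>)) (v n) = lam n powr \<epsilon> * cutoff T (fn n) (t - \<sigma>)"
        using gcoef[of "t - \<sigma>" n] by (simp add: p_def cutoff_def fn_def)
      ultimately show "inner (smoothing \<sigma> (p (t - \<sigma>))) (v n) = lam n * (cutoff T (resolvent (lam n)) \<sigma> * cutoff T (fn n) (t - \<sigma>))"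
        unfolding coeff_smoothing by (simp add: cutoff_def mult_ac)
    qed
    finally show ?thesis by (simp add: conv_def)
  qed
  define F where "F t = f t - Z t" for t
  have Fc: "continuous_on {0..T} F" unfolding F_def by (intro continuous_intros fc Zc)
  obtain \<phi> where \<phi>: "continuous_on {0..T} \<phi>" and \<phi>eq: "\<And>t. t \<in> {0..T} \<Longrightarrow> \<phi> t + conv (low_kernel T) (cutoff T \<phi>) t = F t"
    using volterra_second_kind[OF integrable_low_kernel causal_low_kernel less_imp_le[OF T] Fc] by blast
  obtain B where B: "0 \<le> B" "\<And>s. s \<in> {0..T} \<Longrightarrow> norm (\<phi> s) \<le> B" using continuous_bounded_on_Icc[OF \<phi>] by blast
  have phm: "cutoff T \<phi> \<in> borel_measurable borel" by (rule cutoff_measurable) (rule continuous_on_subset[OF \<phi>], auto)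
  have phb: "norm (cutoff T \<phi> s) \<le> B" for s using B by (rule norm_cutoff_le)
  have e1: "integrable lborel (cutoff T (frac_kernel (\<rho> 1)))" using rho1 by (intro integrable_cutoff_frac_kernel)
  define W where "W = conv (cutoff T (frac_kernel (\<rho> 1))) (cutoff T \<phi>)"
  have cutin: "(\<lambda>s. inner (cutoff T \<phi> s) (v n)) = cutoff T (\<lambda>s. inner (\<phi> s) (v n))" for n
    by (auto simp: cutoff_def fun_eq_iff)
  have Wcoef: "inner (Z t) (v n) = lam n * inner (W t) (v n)" if t: "t \<in> {0..T}" for t n
  proof -
    have "conv (cutoff T (resolvent (lam n))) (cutoff T (fn n)) t = conv (cutoff T (frac_kernel (\<rho> 1))) (cutoff T (\<lambda>s. inner (\<phi> s) (v n))) t"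
    proof (rule frac_representation[OF lp T fnc _ _ t])
      show "continuous_on {0..T} (\<lambda>s. inner (\<phi> s) (v n))" by (intro continuous_intros \<phi>)
      fix s assume s: "s \<in> {0..T}"
      have "inner (\<phi> s + conv (low_kernel T) (cutoff T \<phi>) s) (v n) = inner (F s) (v n)" using \<phi>eq[OF s] by simp
      then show "inner (\<phi> s) (v n) + conv (low_kernel T) (cutoff T (\<lambda>s. inner (\<phi> s) (v n))) s = fn n s - lam n * conv (cutoff T (resolvent (lam n))) (cutoff T (fn n)) s"
        unfolding inner_add_left conv_inner[OF integrable_low_kernel phm phb] cutin F_def inner_diff_left Zcoef fn_def .
    qed
    then show ?thesis
      unfolding Zcoef W_def conv_inner[OF e1 phm phb] cutin by simp
  qed
  have WD: "W t \<in> D" and AW: "A (W t) = Z t" if "t \<in> {0..T}" for t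
    using in_domain_if_coeffs[OF Wcoef[OF that]] by auto
  show ?thesis
  proof (rule that)
    show "continuous_on {0..T} W" unfolding W_def by (rule continuous_on_subset[OF continuous_conv[OF e1 \<phi>]]) simp
    have "causal W" unfolding W_def by (intro causal_conv causal_cutoff)
    then show "W 0 = 0" by (simp add: causal_def)
    show "W t \<in> D" if "t \<in> {0..T}" for t by (rule WD[OF that])
    show "norm (A (W T)) \<le> integral\<^sup>L lborel smoothing_bound * N" if N: "\<And>t. t \<in> {0..T} \<Longrightarrow> frac_norm v lam \<epsilon> (f t) \<le> N" for N
    proof -
      have "norm (g s) \<le> N" if "s \<in> {0..T}" for s using N[OF that] by (simp add: g_def frac_norm_def)
      moreover from this[of 0] have "0 \<le> N" using T norm_ge_zero[of "g 0"] by (meson atLeastAtMost_iff less_imp_le order_refl order_trans)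
      ultimately show ?thesis using Zb AW[of T] T by simp
    qed
    fix t assume t: "0 < t" "t \<le> T"
    define d where "d j = (if j = 1 then \<phi> t else conv (cutoff T (frac_kernel (\<rho> 1 - \<rho> j))) (cutoff T \<phi>) t)" for j
    have dj: "has_caputo_derivative (\<rho> j) W (d j) t" if j: "j \<in> {1..M}" for j
    proof (cases "j = 1")
      case True
      then show ?thesis unfolding W_def d_def using caputo_frac_integral[OF rho1 t \<phi>] by simp
    next
      case False
      then have "\<rho> j < \<rho> 1" using rho_dec[of j] j by auto
      then show ?thesis unfolding W_def d_def using False rho[OF j] caputo_frac_integral_lower[OF _ _ rho1(2) t \<phi>] by auto
    qed
    have "(\<Sum>j=1..M. q j *\<^sub>R d j) = \<phi> t + (\<Sum>j=2..M. q j *\<^sub>R d j)"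
      unfolding sum_split_first q1 by (simp add: d_def)
    also have "(\<Sum>j=2..M. q j *\<^sub>R d j) = (\<Sum>j=2..M. q j *\<^sub>R conv (cutoff T (frac_kernel (\<rho> 1 - \<rho> j))) (cutoff T \<phi>) t)"
      by (rule sum.cong) (auto simp: d_def)
    also have "\<dots> = conv (low_kernel T) (cutoff T \<phi>) t"
      unfolding low_kernel_def
      by (rule conv_kernel_sum[OF _ phm phb, symmetric]) (use rho_dec in \<open>auto intro: integrable_cutoff_frac_kernel\<close>)
    also have "\<phi> t + \<dots> = f t - A (W t)" using \<phi>eq[of t] AW[of t] t by (simp add: F_def)
    finally have "(\<Sum>j=1..M. q j *\<^sub>R d j) + A (W t) = f t" by simp
    then show "\<exists>d. (\<forall>j\<in>{1..M}. has_caputo_derivative (\<rho> j) W (d j) t) \<and> (\<Sum>j=1..M. q j *\<^sub>R d j) + A (W t) = f t"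
      using dj by blast
  qed
qed

lemma A_linear:
  assumes "x \<in> D" "y \<in> D"
  shows "x + c *\<^sub>R y \<in> D" and "A (x + c *\<^sub>R y) = A x + c *\<^sub>R A y"
proof -
  have "inner (A x + c *\<^sub>R A y) (v n) = lam n * inner (x + c *\<^sub>R y) (v n)" for n
    by (simp add: inner_add_left A_coeff[OF assms(1)] A_coeff[OF assms(2)] algebra_simps)
  then show "x + c *\<^sub>R y \<in> D" and "A (x + c *\<^sub>R y) = A x + c *\<^sub>R A y"
    using in_domain_if_coeffs by blast+
qed

text \<open>
  The condition at the final time is left out, so that the solutions for a given right-hand side form an affine space.
\<close>

definition solves :: "(real \<Rightarrow> 'a) \<Rightarrow> (real \<Rightarrow> 'a) \<Rightarrow> bool" where
  "solves u f \<longleftrightarrow> continuous_on {0..T} u \<and>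
     (\<forall>t\<in>{0<..<T}. u t \<in> D \<and> (\<exists>d. (\<forall>j\<in>{1..M}. has_caputo_derivative (\<rho> j) u (d j) t) \<and>
             (\<Sum>j=1..M. q j *\<^sub>R d j) + A (u t) = f t))"

lemma backward_solution_iff: "backward_solution D A M \<rho> q T f \<Phi> u \<longleftrightarrow> solves u f \<and> u T = \<Phi>"
  by (auto simp: backward_solution_def solves_def)

lemma solves_combine:
  assumes u: "solves u f" and w: "solves w g"
  shows "solves (\<lambda>t. u t + c *\<^sub>R w t) (\<lambda>t. f t + c *\<^sub>R g t)"
  unfolding solves_def
proof (intro conjI ballI)
  show "continuous_on {0..T} (\<lambda>t. u t + c *\<^sub>R w t)"
    using u w unfolding solves_def by (intro continuous_intros) auto
  fix t assume t: "t \<in> {0<..<T}"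
  have uD: "u t \<in> D" and wD: "w t \<in> D" using u w t by (auto simp: solves_def)
  show "u t + c *\<^sub>R w t \<in> D" by (rule A_linear(1)[OF uD wD])
  obtain d where d: "\<And>j. j \<in> {1..M} \<Longrightarrow> has_caputo_derivative (\<rho> j) u (d j) t" "(\<Sum>j=1..M. q j *\<^sub>R d j) + A (u t) = f t"
    using u t unfolding solves_def by blast
  obtain e where e: "\<And>j. j \<in> {1..M} \<Longrightarrow> has_caputo_derivative (\<rho> j) w (e j) t" "(\<Sum>j=1..M. q j *\<^sub>R e j) + A (w t) = g t"
    using w t unfolding solves_def by blast
  have "has_caputo_derivative (\<rho> j) (\<lambda>t. u t + c *\<^sub>R w t) (d j + c *\<^sub>R e j) t" if "j \<in> {1..M}" for j
    by (rule has_caputo_derivative_add[OF d(1)[OF that] has_caputo_derivative_linear[OF e(1)[OF that] bounded_linear_scaleR_right]])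
  moreover have "(\<Sum>j=1..M. q j *\<^sub>R (d j + c *\<^sub>R e j)) + A (u t + c *\<^sub>R w t) = f t + c *\<^sub>R g t"
    unfolding A_linear(2)[OF uD wD] d(2)[symmetric] e(2)[symmetric]
    by (simp add: scaleR_add_right sum.distrib scaleR_sum_right mult.commute)
  ultimately show "\<exists>d. (\<forall>j\<in>{1..M}. has_caputo_derivative (\<rho> j) (\<lambda>t. u t + c *\<^sub>R w t) (d j) t) \<and>
             (\<Sum>j=1..M. q j *\<^sub>R d j) + A (u t + c *\<^sub>R w t) = f t + c *\<^sub>R g t"
    by (intro exI[of _ "\<lambda>j. d j + c *\<^sub>R e j"]) auto
qed

lemma solves_free_evolution: "solves (free_evolution y) (\<lambda>_. 0)"
  unfolding solves_def using free_evolution_solves[of _ y] T by auto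

text \<open>
  At a positive maximum all Caputo derivatives would be nonnegative and \<open>lam n\<close> times the value positive,
  but these terms add up to \<open>0\<close>.
\<close>

lemma homogeneous_coeff_nonpos:
  assumes w: "solves w (\<lambda>_. 0)" and w0: "w 0 = 0" and t: "0 \<le> t" "t < T"
  shows "inner (w t) (v n) \<le> 0"
proof (rule ccontr)
  assume neg: "\<not> inner (w t) (v n) \<le> 0"
  define h where "h s = inner (w s) (v n)" for s
  have hc: "continuous_on {0..T} h" unfolding h_def using w unfolding solves_def by (intro continuous_intros) auto
  have "\<exists>m\<in>{0..t}. \<forall>s\<in>{0..t}. h s \<le> h m"
    by (rule continuous_attains_sup) (use t hc in \<open>auto intro: continuous_on_subset\<close>)
  then obtain m where m: "m \<in> {0..t}" "\<And>s. s \<in> {0..t} \<Longrightarrow> h s \<le> h m" by blast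
  have hm: "0 < h m" using m(2)[of t] neg t by (simp add: h_def)
  have m0: "0 < m" using hm m(1) w0 by (cases "m = 0") (auto simp: h_def)
  have mT: "m \<in> {0<..<T}" using m m0 t by auto
  obtain d where d: "\<And>j. j \<in> {1..M} \<Longrightarrow> has_caputo_derivative (\<rho> j) w (d j) m" "(\<Sum>j=1..M. q j *\<^sub>R d j) + A (w m) = 0"
    and wD: "w m \<in> D"
    using w mT unfolding solves_def by blast
  have nn: "0 \<le> inner (d j) (v n)" if j: "j \<in> {1..M}" for j
  proof (rule caputo_nonneg_at_max[OF m0])
    show "has_caputo_derivative (\<rho> j) h (inner (d j) (v n)) m"
      unfolding h_def by (rule has_caputo_derivative_linear[OF d(1)[OF j] bounded_linear_inner_left])
    show "continuous_on {0..m} h" by (rule continuous_on_subset[OF hc]) (use mT in auto)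
    show "h s \<le> h m" if "s \<in> {0..m}" for s using m that by auto
  qed (use rho[OF j] in auto)
  have "0 \<le> (\<Sum>j=1..M. q j * inner (d j) (v n))"
    using nn q_pos by (intro sum_nonneg mult_nonneg_nonneg) (auto simp: less_imp_le)
  moreover have "(\<Sum>j=1..M. q j * inner (d j) (v n)) + lam n * h m = 0"
    using arg_cong[OF d(2), of "\<lambda>x. inner x (v n)"] by (simp add: inner_add_left inner_sum_left A_coeff[OF wD] h_def)
  moreover have "0 < lam n * h m" using lam_pos[of n] hm by simp
  ultimately show False by linarith
qed

lemma homogeneous_unique:
  assumes w: "solves w (\<lambda>_. 0)" and w0: "w 0 = 0" and t: "t \<in> {0..T}"
  shows "w t = 0"
proof -
  have wm: "solves (\<lambda>t. - w t) (\<lambda>_. 0)"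
    using solves_combine[OF solves_combine[OF w w, of "-1"] w, of "-1"] by simp
  have in0: "w s = 0" if "0 \<le> s" "s < T" for s
  proof (rule zero_if_coeffs_zero)
    fix n
    show "inner (w s) (v n) = 0"
      using homogeneous_coeff_nonpos[OF w w0 that, of n] homogeneous_coeff_nonpos[OF wm _ that, of n] w0 by simp
  qed
  show ?thesis
  proof (rule continuous_constant_on_closure[of "{0<..<T}" w])
    show "continuous_on (closure {0<..<T}) w" using w T by (simp add: solves_def)
    show "t \<in> closure {0<..<T}" using t T by simp
  qed (use in0 in auto)
qed

text \<open>
  The difference of two solutions is the free evolution of its initial value \<open>y\<close>, and in every mode the relaxation
  is positive at the final time.
\<close>

lemma solution_unique:
  assumes u: "solves u f" and w: "solves w f" and uT: "u T = w T" and t: "t \<in> {0..T}"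
  shows "u t = w t"
proof -
  define y where "y = u 0 - w 0"
  have 1: "solves (\<lambda>t. (u t + (-1) *\<^sub>R w t) + (-1) *\<^sub>R free_evolution y t) (\<lambda>_. 0)"
    using solves_combine[OF solves_combine[OF u w, of "-1"] solves_free_evolution[of y], of "-1"] by simp
  have eq: "u s - w s = free_evolution y s" if "s \<in> {0..T}" for s
    using homogeneous_unique[OF 1 _ that] by (simp add: free_evolution_0 y_def)
  have "y = 0"
  proof (rule zero_if_coeffs_zero)
    fix n
    have "free_evolution y T = 0" using eq[of T] T uT by simp
    then have "relaxation (lam n) T * inner y (v n) = 0" using coeff_free_evolution[of y T n] by simp
    then show "inner y (v n) = 0" using relaxation_pos[OF less_imp_le[OF lam_pos] T, of n] by simp
  qed
  then have "free_evolution y t = 0" by (intro zero_if_coeffs_zero) (simp add: coeff_free_evolution)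
  then show ?thesis using eq[OF t] by simp
qed

definition stability :: real where
  "stability = (lam 0 + k T) / (lam 0 * k T)"

lemma stability_pos: "0 < stability"
  unfolding stability_def using lam0 k_pos[OF T] by simp

text \<open>
  The stability constant of the backward problem: inverting the evolution costs one power of \<open>A\<close>.
\<close>

lemma inverse_relaxation_le: "\<bar>1 / (lam n * relaxation (lam n) T)\<bar> \<le> stability"
proof -
  have kT: "0 < k T" by (rule k_pos[OF T])
  have r: "0 < relaxation (lam n) T" by (rule relaxation_pos[OF less_imp_le[OF lam_pos] T])
  have "k T \<le> (lam n + k T) * relaxation (lam n) T" by (rule relaxation_lower[OF less_imp_le[OF lam_pos] T])
  also have "\<dots> \<le> lam n * (1 + k T / lam 0) * relaxation (lam n) T"
  proof -
    have "k T \<le> lam n * (k T / lam 0)" using lam_ge[of n] lam0 kT by (simp add: field_simps)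
    then show ?thesis using r by (intro mult_right_mono) (auto simp: algebra_simps)
  qed
  finally have "k T \<le> (lam n * relaxation (lam n) T) * ((lam 0 + k T) / lam 0)" using lam0 by (simp add: field_simps)
  then show ?thesis using kT r lam_pos[of n] lam0 by (simp add: stability_def field_simps)
qed

text \<open>
  The initial value of the free part is determined by its final value \<open>\<Phi> - W T\<close>.
\<close>

lemma backward_solution_constructed:
  assumes f: "frac_continuous_on v lam \<epsilon> {0..T} f" and \<Phi>: "\<Phi> \<in> D"
  obtains u where "solves u f" and "u T = \<Phi>"
    and "\<And>N. (\<And>t. t \<in> {0..T} \<Longrightarrow> frac_norm v lam \<epsilon> (f t) \<le> N) \<Longrightarrow>
           norm (u 0) \<le> stability * (norm (A \<Phi>) + integral\<^sup>L lborel smoothing_bound * N)"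
proof -
  obtain W where W: "continuous_on {0..T} W" "W 0 = 0" "\<And>t. t \<in> {0..T} \<Longrightarrow> W t \<in> D"
    "\<And>t. 0 < t \<Longrightarrow> t \<le> T \<Longrightarrow> \<exists>d. (\<forall>j\<in>{1..M}. has_caputo_derivative (\<rho> j) W (d j) t) \<and> (\<Sum>j=1..M. q j *\<^sub>R d j) + A (W t) = f t"
    "\<And>N. (\<And>t. t \<in> {0..T} \<Longrightarrow> frac_norm v lam \<epsilon> (f t) \<le> N) \<Longrightarrow> norm (A (W T)) \<le> integral\<^sup>L lborel smoothing_bound * N"
    using forced_solution_exists[OF f] by blast
  have Ws: "solves W f" unfolding solves_def using W(1,3,4) by auto
  have WT: "W T \<in> D" using W(3)[of T] T by simp
  define z where "z = A \<Phi> - A (W T)"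
  define y where "y = diag v (\<lambda>n. 1 / (lam n * relaxation (lam n) T)) z"
  define u where "u t = W t + 1 *\<^sub>R free_evolution y t" for t
  show ?thesis
  proof (rule that[of u])
    show "solves u f" unfolding u_def using solves_combine[OF Ws solves_free_evolution[of y], of 1] by simp
    show "u T = \<Phi>"
    proof (rule eq_if_coeffs_eq)
      fix n
      have "relaxation (lam n) T \<noteq> 0" using relaxation_pos[OF less_imp_le[OF lam_pos] T, of n] by simp
      moreover have "inner y (v n) = 1 / (lam n * relaxation (lam n) T) * inner z (v n)"
        unfolding y_def by (rule coeff_diag[OF inverse_relaxation_le])
      moreover have "inner z (v n) = lam n * (inner \<Phi> (v n) - inner (W T) (v n))"
        by (simp add: z_def inner_diff_left A_coeff[OF \<Phi>] A_coeff[OF WT] right_diff_distrib)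
      ultimately show "inner (u T) (v n) = inner \<Phi> (v n)"
        using lam_pos[of n] by (simp add: u_def inner_add_left coeff_free_evolution)
    qed
    fix N assume N: "\<And>t. t \<in> {0..T} \<Longrightarrow> frac_norm v lam \<epsilon> (f t) \<le> N"
    have "norm (u 0) = norm y" by (simp add: u_def W(2) free_evolution_0)
    also have "\<dots> \<le> stability * norm z" unfolding y_def by (rule norm_diag_le[OF inverse_relaxation_le])
    also have "\<dots> \<le> stability * (norm (A \<Phi>) + integral\<^sup>L lborel smoothing_bound * N)"
    proof (rule mult_left_mono)
      have "norm z \<le> norm (A \<Phi>) + norm (A (W T))" unfolding z_def by (rule norm_triangle_ineq4)
      then show "norm z \<le> norm (A \<Phi>) + integral\<^sup>L lborel smoothing_bound * N" using W(5)[OF N] by simp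
    qed (use stability_pos in simp)
    finally show "norm (u 0) \<le> stability * (norm (A \<Phi>) + integral\<^sup>L lborel smoothing_bound * N)" .
  qed
qed

lemma frac_norm_one:
  assumes "x \<in> D"
  shows "frac_norm v lam 1 x = norm (A x)"
proof -
  have "(\<lambda>n. (lam n powr 1 * inner x (v n)) *\<^sub>R v n) = (\<lambda>n. inner (A x) (v n) *\<^sub>R v n)"
    using A_coeff[OF assms] lam_pos by (simp add: less_imp_le)
  then have "frac_power v lam 1 x = A x"
    unfolding frac_power_def using sums_unique[OF expansion[of "A x"]] by simp
  then show ?thesis by (simp add: frac_norm_def)
qed

lemma backward_problem_well_posed:
  "(\<forall>f \<Phi>. frac_continuous_on v lam \<epsilon> {0..T} f \<and> \<Phi> \<in> D \<longrightarrow>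
            (\<exists>u. backward_solution D A M \<rho> q T f \<Phi> u \<and>
                 (\<forall>w. backward_solution D A M \<rho> q T f \<Phi> w \<longrightarrow> (\<forall>t\<in>{0..T}. w t = u t)))) \<and>
         (\<exists>C>0. \<forall>f \<Phi> u. frac_continuous_on v lam \<epsilon> {0..T} f \<and> \<Phi> \<in> D \<and>
            backward_solution D A M \<rho> q T f \<Phi> u \<longrightarrow>
            norm (u 0) \<le> C * (frac_norm v lam 1 (u T) + (SUP t\<in>{0..T}. frac_norm v lam \<epsilon> (f t))))"
proof (intro conjI allI impI)
  fix f \<Phi> assume as: "frac_continuous_on v lam \<epsilon> {0..T} f \<and> \<Phi> \<in> D"
  then obtain u where u: "solves u f" "u T = \<Phi>" using backward_solution_constructed by blast
  then show "\<exists>u. backward_solution D A M \<rho> q T f \<Phi> u \<and>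
                 (\<forall>w. backward_solution D A M \<rho> q T f \<Phi> w \<longrightarrow> (\<forall>t\<in>{0..T}. w t = u t))"
    unfolding backward_solution_iff by (intro exI[of _ u]) (auto intro: solution_unique)
next
  define b where "b = integral\<^sup>L lborel smoothing_bound"
  have b: "0 \<le> b" unfolding b_def using smoothing_bound_nonneg by (intro Bochner_Integration.integral_nonneg) auto
  define C where "C = stability * (1 + b)"
  have C: "0 < C" unfolding C_def using stability_pos b by simp
  have est: "norm (u 0) \<le> C * (frac_norm v lam 1 (u T) + (SUP t\<in>{0..T}. frac_norm v lam \<epsilon> (f t)))"
    if f: "frac_continuous_on v lam \<epsilon> {0..T} f" and \<Phi>: "\<Phi> \<in> D" and u: "backward_solution D A M \<rho> q T f \<Phi> u" for f \<Phi> u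
  proof -
    define N where "N = (SUP t\<in>{0..T}. frac_norm v lam \<epsilon> (f t))"
    have "continuous_on {0..T} (\<lambda>t. frac_norm v lam \<epsilon> (f t))"
      unfolding frac_norm_def by (intro continuous_intros continuous_on_frac_power[OF f])
    then have "bdd_above ((\<lambda>t. frac_norm v lam \<epsilon> (f t)) ` {0..T})"
      by (intro bounded_imp_bdd_above compact_imp_bounded compact_continuous_image) auto
    then have N: "frac_norm v lam \<epsilon> (f t) \<le> N" if "t \<in> {0..T}" for t
      unfolding N_def using that by (intro cSUP_upper)
    have N0: "0 \<le> N" using N[of 0] T by (simp add: frac_norm_def order_trans[OF norm_ge_zero])
    obtain w where w: "solves w f" "w T = \<Phi>" and wb: "norm (w 0) \<le> stability * (norm (A \<Phi>) + b * N)"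
      using backward_solution_constructed[OF f \<Phi>] N unfolding b_def by blast
    have us: "solves u f" "u T = \<Phi>" using u unfolding backward_solution_iff by auto
    have "u 0 = w 0" by (rule solution_unique[OF us(1) w(1)]) (use us w T in auto)
    moreover have "norm (A \<Phi>) + b * N \<le> (1 + b) * (norm (A \<Phi>) + N)"
      using b N0 by (simp add: algebra_simps)
    then have "stability * (norm (A \<Phi>) + b * N) \<le> stability * ((1 + b) * (norm (A \<Phi>) + N))"
      using stability_pos by (intro mult_left_mono) auto
    ultimately have "norm (u 0) \<le> stability * ((1 + b) * (norm (A \<Phi>) + N))"
      using wb by simp
    then show ?thesis using frac_norm_one[OF \<Phi>] us by (simp add: C_def N_def mult.assoc)
  qed
  show "\<exists>C>0. \<forall>f \<Phi> u. frac_continuous_on v lam \<epsilon> {0..T} f \<and> \<Phi> \<in> D \<and>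
            backward_solution D A M \<rho> q T f \<Phi> u \<longrightarrow>
            norm (u 0) \<le> C * (frac_norm v lam 1 (u T) + (SUP t\<in>{0..T}. frac_norm v lam \<epsilon> (f t)))"
    using C est by blast
qed

end

theorem theorem4p3:
  fixes D :: "'a::{real_inner, banach, second_countable_topology} set"
    and A :: "'a \<Rightarrow> 'a"
    and v :: "nat \<Rightarrow> 'a" and lam :: "nat \<Rightarrow> real"
    and M :: nat and \<rho> q :: "nat \<Rightarrow> real" and T \<epsilon> :: real
  assumes "self_adjoint_on D A" and "positive_on D A" and "has_compact_inverse_on D A"
    and "eigensystem D A v lam"
    and "T > 0" and "M \<ge> 1"
    and "\<forall>j\<in>{1..M}. 0 < \<rho> j \<and> \<rho> j < 1"
    and "\<forall>i\<in>{1..M}. \<forall>j\<in>{1..M}. i < j \<longrightarrow> \<rho> j < \<rho> i"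
    and "\<forall>j\<in>{1..M}. q j > 0" and "q 1 = 1"
    and "0 < \<epsilon>" and "\<epsilon> < 1"
  shows "(\<forall>f \<Phi>. frac_continuous_on v lam \<epsilon> {0..T} f \<and> \<Phi> \<in> D \<longrightarrow>
            (\<exists>u. backward_solution D A M \<rho> q T f \<Phi> u \<and>
                 (\<forall>w. backward_solution D A M \<rho> q T f \<Phi> w \<longrightarrow> (\<forall>t\<in>{0..T}. w t = u t)))) \<and>
         (\<exists>C>0. \<forall>f \<Phi> u. frac_continuous_on v lam \<epsilon> {0..T} f \<and> \<Phi> \<in> D \<and>
            backward_solution D A M \<rho> q T f \<Phi> u \<longrightarrow>
            norm (u 0) \<le> C * (frac_norm v lam 1 (u T) + (SUP t\<in>{0..T}. frac_norm v lam \<epsilon> (f t))))"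
proof -
  have es: "inner (v i) (v j) = (if i = j then 1 else 0)" "closure (span (range v)) = UNIV"
    "v n \<in> D" "A (v n) = lam n *\<^sub>R v n" "0 < lam 0" "mono lam" for i j n
    using assms(4) by (simp_all add: eigensystem_def)
  have sa: "(\<forall>x\<in>D. inner (A x) y = inner x z) \<longleftrightarrow> y \<in> D \<and> z = A y" for y z
    using assms(1) by (simp add: self_adjoint_on_def)
  have bij: "bij_betw A D UNIV" using assms(3) by (simp add: has_compact_inverse_on_def)
  interpret backward v M \<rho> q D A lam T \<epsilon>
  proof
    show "inner (A x) (v n) = lam n * inner x (v n)" if "x \<in> D" for x n
      using sa[of "v n" "lam n *\<^sub>R v n"] es that by simp
    show "\<exists>x\<in>D. A x = z" for z using bij by (metis UNIV_I bij_betw_imp_surj_on imageE)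
    show "\<rho> j < \<rho> 1" if "j \<in> {2..M}" for j
      using assms(8) assms(6) that by auto
  qed (use es assms in auto)
  show ?thesis by (rule backward_problem_well_posed)
qed

end
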